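(* Let $k$ be a field, $X$ a well-ordered set, and $\Omega=\{P\}$ with $P$ a unary operator. Let $S_N\subseteq Lie(\{P\};X)$ be the set of all Lie $\{P\}$-polynomials $$f^N_{u,v}=(P([u])P([v]))-P((P([u])[v]))-P(([u]P([v])))+P^2(([u][v])),$$ where $u,v\in ALSW(\{P\};X)$ and $u>_{Dl}v$. Then, with the order $>_{Dl}$ on $\langle\{P\};X\rangle$, the set $S_N$ is a Gröbner-Shirshov basis in $Lie(\{P\};X)$. It follows that the set $$Irr(S_N)=\left\{[w]\in NLSW(\{P\};X) : w\neq\pi|_{P(u)P(v)}\ \text{for all}\ \pi\in\langle\{P\};X\rangle^\star,\ u,v\in ALSW(\{P\};X)\ \text{with}\ u>_{Dl}v\right\}$$ is a linear basis of the free Nijenhuis Lie algebra $NL(X)=Lie(\{P\};X|S_N)=Lie(\{P\};X)/Id_{Lie}(S_N)$ on $X$.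
   Context: A Nijenhuis Lie algebra is a Lie algebra $L$ over $k$ with a linear map $P:L\to L$ satisfying $[P(x)P(y)]=P([P(x)y])+P([xP(y)])-P^2([xy])$ for all $x,y\in L$; free objects on $X$ are in the usual sense (homomorphisms commute with $P$). The definitions below are for a general operator set $\Omega$; in the claim $\Omega=\{P\}$ with $P$ unary. **Words.** $k$ is a field, $X$ a set, $\Omega=\bigcup_{m\ge1}\Omega_m$ where $\Omega_m$ is a set of $m$-ary operator symbols; $X$ and $\Omega$ carry well orders. For a set $Y$: $S(Y)$ is the set of nonempty associative words on $Y$, $Y^*=S(Y)\cup\{1\}$ ($1$ the empty word), and $\Omega(Y)=\bigcup_m\{\omega(y_1,\dots,y_m): y_i\in Y,\ \omega\in\Omega_m\}$ (formal expressions). Put $\langle\Omega;X\rangle_0=S(X)$, $\langle\Omega;X\rangle_n=S(X\cup\Omega(\langle\Omega;X\rangle_{n-1}))$, $\langle\Omega;X\rangle=\bigcup_n\langle\Omega;X\rangle_n$ (associative $\Omega$-words). **Order.** Elements of $X\cup\Omega(\langle\Omega;X\rangle)$ are called prime; each $u\in\langle\Omega;X\rangle$ is uniquely $u=u_1\cdots u_n$ with $u_i$ prime, and $bre(u)=n$; $deg(u)$ is the total number of occurrences of elements of $X$ and $\Omega$ in $u$. Put $wt(u)=(deg(u),bre(u),u_1,\dots,u_n)$. The order $>_{Dl}$ on $\langle\Omega;X\rangle$: $u>_{Dl}v$ iff $wt(u)>wt(v)$ lexicographically, where primes are compared first by degree; primes of degree $1$ are elements of $X$, compared by the order of $X$;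 primes $\omega(a_1,\dots,a_t)$, $\theta(b_1,\dots,b_l)$ of equal degree are compared by comparing $(\omega,a_1,\dots,a_t)$ and $(\theta,b_1,\dots,b_l)$ lexicographically (operators by the order of $\Omega$, arguments recursively by $>_{Dl}$). Let $\succ$ be the restriction of $>_{Dl}$ to prime elements. **Lyndon-Shirshov words.** For an ordered set $Z$, the lex order on $Z^*$: $1>_{lex}u$ for every nonempty $u$, and $zu'>_{lex}z'v'$ ($z,z'\in Z$) iff $z>z'$, or $z=z'$ and $u'>_{lex}v'$. $ALSW(Z)$ is the set of nonempty words $w$ with $uv>_{lex}vu$ for every factorization $w=uv$ with $u,v\ne1$. $NLSW(Z)$ is the set of non-associative (fully bracketed) words $(u)$ such that: the underlying associative word $u$ is in $ALSW(Z)$; if $(u)=((v)(w))$ then $(v),(w)\in NLSW(Z)$; and if moreover $(v)=((v_1)(v_2))$ then $v_2\le_{lex}w$. Each $u\in ALSW(Z)$ has exactly one bracketing $[u]\in NLSW(Z)$ (the Shirshov standard bracketing). **Lyndon-Shirshov $\Omega$-words.** $ALSW(\Omega;X)_0=ALSW(X)$, $ALSW(\Omega;X)_n=ALSW(X\cup\Omega(ALSW(\Omega;X)_{n-1}))$ with respect to $\succ_{lex}$, and $ALSW(\Omega;X)=\bigcup_nALSW(\Omega;X)_n$. The bracketing $[u]$ of $u\in ALSW(\Omega;X)$: $[x]=x$ for $x\in X$; $[\omega(u_1,\dots,u_m)]=\omega([u_1],\dots,[u_m])$; for $u=u_1\cdots u_m$ with $u_i$ prime, $[u]$ is the Shirshov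 standard bracketing of the word $[u_1][u_2]\cdots[u_m]$ in the letters $[u_1],\dots,[u_m]$, ordered by $[p]\succ[q]$ iff $p\succ q$. $NLSW(\Omega;X)=\{[u]:u\in ALSW(\Omega;X)\}$. **Algebras.** A Lie $\Omega$-algebra is a Lie $k$-algebra with, for each $\omega\in\Omega_m$, an $m$-ary multilinear operation; an ideal of it is a Lie ideal $I$ such that $\omega(a_1,\dots,a_m)\in I$ whenever some $a_i\in I$. $Id_{Lie}(S)$ is the ideal of $Lie(\Omega;X)$ generated by $S$. $k\langle\Omega;X\rangle$ is the $k$-space with basis $\langle\Omega;X\rangle$, with concatenation as product and operators extended multilinearly. $Lie(\Omega;X)$ is the Lie $\Omega$-subalgebra of $k\langle\Omega;X\rangle$ generated by $X$ under $(uv)=uv-vu$ (and all operators); the elements $[u]$ are regarded as elements of $Lie(\Omega;X)$ by reading brackets as commutators. For $0\ne f\in k\langle\Omega;X\rangle$, $\bar f$ is the leading (largest) $\Omega$-word of $f$ with respect to $>_{Dl}$; $f$ is monic if the coefficient of $\bar f$ is $1$; a set is monic if all its elements are. (For $0\neq f\in Lie(\Omega;X)$ one has $\bar f\in ALSW(\Omega;X)$.) **Special normal words.** $\langle\Omega;X\rangle^\star$ is the set of $\star$-$\Omega$-words: associative $\Omega$-words on $X\cup\{\star\}$ with exactly one occurrence of $\star\notin X$; $\pi|_s$ is the result of substituting $s$ for $\star$ in $\pi$ (expanded multilinearly). If $v,\pi|_v\in ALSW(\Omega;X)$, there are $\pi_1\in\langle\Omega;X\rangle^\star$ and a possibly empty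 $\Omega$-word $c$ with $[\pi|_v]=[\pi_1|_{[vc]}]$, i.e. $\pi=\pi_1|_{\star c}$, $vc\in ALSW(\Omega;X)$, and the bracketed word $[\pi|_v]$ has $[vc]$ as a bracketed subword at the place of $\star$ in $\pi_1$. Write (uniquely) $c=c_1\cdots c_m$ with $c_i\in ALSW(\Omega;X)$, $c_t\preceq_{lex}c_{t+1}$, and let $[\pi|_v]_v$ be obtained from $[\pi|_v]$ by replacing this subword $[vc]$ by $[\cdots[[[v][c_1]][c_2]]\cdots[c_m]]$; a choice of $(\pi_1,c)$ is fixed for each $(\pi,v)$. For monic $f\in Lie(\Omega;X)$ with $\pi|_{\bar f}\in ALSW(\Omega;X)$, the special normal $f$-word $[\pi|_f]_{\bar f}\in Lie(\Omega;X)$ is obtained from $[\pi|_{\bar f}]_{\bar f}$ by replacing the distinguished factor $[\bar f]$ by $f$. **Compositions.** Let $f,g\in Lie(\Omega;X)$ be monic. (a) If $w=\bar fa=b\bar g$ with $a,b\in\langle\Omega;X\rangle$ and $bre(w)<bre(\bar f)+bre(\bar g)$, then $\langle f,g\rangle_w=[fa]_{\bar f}-[bg]_{\bar g}$ (intersection composition; $\pi=\star a$ and $\pi=b\star$ respectively). (b) If $w=\bar f=\pi|_{\bar g}$ with $\pi\in\langle\Omega;X\rangle^\star$, then $\langle f,g\rangle_w=f-[\pi|_g]_{\bar g}$ (inclusion composition). A composition is trivial modulo $(S,w)$ if it equals a finite sum $\sum\alpha_i[\pi_i|_{s_i}]_{\overline{s_i}}$ with $\alpha_i\in k$, $s_i\in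 S$, $[\pi_i|_{s_i}]_{\overline{s_i}}$ special normal $s_i$-words and $\pi_i|_{\overline{s_i}}<_{Dl}w$. A monic set $S\subseteq Lie(\Omega;X)$ is a Gröbner-Shirshov basis in $Lie(\Omega;X)$ if every composition $\langle f,g\rangle_w$ of $f,g\in S$ is trivial modulo $(S,w)$. *)

theory Defs
  imports Complex_Main "HOL-Library.Poly_Mapping"
begin

section \<open>Associative words with one unary operator\<close>

text \<open>Words over \<open>Y\<close> in the operator set \<open>{P}\<close> are lists of primes; \<open>Op w\<close> stands for \<open>P(w)\<close>.
  The empty list is the empty word. The type also contains expressions with \<open>P\<close> applied to the
  empty word; these are excluded from \<open>owords\<close>, which is the set of nonempty associative
  \<open>{P}\<close>-words.\<close>

datatype 'y oprime = Ltr 'y | Op "'y oprime list"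

type_synonym 'y oword = "'y oprime list"

primrec oword_level :: "nat \<Rightarrow> 'y oword set" where
  "oword_level 0 = {w. w \<noteq> [] \<and> set w \<subseteq> range Ltr}"
| "oword_level (Suc n) = {w. w \<noteq> [] \<and> set w \<subseteq> range Ltr \<union> Op ` oword_level n}"

definition owords :: "'y oword set" where
  "owords = (\<Union>n. oword_level n)"

primrec pdeg :: "'y oprime \<Rightarrow> nat" where
  "pdeg (Ltr y) = 1"
| "pdeg (Op w) = Suc (sum_list (map pdeg w))"

definition odeg :: "'y oword \<Rightarrow> nat" where
  "odeg w = sum_list (map pdeg w)"

text \<open>\<open>dl_less u v\<close> is \<open>u <\<^sub>D\<^sub>l v\<close>. The breadth of a word is its length. As there is only one
  operator, comparing \<open>(P, a)\<close> with \<open>(P, b)\<close> is comparing \<open>a\<close> with \<open>b\<close>. On primes,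
  \<open>prime_less p q\<close> is \<open>dl_less [p] [q]\<close>.\<close>

inductive prime_less :: "'x::wellorder oprime \<Rightarrow> 'x oprime \<Rightarrow> bool"
  and dl_less :: "'x::wellorder oword \<Rightarrow> 'x oword \<Rightarrow> bool" where
  "pdeg p < pdeg q \<Longrightarrow> prime_less p q"
| "x < y \<Longrightarrow> prime_less (Ltr x) (Ltr y)"
| "pdeg (Op a) = pdeg (Op b) \<Longrightarrow> dl_less a b \<Longrightarrow> prime_less (Op a) (Op b)"
| "odeg u < odeg v \<Longrightarrow> dl_less u v"
| "odeg u = odeg v \<Longrightarrow> length u < length v \<Longrightarrow> dl_less u v"
| "odeg (r @ p # s) = odeg (r @ q # t) \<Longrightarrow> length s = length t \<Longrightarrow> prime_less p q
    \<Longrightarrow> dl_less (r @ p # s) (r @ q # t)"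

abbreviation prime_greater :: "'x::wellorder oprime \<Rightarrow> 'x oprime \<Rightarrow> bool" where
  "prime_greater p q \<equiv> prime_less q p"


section \<open>Lyndon--Shirshov words over an ordered alphabet\<close>

text \<open>Here \<open>gt\<close> is the strict order of the letters. The empty word is the greatest.\<close>

fun lex_greater :: "('z \<Rightarrow> 'z \<Rightarrow> bool) \<Rightarrow> 'z list \<Rightarrow> 'z list \<Rightarrow> bool" where
  "lex_greater gt u [] \<longleftrightarrow> False"
| "lex_greater gt [] (z # v) \<longleftrightarrow> True"
| "lex_greater gt (z # u) (z' # v) \<longleftrightarrow> gt z z' \<or> (z = z' \<and> lex_greater gt u v)"

definition lex_le :: "('z \<Rightarrow> 'z \<Rightarrow> bool) \<Rightarrow> 'z list \<Rightarrow> 'z list \<Rightarrow> bool" where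
  "lex_le gt u v \<longleftrightarrow> u = v \<or> lex_greater gt v u"

definition ALSW_on :: "('z \<Rightarrow> 'z \<Rightarrow> bool) \<Rightarrow> 'z set \<Rightarrow> 'z list set" where
  "ALSW_on gt Z = {w \<in> lists Z. w \<noteq> [] \<and>
     (\<forall>u v. w = u @ v \<and> u \<noteq> [] \<and> v \<noteq> [] \<longrightarrow> lex_greater gt (u @ v) (v @ u))}"

datatype 'z brk = Leaf 'z | Node "'z brk" "'z brk"

primrec frontier :: "'z brk \<Rightarrow> 'z list" where
  "frontier (Leaf z) = [z]"
| "frontier (Node s t) = frontier s @ frontier t"

primrec is_NLSW :: "('z \<Rightarrow> 'z \<Rightarrow> bool) \<Rightarrow> 'z brk \<Rightarrow> bool" where
  "is_NLSW gt (Leaf z) \<longleftrightarrow> [z] \<in> ALSW_on gt UNIV"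
| "is_NLSW gt (Node s t) \<longleftrightarrow> frontier (Node s t) \<in> ALSW_on gt UNIV \<and> is_NLSW gt s \<and> is_NLSW gt t \<and>
     (\<forall>s1 s2. s = Node s1 s2 \<longrightarrow> lex_le gt (frontier s2) (frontier t))"

definition shirshov_bracketing :: "('z \<Rightarrow> 'z \<Rightarrow> bool) \<Rightarrow> 'z list \<Rightarrow> 'z brk" where
  "shirshov_bracketing gt u = (THE t. is_NLSW gt t \<and> frontier t = u)"


section \<open>Lyndon--Shirshov words with operator\<close>

primrec ALSW_level :: "nat \<Rightarrow> 'x::wellorder oword set" where
  "ALSW_level 0 = ALSW_on prime_greater (range Ltr)"
| "ALSW_level (Suc n) = ALSW_on prime_greater (range Ltr \<union> Op ` ALSW_level n)"

definition ALSW :: "'x::wellorder oword set" where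
  "ALSW = (\<Union>n. ALSW_level n)"

datatype 'y naword = NLtr 'y | NOp "'y naword" | NBr "'y naword" "'y naword"

primrec assoc :: "'y naword \<Rightarrow> 'y oword" where
  "assoc (NLtr y) = [Ltr y]"
| "assoc (NOp t) = [Op (assoc t)]"
| "assoc (NBr s t) = assoc s @ assoc t"

primrec naword_of_brk :: "'y naword brk \<Rightarrow> 'y naword" where
  "naword_of_brk (Leaf t) = t"
| "naword_of_brk (Node s t) = NBr (naword_of_brk s) (naword_of_brk t)"

text \<open>\<open>bracketing u\<close> is \<open>[u]\<close>: the standard bracketing of \<open>[u\<^sub>1]\<dots>[u\<^sub>m]\<close> in the letters \<open>[u\<^sub>i]\<close>,
  which are ordered through their underlying associative words.\<close>

definition naword_greater :: "'x::wellorder naword \<Rightarrow> 'x naword \<Rightarrow> bool" where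
  "naword_greater s t \<longleftrightarrow> dl_less (assoc t) (assoc s)"

primrec prime_bracketing :: "'x::wellorder oprime \<Rightarrow> 'x naword" where
  "prime_bracketing (Ltr x) = NLtr x"
| "prime_bracketing (Op u) =
     NOp (naword_of_brk (shirshov_bracketing naword_greater (map prime_bracketing u)))"

definition bracketing :: "'x::wellorder oword \<Rightarrow> 'x naword" where
  "bracketing u = naword_of_brk (shirshov_bracketing naword_greater (map prime_bracketing u))"

definition NLSW :: "'x::wellorder naword set" where
  "NLSW = bracketing ` ALSW"


section \<open>The free associative and the free Lie algebra with operator\<close>

text \<open>With concatenation as addition on lists, the product of \<open>Poly_Mapping\<close> is the linear
  extension of concatenation. The type \<open>'x oword \<Rightarrow>\<^sub>0 'k\<close> is the algebra spanned by \<open>owords\<close>,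
  enlarged by the empty word and the expressions containing \<open>P\<close> of it; these do not
  occur in elements of the subalgebra \<open>Lie\<close> generated by the letters.\<close>

instantiation list :: (type) monoid_add
begin

definition zero_list :: "'a list" where "zero_list = []"

definition plus_list :: "'a list \<Rightarrow> 'a list \<Rightarrow> 'a list" where "plus_list u v = u @ v"

instance
  by standard (simp_all add: zero_list_def plus_list_def)

end

type_synonym ('x, 'k) opoly = "'x oword \<Rightarrow>\<^sub>0 'k"

definition scal :: "'k::field \<Rightarrow> ('x, 'k) opoly \<Rightarrow> ('x, 'k) opoly" where
  "scal c f = Poly_Mapping.map ((*) c) f"

definition gen :: "'x \<Rightarrow> ('x, 'k::field) opoly" where
  "gen x = Poly_Mapping.single [Ltr x] 1"

definition comm :: "('x, 'k::field) opoly \<Rightarrow> ('x, 'k) opoly \<Rightarrow> ('x, 'k) opoly" where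
  "comm f g = f * g - g * f"

definition opP :: "('x, 'k::field) opoly \<Rightarrow> ('x, 'k) opoly" where
  "opP f = (\<Sum>w\<in>Poly_Mapping.keys f. Poly_Mapping.single [Op w] (Poly_Mapping.lookup f w))"

lemma scal_conv_mult: "scal c f = Poly_Mapping.single 0 c * f"
  by (simp add: scal_def mult_map_scale_conv_mult)

lemma lookup_scal: "Poly_Mapping.lookup (scal c f) w = c * Poly_Mapping.lookup f w"
  by (simp add: scal_def Poly_Mapping.map.rep_eq when_def)

lemma vector_space_scal: "vector_space scal"
  by standard (auto intro!: poly_mapping_eqI simp: lookup_scal lookup_add algebra_simps)

interpretation opoly: vector_space scal
  by (rule vector_space_scal)

definition lie_subalgebra :: "('x, 'k::field) opoly set \<Rightarrow> bool" where
  "lie_subalgebra A \<longleftrightarrow> opoly.subspace A \<and> (\<forall>f\<in>A. \<forall>g\<in>A. comm f g \<in> A) \<and> (\<forall>f\<in>A. opP f \<in> A)"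

definition Lie :: "('x, 'k::field) opoly set" where
  "Lie = lie_subalgebra hull (range gen)"

definition lie_ideal :: "('x, 'k::field) opoly set \<Rightarrow> bool" where
  "lie_ideal I \<longleftrightarrow> I \<subseteq> Lie \<and> opoly.subspace I \<and> (\<forall>a\<in>Lie. \<forall>f\<in>I. comm a f \<in> I) \<and> (\<forall>f\<in>I. opP f \<in> I)"

definition Id_Lie :: "('x, 'k::field) opoly set \<Rightarrow> ('x, 'k) opoly set" where
  "Id_Lie S = lie_ideal hull S"

text \<open>Value of a nonassociative word, brackets being read as commutators.\<close>

primrec eval_na :: "('y \<Rightarrow> ('x, 'k::field) opoly) \<Rightarrow> 'y naword \<Rightarrow> ('x, 'k) opoly" where
  "eval_na \<sigma> (NLtr y) = \<sigma> y"
| "eval_na \<sigma> (NOp t) = opP (eval_na \<sigma> t)"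
| "eval_na \<sigma> (NBr s t) = comm (eval_na \<sigma> s) (eval_na \<sigma> t)"

definition LS :: "'x::wellorder oword \<Rightarrow> ('x, 'k::field) opoly" where
  "LS u = eval_na gen (bracketing u)"

definition lead :: "('x::wellorder, 'k::field) opoly \<Rightarrow> 'x oword" where
  "lead f = (THE w. w \<in> Poly_Mapping.keys f \<and> (\<forall>v\<in>Poly_Mapping.keys f. v \<noteq> w \<longrightarrow> dl_less v w))"

definition monic :: "('x::wellorder, 'k::field) opoly \<Rightarrow> bool" where
  "monic f \<longleftrightarrow> f \<noteq> 0 \<and> Poly_Mapping.lookup f (lead f) = 1"


section \<open>Star words and special normal words\<close>

text \<open>The alphabet \<open>X \<union> {\<star>}\<close> is the option type, with \<open>None\<close> as the star.\<close>

primrec psubst :: "('y \<Rightarrow> 'z oword) \<Rightarrow> 'y oprime \<Rightarrow> 'z oword" where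
  "psubst \<sigma> (Ltr y) = \<sigma> y"
| "psubst \<sigma> (Op w) = [Op (concat (map (psubst \<sigma>) w))]"

definition osubst :: "('y \<Rightarrow> 'z oword) \<Rightarrow> 'y oword \<Rightarrow> 'z oword" where
  "osubst \<sigma> w = concat (map (psubst \<sigma>) w)"

primrec nsubst :: "('y \<Rightarrow> 'z naword) \<Rightarrow> 'y naword \<Rightarrow> 'z naword" where
  "nsubst \<sigma> (NLtr y) = \<sigma> y"
| "nsubst \<sigma> (NOp t) = NOp (nsubst \<sigma> t)"
| "nsubst \<sigma> (NBr s t) = NBr (nsubst \<sigma> s) (nsubst \<sigma> t)"

primrec pstars :: "'x option oprime \<Rightarrow> nat" where
  "pstars (Ltr y) = (if y = None then 1 else 0)"
| "pstars (Op w) = sum_list (map pstars w)"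

definition star_words :: "'x option oword set" where
  "star_words = {\<pi> \<in> owords. sum_list (map pstars \<pi>) = 1}"

definition star :: "'x option oprime" where
  "star = Ltr None"

definition emb :: "'x oword \<Rightarrow> 'x option oword" where
  "emb w = map (map_oprime Some) w"

definition plug :: "'x option oword \<Rightarrow> 'x oword \<Rightarrow> 'x oword" where
  "plug \<pi> v = osubst (case_option v (\<lambda>x. [Ltr x])) \<pi>"

definition plug_star :: "'x option oword \<Rightarrow> 'x option oword \<Rightarrow> 'x option oword" where
  "plug_star \<pi> \<rho> = osubst (case_option \<rho> (\<lambda>x. [Ltr (Some x)])) \<pi>"

text \<open>\<open>bracket_split \<pi> v (C, c)\<close>: the bracketed word \<open>[\<pi>|\<^sub>v]\<close> is the bracketed star word \<open>C\<close> with
  \<open>[vc]\<close> in place of the star, where \<open>\<pi>\<^sub>1 = assoc C\<close> satisfies \<open>\<pi> = \<pi>\<^sub>1|\<close> with \<open>\<star>c\<close> substituted.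
  Such a \<open>C\<close> is determined by \<open>\<pi>\<^sub>1\<close> and \<open>c\<close>, so that choosing \<open>(C, c)\<close> amounts to choosing
  \<open>(\<pi>\<^sub>1, c)\<close>.\<close>

definition bracket_split ::
    "'x::wellorder option oword \<Rightarrow> 'x oword \<Rightarrow> 'x option naword \<times> 'x oword \<Rightarrow> bool" where
  "bracket_split \<pi> v = (\<lambda>(C, c).
     assoc C \<in> star_words \<and> (c = [] \<or> c \<in> owords) \<and> plug_star (assoc C) (star # emb c) = \<pi> \<and>
     v @ c \<in> ALSW \<and> nsubst (case_option (bracketing (v @ c)) NLtr) C = bracketing (plug \<pi> v))"

text \<open>The fixed choice for each \<open>(\<pi>, v)\<close> is made by the choice operator; nothing is known about it
  except that it is a valid choice.\<close>

definition chosen_split ::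
    "'x::wellorder option oword \<Rightarrow> 'x oword \<Rightarrow> 'x option naword \<times> 'x oword" where
  "chosen_split \<pi> v = (SOME p. bracket_split \<pi> v p)"

definition LS_factors :: "'x::wellorder oword \<Rightarrow> 'x oword list" where
  "LS_factors c = (THE cs. concat cs = c \<and> set cs \<subseteq> ALSW \<and> successively (lex_le prime_greater) cs)"

text \<open>\<open>special_word \<pi> f\<close> is \<open>[\<pi>|\<^sub>f]\<close> with respect to the leading word of \<open>f\<close>; it is meant for monic \<open>f\<close> in
  \<open>Lie\<close> and \<open>admissible \<pi> f\<close>.\<close>

definition admissible :: "'x option oword \<Rightarrow> ('x::wellorder, 'k::field) opoly \<Rightarrow> bool" where
  "admissible \<pi> f \<longleftrightarrow> \<pi> \<in> star_words \<and> plug \<pi> (lead f) \<in> ALSW"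

definition special_word ::
    "'x option oword \<Rightarrow> ('x::wellorder, 'k::field) opoly \<Rightarrow> ('x, 'k) opoly" where
  "special_word \<pi> f = (let (C, c) = chosen_split \<pi> (lead f) in
     eval_na (case_option (foldl (\<lambda>h d. comm h (LS d)) f (LS_factors c)) gen) C)"


section \<open>Compositions and Groebner--Shirshov bases\<close>

inductive composition ::
    "('x::wellorder, 'k::field) opoly \<Rightarrow> ('x, 'k) opoly \<Rightarrow> 'x oword \<Rightarrow> ('x, 'k) opoly \<Rightarrow> bool"
  for f g :: "('x::wellorder, 'k::field) opoly" where
  intersection: "w = lead f @ a \<Longrightarrow> w = b @ lead g \<Longrightarrow> a \<in> owords \<Longrightarrow> b \<in> owords
    \<Longrightarrow> length w < length (lead f) + length (lead g)
    \<Longrightarrow> composition f g w (special_word (star # emb a) f - special_word (emb b @ [star]) g)"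
| inclusion: "w = lead f \<Longrightarrow> w = plug \<pi> (lead g) \<Longrightarrow> \<pi> \<in> star_words
    \<Longrightarrow> composition f g w (f - special_word \<pi> g)"

definition trivial_mod ::
    "('x::wellorder, 'k::field) opoly set \<Rightarrow> 'x oword \<Rightarrow> ('x, 'k) opoly \<Rightarrow> bool" where
  "trivial_mod S w h \<longleftrightarrow> h \<in> opoly.span
     {special_word \<pi> s | \<pi> s. s \<in> S \<and> admissible \<pi> s \<and> dl_less (plug \<pi> (lead s)) w}"

definition GS_basis :: "('x::wellorder, 'k::field) opoly set \<Rightarrow> bool" where
  "GS_basis S \<longleftrightarrow> S \<subseteq> Lie \<and> (\<forall>s\<in>S. monic s) \<and>
     (\<forall>f\<in>S. \<forall>g\<in>S. \<forall>w h. composition f g w h \<longrightarrow> trivial_mod S w h)"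


section \<open>Nijenhuis Lie algebras\<close>

locale lie_algebra = vector_space scale
  for scale :: "'k::field \<Rightarrow> 'l::ab_group_add \<Rightarrow> 'l" +
  fixes br :: "'l \<Rightarrow> 'l \<Rightarrow> 'l"
  assumes br_linear_left: "Vector_Spaces.linear scale scale (\<lambda>x. br x y)"
    and br_linear_right: "Vector_Spaces.linear scale scale (\<lambda>y. br x y)"
    and br_self: "br x x = 0"
    and jacobi: "br x (br y z) + br y (br z x) + br z (br x y) = 0"

locale nijenhuis_lie_algebra = lie_algebra scale br
  for scale :: "'k::field \<Rightarrow> 'l::ab_group_add \<Rightarrow> 'l" and br :: "'l \<Rightarrow> 'l \<Rightarrow> 'l" +
  fixes P :: "'l \<Rightarrow> 'l"
  assumes P_linear: "Vector_Spaces.linear scale scale P"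
    and nijenhuis: "br (P x) (P y) = P (br (P x) y) + P (br x (P y)) - P (P (br x y))"

definition nijenhuis_hom ::
    "('k::field \<Rightarrow> 'l::ab_group_add \<Rightarrow> 'l) \<Rightarrow> ('l \<Rightarrow> 'l \<Rightarrow> 'l) \<Rightarrow> ('l \<Rightarrow> 'l) \<Rightarrow>
     ('k \<Rightarrow> 'm::ab_group_add \<Rightarrow> 'm) \<Rightarrow> ('m \<Rightarrow> 'm \<Rightarrow> 'm) \<Rightarrow> ('m \<Rightarrow> 'm) \<Rightarrow> ('l \<Rightarrow> 'm) \<Rightarrow> bool" where
  "nijenhuis_hom s b P s' b' P' h \<longleftrightarrow> Vector_Spaces.linear s s' h \<and>
     (\<forall>x y. h (b x y) = b' (h x) (h y)) \<and> (\<forall>x. h (P x) = P' (h x))"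

definition fN :: "'x::wellorder oword \<Rightarrow> 'x oword \<Rightarrow> ('x, 'k::field) opoly" where
  "fN u v = comm (opP (LS u)) (opP (LS v)) - opP (comm (opP (LS u)) (LS v))
     - opP (comm (LS u) (opP (LS v))) + opP (opP (comm (LS u) (LS v)))"

definition S_N :: "('x::wellorder, 'k::field) opoly set" where
  "S_N = {fN u v | u v. u \<in> ALSW \<and> v \<in> ALSW \<and> dl_less v u}"

definition Irr_S_N :: "'x::wellorder naword set" where
  "Irr_S_N = {bracketing w | w. w \<in> ALSW \<and>
     (\<forall>\<pi>\<in>star_words. \<forall>u\<in>ALSW. \<forall>v\<in>ALSW. dl_less v u \<longrightarrow> w \<noteq> plug \<pi> [Op u, Op v])}"


section \<open>The quotient of the free Lie algebra with operator by the ideal of \<open>S_N\<close>\<close>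

lemma opP_diff: "opP (f - g) = opP f - opP g"
proof -
  have eq: "opP h = (\<Sum>w\<in>A. Poly_Mapping.single [Op w] (Poly_Mapping.lookup h w))"
    if "finite A" "Poly_Mapping.keys h \<subseteq> A" for h :: "('a, 'b) opoly" and A
    unfolding opP_def using that
    by (intro sum.mono_neutral_left) (auto simp: in_keys_iff)
  let ?A = "Poly_Mapping.keys f \<union> Poly_Mapping.keys g \<union> Poly_Mapping.keys (f - g)"
  show ?thesis
    by (subst (1 2 3) eq[of ?A]) (auto simp: lookup_minus single_diff sum_subtractf)
qed

lemma lie_subalgebra_Lie: "lie_subalgebra Lie"
  unfolding Lie_def by (rule hull_in) (auto simp: lie_subalgebra_def opoly.subspace_def)

lemma subspace_Lie: "opoly.subspace Lie"
  by (rule lie_subalgebra_Lie[unfolded lie_subalgebra_def, THEN conjunct1])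

lemma comm_in_Lie: "f \<in> Lie \<Longrightarrow> g \<in> Lie \<Longrightarrow> comm f g \<in> Lie"
  by (rule lie_subalgebra_Lie[unfolded lie_subalgebra_def, THEN conjunct2, THEN conjunct1, rule_format])

lemma opP_in_Lie: "f \<in> Lie \<Longrightarrow> opP f \<in> Lie"
  by (rule lie_subalgebra_Lie[unfolded lie_subalgebra_def, THEN conjunct2, THEN conjunct2, rule_format])

lemma gen_in_Lie: "gen x \<in> Lie"
  unfolding Lie_def by (rule hull_inc) simp

lemma eval_na_gen_in_Lie: "eval_na gen t \<in> Lie"
  by (induction t) (simp_all add: gen_in_Lie comm_in_Lie opP_in_Lie)

lemma LS_in_Lie: "LS u \<in> Lie"
  by (simp add: LS_def eval_na_gen_in_Lie)

lemma S_N_subset_Lie: "S_N \<subseteq> Lie"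
  by (auto simp: S_N_def fN_def
      intro!: opoly.subspace_add[OF subspace_Lie] opoly.subspace_diff[OF subspace_Lie]
        comm_in_Lie opP_in_Lie LS_in_Lie)

lemma lie_ideal_Lie: "lie_ideal Lie"
  by (simp add: lie_ideal_def subspace_Lie comm_in_Lie opP_in_Lie)

lemma lie_ideal_Id_Lie:
  assumes "S \<subseteq> Lie"
  shows "lie_ideal (Id_Lie S)"
proof -
  have "Id_Lie S \<subseteq> Lie"
    unfolding Id_Lie_def using assms lie_ideal_Lie by (rule hull_minimal)
  then show ?thesis
    unfolding Id_Lie_def lie_ideal_def hull_def by (auto simp: opoly.subspace_def)
qed

lemma lie_ideal_Id_S_N: "lie_ideal (Id_Lie S_N)"
  by (rule lie_ideal_Id_Lie[OF S_N_subset_Lie])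

lemma subspace_Id_S_N: "opoly.subspace (Id_Lie S_N)"
  by (rule lie_ideal_Id_S_N[unfolded lie_ideal_def, THEN conjunct2, THEN conjunct1])

lemma comm_in_Id_S_N: "a \<in> Lie \<Longrightarrow> f \<in> Id_Lie S_N \<Longrightarrow> comm a f \<in> Id_Lie S_N"
  using lie_ideal_Id_S_N[where 'a = 'a and 'b = 'b] by (simp add: lie_ideal_def)

lemma opP_in_Id_S_N: "f \<in> Id_Lie S_N \<Longrightarrow> opP f \<in> Id_Lie S_N"
  using lie_ideal_Id_S_N[where 'a = 'a and 'b = 'b] by (simp add: lie_ideal_def)

definition nl_rel :: "('x::wellorder, 'k::field) opoly \<Rightarrow> ('x, 'k) opoly \<Rightarrow> bool" where
  "nl_rel f g \<longleftrightarrow> f \<in> Lie \<and> g \<in> Lie \<and> f - g \<in> Id_Lie S_N"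

lemma nl_rel_refl: "f \<in> Lie \<Longrightarrow> nl_rel f f"
  by (simp add: nl_rel_def opoly.subspace_0[OF subspace_Id_S_N])

lemma nl_rel_sym: "nl_rel f g \<Longrightarrow> nl_rel g f"
  using opoly.subspace_neg[OF subspace_Id_S_N, of "f - g"] by (simp add: nl_rel_def)

lemma nl_rel_trans: "nl_rel f g \<Longrightarrow> nl_rel g h \<Longrightarrow> nl_rel f h"
  using opoly.subspace_add[OF subspace_Id_S_N, of "f - g" "g - h"] by (simp add: nl_rel_def)

lemma nl_rel_add: "nl_rel f f' \<Longrightarrow> nl_rel g g' \<Longrightarrow> nl_rel (f + g) (f' + g')"
  using opoly.subspace_add[OF subspace_Id_S_N, of "f - f'" "g - g'"]
  by (simp add: nl_rel_def opoly.subspace_add[OF subspace_Lie] algebra_simps)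

lemma nl_rel_uminus: "nl_rel f f' \<Longrightarrow> nl_rel (- f) (- f')"
  using opoly.subspace_neg[OF subspace_Id_S_N, of "f - f'"]
  by (simp add: nl_rel_def opoly.subspace_neg[OF subspace_Lie])

lemma nl_rel_diff: "nl_rel f f' \<Longrightarrow> nl_rel g g' \<Longrightarrow> nl_rel (f - g) (f' - g')"
  using nl_rel_add[of f f' "- g" "- g'"] nl_rel_uminus[of g g'] by simp

lemma nl_rel_scal: "nl_rel f f' \<Longrightarrow> nl_rel (scal c f) (scal c f')"
  using opoly.subspace_scale[OF subspace_Id_S_N, of "f - f'" c]
  by (simp add: nl_rel_def opoly.subspace_scale[OF subspace_Lie] opoly.scale_right_diff_distrib)

lemma nl_rel_comm:
  assumes "nl_rel f f'" "nl_rel g g'"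
  shows "nl_rel (comm f g) (comm f' g')"
proof -
  have eq: "comm f g - comm f' g' = comm f (g - g') - comm g' (f - f')"
    by (simp add: comm_def algebra_simps)
  have "comm f g - comm f' g' \<in> Id_Lie S_N"
    unfolding eq using assms
    by (intro opoly.subspace_diff[OF subspace_Id_S_N, OF comm_in_Id_S_N comm_in_Id_S_N])
      (simp_all add: nl_rel_def)
  then show ?thesis
    using assms by (simp add: nl_rel_def comm_in_Lie)
qed

lemma nl_rel_opP: "nl_rel f f' \<Longrightarrow> nl_rel (opP f) (opP f')"
  using opP_in_Id_S_N[of "f - f'"] by (simp add: nl_rel_def opP_in_Lie opP_diff)

text \<open>The quotient relation is partial with domain \<open>Lie\<close>, so \<open>('x, 'k) NL\<close> consists of the cosets
  of \<open>Id_Lie S_N\<close> in \<open>Lie\<close>.\<close>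

quotient_type (overloaded) ('x, 'k) NL = "('x::wellorder, 'k::field) opoly" / partial: nl_rel
proof (rule part_equivpI)
  show "\<exists>f. nl_rel f f"
    using nl_rel_refl opoly.subspace_0[OF subspace_Lie] by blast
  show "symp nl_rel"
    by (rule sympI) (rule nl_rel_sym)
  show "transp nl_rel"
    by (rule transpI) (rule nl_rel_trans)
qed

instantiation NL :: (wellorder, field) ab_group_add
begin

lift_definition zero_NL :: "('a, 'b) NL" is 0
  by (rule nl_rel_refl) (rule opoly.subspace_0[OF subspace_Lie])

lift_definition plus_NL :: "('a, 'b) NL \<Rightarrow> ('a, 'b) NL \<Rightarrow> ('a, 'b) NL" is "(+)"
  by (rule nl_rel_add)

lift_definition uminus_NL :: "('a, 'b) NL \<Rightarrow> ('a, 'b) NL" is uminus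
  by (rule nl_rel_uminus)

lift_definition minus_NL :: "('a, 'b) NL \<Rightarrow> ('a, 'b) NL \<Rightarrow> ('a, 'b) NL" is "(-)"
  by (rule nl_rel_diff)

instance
  by standard
    (transfer; auto simp: algebra_simps nl_rel_def
      intro: opoly.subspace_0[OF subspace_Id_S_N] opoly.subspace_add[OF subspace_Lie]
        opoly.subspace_diff[OF subspace_Lie] opoly.subspace_0[OF subspace_Lie])+

end

lift_definition nl_scale :: "'k \<Rightarrow> ('x::wellorder, 'k::field) NL \<Rightarrow> ('x, 'k) NL" is scal
  by (rule nl_rel_scal)

lift_definition nl_br :: "('x::wellorder, 'k::field) NL \<Rightarrow> ('x, 'k) NL \<Rightarrow> ('x, 'k) NL" is comm
  by (rule nl_rel_comm)

lift_definition nl_P :: "('x::wellorder, 'k::field) NL \<Rightarrow> ('x, 'k) NL" is opP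
  by (rule nl_rel_opP)

text \<open>The projection of \<open>Lie\<close> onto the quotient; only its values on \<open>Lie\<close> are meaningful.\<close>

definition nl_class :: "('x::wellorder, 'k::field) opoly \<Rightarrow> ('x, 'k) NL" where
  "nl_class f = abs_NL f"

definition is_linear_basis ::
    "('k::field \<Rightarrow> 'v::ab_group_add \<Rightarrow> 'v) \<Rightarrow> 'i set \<Rightarrow> ('i \<Rightarrow> 'v) \<Rightarrow> bool" where
  "is_linear_basis scale I b \<longleftrightarrow>
     inj_on b I \<and> \<not> module.dependent scale (b ` I) \<and> module.span scale (b ` I) = UNIV"

end

theory Submission
  imports Defs "HOL-Library.Multiset" "HOL-Library.Product_Plus"
begin

text \<open>The compositions are not computed. Since a composition lies in the ideal, triviality modulo
  \<open>(S_N, w)\<close> follows from reduction once the irreducible words are known to be independent in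
  \<open>N = NL(X)\<close>. Independence is proved by induction on the degree, from a representation. The
  Nijenhuis identity says that \<open>[u, v]\<^sub>P = [P u, v] + [u, P v] - P [u, v]\<close> is a Lie bracket on \<open>N\<close>.
  Let \<open>U\<close> be the enveloping algebra of the free product of the free Lie algebra on \<open>X\<close> and of
  \<open>(N, [,]\<^sub>P)\<close>, with inclusion \<open>\<iota>\<close> of \<open>N\<close>. Then \<open>(a, f) \<mapsto> (P a, \<iota> a)\<close> is a Nijenhuis operator on \<open>N \<times> U\<close>, so the
  universal property maps \<open>N\<close> to \<open>N \<times> U\<close>, sending \<open>P(u)\<close> to \<open>\<iota> u\<close> in the second component. The
  Poincare--Birkhoff--Witt basis of \<open>U\<close> built on the irreducible words of lower degree consists of the
  words without descents \<open>P(u)P(v)\<close>, \<open>u > v\<close>, and separates the irreducible words of the next degree.\<close>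

section \<open>Lyndon--Shirshov words\<close>

text \<open>The obstacle is circularity: separating the elements \<open>P(u)\<close> of the quotient
  requires that the \<open>u\<close> are already known to be independent there. The degree resolves
  this, as \<open>u\<close> has smaller degree than \<open>P(u)\<close>. At each stage the
  irreducible words treated so far, as vectors of \<open>N\<close>, are completed to a basis of
  \<open>N\<close> by arbitrary vectors, so that \<open>U\<close> can be built before a basis of
  \<open>N\<close> is known. The operator on \<open>N \<times> U\<close> depends on the first
  component alone. In the second component its Nijenhuis identity therefore says exactly that the
  inclusion carries the deformed bracket to the commutator. By uniqueness the first component of the
  map is the identity, so the value at \<open>P(u)\<close> involves no recursion. Independence at
  the next degree is a triangularity argument. A standard bracketing expands into its own word and
  lexicographically later permutations; passing to normal form moves a word later or shortens it.
  Hence the coefficient at the longest word, lexicographically earliest among those, can be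
  isolated.\<close>

definition lex_differ :: "('z \<Rightarrow> 'z \<Rightarrow> bool) \<Rightarrow> 'z list \<Rightarrow> 'z list \<Rightarrow> bool" where
  "lex_differ gt u v \<longleftrightarrow> (\<exists>r a b s t. u = r @ a # s \<and> v = r @ b # t \<and> gt a b)"

lemma lex_greater_conv_lexord: "lex_greater gt u v \<longleftrightarrow> (u, v) \<in> lexord {(a, b). gt a b}"
  by (induction gt u v rule: lex_greater.induct) auto

lemma lex_greater_iff_differ:
  "lex_greater gt u v \<longleftrightarrow> (\<exists>x. x \<noteq> [] \<and> v = u @ x) \<or> lex_differ gt u v"
  unfolding lex_greater_conv_lexord lexord_def lex_differ_def
  by (auto simp: neq_Nil_conv) blast+

text \<open>A difference at a common position survives any continuation of the two words, whereas a
  comparison decided by the prefix rule may be reversed. Most arguments below therefore first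
  exclude the prefix case, usually by \<open>lex_differI\<close> from the lengths.\<close>

lemma lex_differ_append: "lex_differ gt u v \<Longrightarrow> lex_differ gt (u @ a) (v @ b)"
  unfolding lex_differ_def by fastforce

lemma lex_differI: "lex_greater gt u v \<Longrightarrow> length v \<le> length u \<Longrightarrow> lex_differ gt u v"
  unfolding lex_greater_iff_differ by auto

lemma lex_differD: "lex_differ gt u v \<Longrightarrow> lex_greater gt u v"
  unfolding lex_greater_iff_differ by auto

lemma lex_greater_map:
  assumes "\<And>p q. p \<in> set u \<Longrightarrow> q \<in> set v \<Longrightarrow> gt' (f p) (f q) \<longleftrightarrow> gt p q"
    and "\<And>p q. p \<in> set u \<Longrightarrow> q \<in> set v \<Longrightarrow> f p = f q \<longleftrightarrow> p = q"
  shows "lex_greater gt' (map f u) (map f v) \<longleftrightarrow> lex_greater gt u v"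
  using assms
proof (induction gt u v rule: lex_greater.induct)
  case (3 gt z u z' v)
  then have "lex_greater gt' (map f u) (map f v) \<longleftrightarrow> lex_greater gt u v" by simp
  with 3 show ?case by simp
qed simp_all

text \<open>Totality is asked for on \<open>Z\<close> only, because the order of primes used later
  is not total on its type: it does not compare \<open>Op []\<close> with a letter, both having
  degree 1.\<close>

locale alphabet =
  fixes gt :: "'z \<Rightarrow> 'z \<Rightarrow> bool" and Z :: "'z set"
  assumes gt_irrefl: "\<not> gt x x"
    and gt_trans: "gt x y \<Longrightarrow> gt y z \<Longrightarrow> gt x z"
    and gt_total: "x \<in> Z \<Longrightarrow> y \<in> Z \<Longrightarrow> x \<noteq> y \<Longrightarrow> gt x y \<or> gt y x"
begin

text \<open>With the order written \<open>\<sqsubset>\<close> below, a proper prefix is smaller than the word, and the words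
  in \<open>ALSW_on\<close> are the Lyndon words in the usual sense: they precede their proper suffixes.\<close>

abbreviation lex_before (infix "\<sqsubset>" 50) where "u \<sqsubset> v \<equiv> lex_greater gt u v"
abbreviation lex_beforeeq (infix "\<sqsubseteq>" 50) where "u \<sqsubseteq> v \<equiv> u = v \<or> u \<sqsubset> v"

lemma lex_irrefl: "\<not> u \<sqsubset> u"
  by (induction u) (auto simp: gt_irrefl)

lemma lex_trans: "u \<sqsubset> v \<Longrightarrow> v \<sqsubset> w \<Longrightarrow> u \<sqsubset> w"
  unfolding lex_greater_conv_lexord
  by (rule lexord_trans) (auto simp: trans_def intro: gt_trans)

lemma lex_asym: "u \<sqsubset> v \<Longrightarrow> \<not> v \<sqsubset> u"
  using lex_trans lex_irrefl by blast

lemma lex_le_trans: "u \<sqsubseteq> v \<Longrightarrow> v \<sqsubseteq> w \<Longrightarrow> u \<sqsubseteq> w"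
  using lex_trans by metis

lemma lex_antisym: "u \<sqsubseteq> v \<Longrightarrow> v \<sqsubseteq> u \<Longrightarrow> u = v"
  using lex_asym by metis

lemma lex_total: "set u \<subseteq> Z \<Longrightarrow> set v \<subseteq> Z \<Longrightarrow> u = v \<or> u \<sqsubset> v \<or> v \<sqsubset> u"
proof (induction u arbitrary: v)
  case Nil
  then show ?case by (cases v) auto
next
  case (Cons a u)
  then show ?case using gt_total by (cases v) auto
qed

lemma lex_append_left [simp]: "a @ u \<sqsubset> a @ v \<longleftrightarrow> u \<sqsubset> v"
  by (induction a) (auto simp: gt_irrefl)

lemma lex_prefix: "x \<noteq> [] \<Longrightarrow> u \<sqsubset> u @ x"
  unfolding lex_greater_iff_differ by auto

section \<open>Lyndon words: characterization by suffixes, products and overlaps\<close>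

definition lyn :: "'z list \<Rightarrow> bool" where
  "lyn w \<longleftrightarrow> w \<noteq> [] \<and> set w \<subseteq> Z \<and> (\<forall>u v. w = u @ v \<longrightarrow> u \<noteq> [] \<longrightarrow> v \<noteq> [] \<longrightarrow> w \<sqsubset> v)"

lemma lyn_suffix: "lyn (u @ v) \<Longrightarrow> u \<noteq> [] \<Longrightarrow> v \<noteq> [] \<Longrightarrow> u @ v \<sqsubset> v"
  unfolding lyn_def by blast

lemma lyn_suffix_differ: "lyn (u @ v) \<Longrightarrow> u \<noteq> [] \<Longrightarrow> v \<noteq> [] \<Longrightarrow> lex_differ gt (u @ v) v"
  using lyn_suffix by (intro lex_differI) auto

lemma lyn_nonempty: "lyn w \<Longrightarrow> w \<noteq> []" and lyn_set: "lyn w \<Longrightarrow> set w \<subseteq> Z"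
  unfolding lyn_def by auto

lemma lyn_rotate: "lyn (u @ v) \<Longrightarrow> u \<noteq> [] \<Longrightarrow> v \<noteq> [] \<Longrightarrow> u @ v \<sqsubset> v @ u"
  using lex_differ_append[OF lyn_suffix_differ, of u v "[]" u] by (auto intro: lex_differD)

lemma lyn_letter: "z \<in> Z \<Longrightarrow> lyn [z]"
  by (auto simp: lyn_def Cons_eq_append_conv)

text \<open>For the converse direction, suppose that a proper suffix \<open>v\<close> of
  \<open>w = u @ v\<close> preceded \<open>w\<close>. If the two differ at a position, then the
  rotation \<open>v @ u\<close> precedes \<open>w\<close> as well. Otherwise \<open>v\<close> is a
  border, \<open>w = v @ x\<close>, and the rotations at both ends compare \<open>x\<close> with
  \<open>u\<close> in opposite ways.\<close>

lemma lyn_iff_ALSW_on: "lyn w \<longleftrightarrow> w \<in> ALSW_on gt Z"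
proof
  assume "lyn w"
  then show "w \<in> ALSW_on gt Z"
    using lyn_rotate unfolding ALSW_on_def by (auto simp: lyn_nonempty dest: lyn_set)
next
  assume w: "w \<in> ALSW_on gt Z"
  have "w \<sqsubset> v" if uv: "w = u @ v" "u \<noteq> []" "v \<noteq> []" for u v
  proof (rule ccontr)
    assume n: "\<not> w \<sqsubset> v"
    have rot: "a @ b \<sqsubset> b @ a" if "w = a @ b" "a \<noteq> []" "b \<noteq> []" for a b
      using w that by (auto simp: ALSW_on_def)
    have "v \<sqsubset> w" using lex_total[of w v] w uv n by (auto simp: ALSW_on_def)
    then consider x where "x \<noteq> []" "w = v @ x" | "lex_differ gt v w"
      unfolding lex_greater_iff_differ by auto
    then show False
    proof cases
      case 1
      have "u @ v \<sqsubset> v @ u" "v @ x \<sqsubset> x @ v" using rot uv 1 by blast+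
      moreover have len: "length x = length u"
        using 1 uv by (metis add_left_cancel length_append add.commute)
      ultimately have "x \<sqsubset> u" "u @ v \<sqsubset> x @ v" using 1 uv by (metis lex_append_left, metis)
      then have "lex_differ gt x u" using len by (intro lex_differI) auto
      then have "x @ v \<sqsubset> u @ v" using lex_differ_append lex_differD by blast
      then show False
        using \<open>u @ v \<sqsubset> x @ v\<close> lex_asym by blast
    next
      case 2
      then have "v @ u \<sqsubset> u @ v"
        using lex_differ_append[of gt v w u "[]"] uv lex_differD by fastforce
      then show False
        using rot uv lex_asym by blast
    qed
  qed
  then show "lyn w" using w unfolding lyn_def ALSW_on_def by auto
qed

text \<open>A suffix that starts inside \<open>u\<close> is already separated from \<open>u\<close>
  at a position, by \<open>lyn_suffix_differ\<close>. A suffix inside \<open>v\<close> comes at or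
  after \<open>v\<close>, so everything reduces to \<open>u @ v \<sqsubset> v\<close>.\<close>

lemma lyn_append:
  assumes u: "lyn u" and v: "lyn v" and uv: "u \<sqsubset> v"
  shows "lyn (u @ v)"
proof -
  have uvv: "u @ v \<sqsubset> v"
  proof -
    from uv consider x where "x \<noteq> []" "v = u @ x" | "lex_differ gt u v"
      unfolding lex_greater_iff_differ by auto
    then show ?thesis
    proof cases
      case 1
      then have "v \<sqsubset> x" using v u lyn_suffix lyn_nonempty by blast
      then show ?thesis
        using 1 lex_append_left by metis
    next
      case 2
      then show ?thesis
        using lex_differ_append[of gt u v v "[]"] lex_differD by fastforce
    qed
  qed
  have "u @ v \<sqsubset> y" if xy: "u @ v = x @ y" "x \<noteq> []" "y \<noteq> []" for x y
  proof -
    from xy(1) consider z where "u = x @ z" "y = z @ v" | z where "x = u @ z" "v = z @ y"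
      by (auto simp: append_eq_append_conv2)
    then show ?thesis
    proof cases
      case 1
      show ?thesis
      proof (cases "z = []")
        case True
        then show ?thesis using 1 uvv by simp
      next
        case False
        then have "lex_differ gt u z" using 1 u xy lyn_suffix_differ by blast
        then show ?thesis
          using 1 lex_differ_append lex_differD by blast
      qed
    next
      case 2
      show ?thesis
      proof (cases "z = []")
        case True
        then show ?thesis using 2 uvv by simp
      next
        case False
        then have "v \<sqsubset> y" using 2 v xy lyn_suffix by blast
        then show ?thesis
          using uvv lex_trans by blast
      qed
    qed
  qed
  then show ?thesis
    using u v unfolding lyn_def by auto
qed

text \<open>A suffix starting inside \<open>u\<close> is separated from \<open>u @ v\<close> at a
  position, so appending \<open>w\<close> changes nothing. A later one is a suffix of the Lyndon
  word \<open>v @ w\<close>, which itself follows the whole word. This serves to exclude badly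
  placed splits in \<open>NLSW_subword\<close>.\<close>

lemma lyn_overlap:
  assumes uv: "lyn (u @ v)" and vw: "lyn (v @ w)" and "v \<noteq> []"
  shows "lyn (u @ v @ w)"
proof (cases "u = []")
  case False
  have uvw: "u @ v @ w \<sqsubset> v @ w"
    using lex_differ_append[OF lyn_suffix_differ[OF uv False \<open>v \<noteq> []\<close>], of w w] lex_differD by fastforce
  have "u @ v @ w \<sqsubset> y" if xy: "u @ v @ w = x @ y" "x \<noteq> []" "y \<noteq> []" for x y
  proof -
    from xy(1) consider z where "u = x @ z" "y = z @ v @ w" | z where "x = u @ z" "v @ w = z @ y"
      by (auto simp: append_eq_append_conv2)
    then show ?thesis
    proof cases
      case 1
      then have "lex_differ gt (u @ v) (z @ v)"
        using lyn_suffix_differ[of x "z @ v"] uv xy \<open>v \<noteq> []\<close> by simp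
      then show ?thesis
        using 1 lex_differ_append[of gt "u @ v" "z @ v" w w] lex_differD by fastforce
    next
      case 2
      then show ?thesis
        using uvw lyn_suffix[of z y] vw xy lex_trans by (cases "z = []") auto
    qed
  qed
  then show ?thesis
    using assms unfolding lyn_def by auto
qed (use vw in simp)

section \<open>Least suffixes and the standard factorization\<close>

lemma ex_min_word:
  assumes "finite A" "A \<noteq> {}" "\<And>w. w \<in> A \<Longrightarrow> set w \<subseteq> Z"
  shows "\<exists>m\<in>A. \<forall>w\<in>A. m \<sqsubseteq> w"
  using assms
proof (induction A rule: finite_ne_induct)
  case (insert a A)
  then obtain m where m: "m \<in> A" "\<forall>w\<in>A. m \<sqsubseteq> w" by auto
  then have "a = m \<or> a \<sqsubset> m \<or> m \<sqsubset> a" using insert lex_total[of a m] by auto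
  then show ?case
    using m lex_trans by (metis insert_iff)
qed auto

lemma finite_suffixes: "finite {y. \<exists>x. w = x @ y}"
proof (rule finite_subset)
  show "{y. \<exists>x. w = x @ y} \<subseteq> (\<lambda>n. drop n w) ` {..length w}"
  proof
    fix y assume "y \<in> {y. \<exists>x. w = x @ y}"
    then obtain x where "w = x @ y" by blast
    then show "y \<in> (\<lambda>n. drop n w) ` {..length w}" by (intro image_eqI[of _ _ "length x"]) auto
  qed
qed simp

lemma ex_min_proper_suffix:
  assumes "length w \<ge> 2" "set w \<subseteq> Z"
  obtains s t where "w = s @ t" "s \<noteq> []" "t \<noteq> []"
    "\<And>x y. w = x @ y \<Longrightarrow> x \<noteq> [] \<Longrightarrow> y \<noteq> [] \<Longrightarrow> t \<sqsubseteq> y"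
proof -
  let ?A = "{y. \<exists>x. w = x @ y \<and> x \<noteq> [] \<and> y \<noteq> []}"
  have "finite ?A" by (rule finite_subset[OF _ finite_suffixes[of w]]) blast
  moreover have "w = [hd w] @ tl w" "tl w \<noteq> []" using assms by (cases w; force)+
  then have "tl w \<in> ?A" by blast
  moreover have "set y \<subseteq> Z" if "y \<in> ?A" for y
    using that assms by auto
  ultimately obtain t where "t \<in> ?A" "\<forall>y\<in>?A. t \<sqsubseteq> y" using ex_min_word[of ?A] by blast
  then show ?thesis
    using that by blast
qed

lemma min_suffix_lyn:
  assumes w: "w = s @ t" "t \<noteq> []" "set w \<subseteq> Z"
    and min: "\<And>x y. w = x @ y \<Longrightarrow> x \<noteq> [] \<Longrightarrow> y \<noteq> [] \<Longrightarrow> t \<sqsubseteq> y"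
  shows "lyn t"
proof -
  have "t \<sqsubset> y" if "t = x @ y" "x \<noteq> []" "y \<noteq> []" for x y
    using min[of "s @ x" y] w that by auto
  then show ?thesis
    unfolding lyn_def using w by auto
qed

text \<open>The right factor \<open>t\<close> is the least proper suffix. Were a proper suffix
  \<open>y\<close> of \<open>s\<close> to precede \<open>s\<close>, then either the difference at a
  position gives \<open>y @ t \<sqsubset> w\<close>, or \<open>s = y @ z\<close> and cancelling
  \<open>y\<close> in \<open>w \<sqsubset> y @ t\<close> gives \<open>z @ t \<sqsubset> t\<close>,
  against the choice of \<open>t\<close>.\<close>

lemma standard_factorization:
  assumes w: "lyn w" "length w \<ge> 2"
  obtains s t where "w = s @ t" "lyn s" "lyn t" "s \<sqsubset> t"
    "\<And>x y. w = x @ y \<Longrightarrow> x \<noteq> [] \<Longrightarrow> y \<noteq> [] \<Longrightarrow> t \<sqsubseteq> y"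
proof -
  obtain s t where st: "w = s @ t" "s \<noteq> []" "t \<noteq> []"
    and min: "\<And>x y. w = x @ y \<Longrightarrow> x \<noteq> [] \<Longrightarrow> y \<noteq> [] \<Longrightarrow> t \<sqsubseteq> y"
    using ex_min_proper_suffix w lyn_set by metis
  have t: "lyn t" using min_suffix_lyn[of w s t] st min w lyn_set by blast
  have "s \<sqsubset> y" if xy: "s = x @ y" "x \<noteq> []" "y \<noteq> []" for x y
  proof (rule ccontr)
    assume "\<not> s \<sqsubset> y"
    then have "y \<sqsubset> s" using lex_total[of s y] w st xy lyn_set by fastforce
    then consider z where "z \<noteq> []" "s = y @ z" | "lex_differ gt y s"
      unfolding lex_greater_iff_differ by auto
    then show False
    proof cases
      case 1
      have "x @ y @ t \<sqsubset> y @ t" using lyn_suffix[of x "y @ t"] w(1) st xy by simp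
      moreover have "x @ y @ t = y @ z @ t" using 1 xy by simp
      ultimately have "z @ t \<sqsubset> t" by simp
      moreover have "t \<sqsubseteq> z @ t" using min[of y "z @ t"] 1 st xy by simp
      ultimately show False
        using lex_asym lex_irrefl by metis
    next
      case 2
      then have "y @ t \<sqsubset> s @ t" using lex_differ_append lex_differD by blast
      moreover have "s @ t \<sqsubset> y @ t" using lyn_suffix[of x "y @ t"] w(1) st xy by simp
      ultimately show False
        using lex_asym by blast
    qed
  qed
  then have s: "lyn s" unfolding lyn_def using st lyn_set[OF w(1)] by auto
  have "s \<sqsubset> t" using lex_prefix[of t s] lyn_suffix[of s t] w st lex_trans by blast
  then show ?thesis
    using that st s t min by blast
qed

section \<open>Existence and uniqueness of the standard bracketing\<close>

lemma is_NLSW_lyn: "is_NLSW gt T \<Longrightarrow> set (frontier T) \<subseteq> Z \<Longrightarrow> lyn (frontier T)"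
  by (cases T) (auto simp: lyn_iff_ALSW_on ALSW_on_def)

lemma lyn_ALSW_UNIV: "lyn w \<Longrightarrow> w \<in> ALSW_on gt UNIV"
  by (auto simp: lyn_iff_ALSW_on ALSW_on_def)

lemma frontier_nonempty [simp]: "frontier T \<noteq> []"
  by (induction T) auto

text \<open>Splitting at the least suffix \<open>t\<close> recursively works: if the right factor
  \<open>S2\<close> of the left child preceded \<open>t\<close>, then \<open>S2\<close> and
  \<open>t\<close> would combine to a Lyndon word, which is a proper suffix preceding
  \<open>t\<close>.\<close>

lemma ex_NLSW:
  assumes "lyn w"
  shows "\<exists>T. is_NLSW gt T \<and> frontier T = w"
  using assms
proof (induction "length w" arbitrary: w rule: less_induct)
  case less
  show ?case
  proof (cases "length w \<ge> 2")
    case False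
    then obtain z where "w = [z]"
      using lyn_nonempty[OF less.prems] by (cases w; cases "tl w") auto
    then show ?thesis
      using lyn_ALSW_UNIV less.prems by (intro exI[of _ "Leaf z"]) simp
  next
    case True
    then obtain s t where st: "w = s @ t" "lyn s" "lyn t" "s \<sqsubset> t"
      and min: "\<And>x y. w = x @ y \<Longrightarrow> x \<noteq> [] \<Longrightarrow> y \<noteq> [] \<Longrightarrow> t \<sqsubseteq> y"
      using standard_factorization less.prems by metis
    obtain S T where S: "is_NLSW gt S" "frontier S = s" and T: "is_NLSW gt T" "frontier T = t"
      using less.hyps[of s] less.hyps[of t] st lyn_nonempty by fastforce
    have "lex_le gt (frontier S2) t" if "S = Node S1 S2" for S1 S2
    proof (rule ccontr)
      let ?y = "frontier S2"
      assume "\<not> lex_le gt ?y t"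
      moreover have S2: "is_NLSW gt S2" "set ?y \<subseteq> Z" using that S lyn_set[OF st(2)] by auto
      ultimately have "?y \<sqsubset> t" using lex_total[of ?y t] st lyn_set unfolding lex_le_def by auto
      then have "lyn (?y @ t)" using S2 is_NLSW_lyn st lyn_append by blast
      then have "?y @ t \<sqsubset> t" using lyn_suffix st lyn_nonempty by simp
      moreover have "t \<sqsubseteq> ?y @ t" using min[of "frontier S1" "?y @ t"] st S that by auto
      ultimately show False
        using lex_asym lex_irrefl by metis
    qed
    then have "is_NLSW gt (Node S T)" using S T st less.prems lyn_ALSW_UNIV by auto
    then show ?thesis
      using S T st by (intro exI[of _ "Node S T"]) simp
  qed
qed

text \<open>The condition on \<open>S2\<close> passes the minimality down the left spine: a suffix
  cutting \<open>S\<close> continues a suffix of the frontier of \<open>S\<close>, which comes at or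
  after \<open>S2\<close> by induction, and \<open>S2\<close> at or after \<open>T\<close>. The
  place where a node splits is thus determined by its frontier, which is the reason for
  uniqueness.\<close>

lemma NLSW_min_suffix:
  assumes "is_NLSW gt (Node S T)" "set (frontier (Node S T)) \<subseteq> Z"
    "frontier (Node S T) = x @ y" "x \<noteq> []" "y \<noteq> []"
  shows "frontier T \<sqsubseteq> y"
  using assms
proof (induction S arbitrary: T x y)
  case (Leaf z)
  have T: "lyn (frontier T)" using Leaf.prems is_NLSW_lyn by auto
  obtain x' where x': "frontier T = x' @ y" using Leaf.prems by (cases x) auto
  then show ?case
    using T Leaf.prems lyn_suffix[of x' y] by (cases "x' = []") auto
next
  case (Node S1 S2)
  let ?s = "frontier (Node S1 S2)" and ?t = "frontier T"
  have T: "lyn ?t" using Node.prems is_NLSW_lyn by auto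
  have "?s @ ?t = x @ y" using Node.prems(3) by simp
  then consider z where "?s = x @ z" "y = z @ ?t" | z where "x = ?s @ z" "?t = z @ y"
    unfolding append_eq_append_conv2 by metis
  then show ?case
  proof cases
    case 1
    show ?thesis
    proof (cases "z = []")
      case False
      have "frontier S2 \<sqsubseteq> z" using Node.IH(1)[of S2 x z] Node.prems 1 False by auto
      moreover have "?t \<sqsubseteq> frontier S2" using Node.prems by (auto simp: lex_le_def)
      ultimately have "?t \<sqsubseteq> z" by (rule lex_le_trans[rotated])
      then show ?thesis
        using 1 lex_prefix[of ?t z] lex_trans by auto
    qed (use 1 in simp)
  next
    case 2
    then show ?thesis
      using T Node.prems lyn_suffix[of z y] by (cases "z = []") auto
  qed
qed

lemma NLSW_unique:
  assumes "is_NLSW gt T" "is_NLSW gt T'" "frontier T = frontier T'" "set (frontier T) \<subseteq> Z"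
  shows "T = T'"
  using assms
proof (induction T arbitrary: T')
  case (Leaf z)
  then show ?case
    by (cases T') (auto simp: Cons_eq_append_conv)
next
  case (Node S T)
  then obtain S' T'' where T': "T' = Node S' T''" by (cases T') (auto simp: append_eq_Cons_conv)
  have eq: "frontier (Node S T) = frontier S' @ frontier T''" using Node.prems(3) T' by simp
  have "frontier T \<sqsubseteq> frontier T''" by (rule NLSW_min_suffix[OF Node.prems(1,4) eq]) simp_all
  moreover have "frontier T'' \<sqsubseteq> frontier T"
    by (rule NLSW_min_suffix[of S' T'' "frontier S"]) (use Node.prems T' eq in auto)
  ultimately have "frontier T = frontier T''" by (rule lex_antisym)
  moreover from this have "frontier S = frontier S'"
    using eq by simp
  ultimately show ?case
    using Node.IH(1)[of S'] Node.IH(2)[of T''] Node.prems(1,2,4) T' by simp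
qed

lemma shirshov_bracketing:
  assumes "lyn w"
  shows "is_NLSW gt (shirshov_bracketing gt w)" "frontier (shirshov_bracketing gt w) = w"
proof -
  have "\<exists>!T. is_NLSW gt T \<and> frontier T = w"
  proof (rule ex_ex1I[OF ex_NLSW[OF assms]])
    show "T = T'" if "is_NLSW gt T \<and> frontier T = w" "is_NLSW gt T' \<and> frontier T' = w" for T T'
      using that lyn_set[OF assms] by (intro NLSW_unique) auto
  qed
  then have "is_NLSW gt (shirshov_bracketing gt w) \<and> frontier (shirshov_bracketing gt w) = w"
    unfolding shirshov_bracketing_def by (rule theI')
  then show "is_NLSW gt (shirshov_bracketing gt w)" "frontier (shirshov_bracketing gt w) = w"
    by auto
qed

lemma shirshov_bracketing_eqI:
  assumes "is_NLSW gt T" "frontier T = w" "set w \<subseteq> Z"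
  shows "shirshov_bracketing gt w = T"
proof -
  have "lyn w" using is_NLSW_lyn[of T] assms by simp
  then show ?thesis
    using shirshov_bracketing[of w] assms by (intro NLSW_unique) auto
qed

lemma shirshov_bracketing_letter: "z \<in> Z \<Longrightarrow> shirshov_bracketing gt [z] = Leaf z"
  by (rule shirshov_bracketing_eqI) (auto intro: lyn_ALSW_UNIV lyn_letter)

text \<open>The last factor is the least nonempty suffix \<open>t\<close> of \<open>c\<close>. If
  the factor before it preceded \<open>t\<close>, the two would merge to a Lyndon word, a suffix
  preceding \<open>t\<close>.\<close>

lemma ex_lyn_factorization:
  assumes "set c \<subseteq> Z"
  shows "\<exists>cs. concat cs = c \<and> (\<forall>d\<in>set cs. lyn d) \<and> successively (lex_le gt) cs"
  using assms
proof (induction "length c" arbitrary: c rule: less_induct)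
  case less
  show ?case
  proof (cases "c = []")
    case True
    then show ?thesis by (intro exI[of _ "[]"]) simp
  next
    case False
    let ?A = "{y. \<exists>x. c = x @ y \<and> y \<noteq> []}"
    have "finite ?A" by (rule finite_subset[OF _ finite_suffixes[of c]]) blast
    moreover have "c \<in> ?A" using False by simp
    moreover have "set y \<subseteq> Z" if "y \<in> ?A" for y
      using that less.prems by auto
    ultimately obtain t where t: "t \<in> ?A" "\<forall>y\<in>?A. t \<sqsubseteq> y" using ex_min_word[of ?A] by blast
    then obtain s where c: "c = s @ t" "t \<noteq> []" by blast
    have lt: "lyn t" using min_suffix_lyn[of c s t] c t less.prems by blast
    obtain cs where cs: "concat cs = s" "\<forall>d\<in>set cs. lyn d" "successively (lex_le gt) cs"
      using less.hyps[of s] c less.prems by auto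
    have "lex_le gt (last cs) t" if "cs \<noteq> []"
    proof (rule ccontr)
      assume "\<not> lex_le gt (last cs) t"
      moreover have l: "lyn (last cs)" using cs that by simp
      ultimately have "last cs \<sqsubset> t"
        using lex_total[of "last cs" t] lt lyn_set unfolding lex_le_def by auto
      then have "lyn (last cs @ t)" using l lt lyn_append by blast
      then have "last cs @ t \<sqsubset> t" using lyn_suffix l c lyn_nonempty by blast
      moreover have "c = concat (butlast cs) @ last cs @ t"
        using c cs that by (metis append.assoc append_butlast_last_id concat.simps concat_append append_Nil2)
      then have "t \<sqsubseteq> last cs @ t" using t c by blast
      ultimately show False
        using lex_asym lex_irrefl by metis
    qed
    then have "successively (lex_le gt) (cs @ [t])"
      using cs by (auto simp: successively_append_iff)
    then show ?thesis
      using cs c lt by (intro exI[of _ "cs @ [t]"]) auto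
  qed
qed

lemma sorted_lyn_factorization:
  "successively (lex_le gt) cs \<longleftrightarrow> sorted_wrt (lex_le gt) cs"
  by (rule successively_conv_sorted_wrt) (auto simp: transp_def lex_le_def intro: lex_trans)

text \<open>In \<open>lex_le\<close> the second argument is the one that comes first for
  \<open>\<sqsubset>\<close>. Along a sorted factorization the factors therefore go down in
  \<open>\<sqsubset>\<close>.\<close>

lemma sorted_last_le:
  assumes "successively (lex_le gt) (cs @ [t])" "d \<in> set (cs @ [t])"
  shows "t \<sqsubseteq> d"
proof -
  have "\<forall>d\<in>set cs. lex_le gt d t"
    using assms(1) unfolding sorted_lyn_factorization sorted_wrt_append by auto
  then show ?thesis
    using assms(2) by (auto simp: lex_le_def)
qed

text \<open>Any suffix begins with a nonempty suffix of some factor, or with a whole factor, and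
  these come at or after the last factor. This describes the last factor by the word alone, so that
  two factorizations can be compared from the right.\<close>

lemma lyn_factorization_min:
  assumes lyn: "\<forall>d\<in>set (cs @ [t]). lyn d" and sorted: "successively (lex_le gt) (cs @ [t])"
    and eq: "concat (cs @ [t]) = x @ y" and y: "y \<noteq> []"
  shows "t \<sqsubseteq> y"
proof -
  have td: "t \<sqsubseteq> d" if "d \<in> set (cs @ [t])" for d
    using sorted_last_le[OF sorted that] .
  have pre: "t \<sqsubseteq> u @ z" if "t \<sqsubseteq> u" for u z
    using that lex_prefix[of z u] lex_trans by (cases "z = []") auto
  obtain c1 d1 d2 c2 where c: "cs @ [t] = c1 @ (d1 @ d2) # c2" "y = d2 @ concat c2"
    using eq unfolding concat_eq_append_conv by auto
  then have d: "lyn (d1 @ d2)" "t \<sqsubseteq> d1 @ d2" using lyn td[of "d1 @ d2"] by auto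
  show ?thesis
  proof (cases "d2 = []")
    case True
    then obtain e c3 where "c2 = e # c3" using c y by (cases c2) auto
    then show ?thesis
      using c True td[of e] pre by auto
  next
    case False
    then have "t \<sqsubseteq> d2" using d lyn_suffix[of d1 d2] lex_trans by (cases "d1 = []") auto
    then show ?thesis
      using c pre by auto
  qed
qed

lemma lyn_factorization_unique:
  assumes "concat cs = concat ds" "\<forall>d\<in>set cs. lyn d" "\<forall>d\<in>set ds. lyn d"
    "successively (lex_le gt) cs" "successively (lex_le gt) ds"
  shows "cs = ds"
  using assms
proof (induction cs arbitrary: ds rule: rev_induct)
  case Nil
  then show ?case
    by (cases ds) (auto simp: lyn_nonempty)
next
  case (snoc c cs)
  then have "ds \<noteq> []" using lyn_nonempty by auto
  then obtain d es where ds: "ds = es @ [d]" by (metis rev_exhaust)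
  have "c \<sqsubseteq> d"
    using lyn_factorization_min[of cs c "concat es" d] snoc.prems ds lyn_nonempty by auto
  moreover have "d \<sqsubseteq> c"
    using lyn_factorization_min[of es d "concat cs" c] snoc.prems ds lyn_nonempty by auto
  ultimately have "c = d" by (rule lex_antisym)
  then show ?case
    using snoc.IH[of es] snoc.prems ds by (auto simp: successively_append_iff)
qed

text \<open>The last factor, being a suffix of the Lyndon word, follows it; all other factors come
  at or after the last, and the prefix \<open>v @ concat cs\<close> precedes the whole. The second
  conjunct is what \<open>lyn_append\<close> needs to absorb the next factor. The purpose is that
  all partial brackets in \<open>[...[[v][c1]]...[cm]]\<close> have Lyndon words as
  frontiers.\<close>

lemma lyn_factorization_lyn:
  assumes v: "lyn v" and vc: "lyn (v @ concat (cs @ ds))"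
    and lyn: "\<forall>d\<in>set (cs @ ds). lyn d" and sorted: "successively (lex_le gt) (cs @ ds)"
  shows "lyn (v @ concat cs) \<and> (\<forall>d\<in>set ds. v @ concat cs \<sqsubset> d)"
  using vc lyn sorted
proof (induction cs arbitrary: ds rule: rev_induct)
  case Nil
  show ?case
  proof (intro conjI ballI)
    fix d assume "d \<in> set ds"
    then obtain es e where ds: "ds = es @ [e]" by (metis empty_iff empty_set rev_exhaust)
    then have "v @ concat ds \<sqsubset> e"
      using lyn_suffix[of "v @ concat es" e] Nil ds lyn_nonempty[OF v] lyn_nonempty[of e] by auto
    moreover have "e \<sqsubseteq> d" using Nil \<open>d \<in> set ds\<close> ds by (intro sorted_last_le[of es]) auto
    moreover have "v \<sqsubset> v @ concat ds"
      using \<open>d \<in> set ds\<close> Nil lyn_nonempty by (intro lex_prefix) auto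
    ultimately show "v @ concat [] \<sqsubset> d" by (metis append_Nil2 concat.simps(1) lex_trans)
  qed (use v in simp)
next
  case (snoc c cs)
  have IH: "lyn (v @ concat cs)" "\<forall>d\<in>set (c # ds). v @ concat cs \<sqsubset> d"
    using snoc.IH[of "c # ds"] snoc.prems by auto
  have l: "lyn ((v @ concat cs) @ c)"
  proof (rule lyn_append[OF IH(1)])
    show "lyn c" using snoc.prems(2) by simp
    show "v @ concat cs \<sqsubset> c" using IH(2) by simp
  qed
  have "v @ concat (cs @ [c]) \<sqsubset> d" if d: "d \<in> set ds" for d
  proof -
    from d obtain es e where ds: "ds = es @ [e]" by (metis empty_iff empty_set rev_exhaust)
    then have "v @ concat (cs @ [c] @ ds) \<sqsubset> e"
      using lyn_suffix[of "v @ concat (cs @ [c] @ es)" e] snoc.prems v lyn_nonempty by auto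
    moreover have "e \<sqsubseteq> d"
      using snoc.prems that ds by (intro sorted_last_le[of "cs @ c # es"]) auto
    moreover have "concat ds \<noteq> []" using d lyn_nonempty[of d] snoc.prems(2) by auto
    then have "v @ concat (cs @ [c]) \<sqsubset> v @ concat (cs @ [c] @ ds)"
      using lex_prefix[of "concat ds" "v @ concat (cs @ [c])"] by simp
    ultimately show ?thesis
      using lex_trans by metis
  qed
  then show ?case
    using l by auto
qed

end

text \<open>Bracketed words with a hole \<open>None\<close>.\<close>

primrec plug_brk :: "'z brk \<Rightarrow> 'z option brk \<Rightarrow> 'z brk" where
  "plug_brk S (Leaf p) = (case p of None \<Rightarrow> S | Some z \<Rightarrow> Leaf z)"
| "plug_brk S (Node C D) = Node (plug_brk S C) (plug_brk S D)"

lemma plug_brk_map_Some [simp]: "plug_brk S (map_brk Some T) = T"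
  by (induction T) auto

lemma frontier_map_brk [simp]: "frontier (map_brk f T) = map f (frontier T)"
  by (induction T) auto

lemma ex_plug_leaf:
  assumes "frontier T = p @ [z] @ q"
  shows "\<exists>D. T = plug_brk (Leaf z) D \<and> frontier D = map Some p @ [None] @ map Some q"
  using assms
proof (induction T arbitrary: p q)
  case (Leaf y)
  then show ?case
    by (intro exI[of _ "Leaf None"]) (auto simp: Cons_eq_append_conv)
next
  case (Node S T)
  from Node.prems have "frontier S @ frontier T = p @ [z] @ q" by simp
  then consider r where "frontier S = p @ [z] @ r" "q = r @ frontier T"
    | r where "frontier T = r @ [z] @ q" "p = frontier S @ r"
  proof -
    assume eq: "frontier S @ frontier T = p @ [z] @ q"
    assume *: "\<And>r. frontier S = p @ [z] @ r \<Longrightarrow> q = r @ frontier T \<Longrightarrow> thesis"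
      "\<And>r. frontier T = r @ [z] @ q \<Longrightarrow> p = frontier S @ r \<Longrightarrow> thesis"
    from eq consider u where "frontier S = p @ u" "u @ frontier T = [z] @ q"
      | r where "p = frontier S @ r" "frontier T = r @ [z] @ q"
      unfolding append_eq_append_conv2 by metis
    then show thesis
    proof cases
      case 1
      then show thesis
        using * *(2)[of "[]"] by (cases u) auto
    qed (use * in blast)
  qed
  then show ?case
  proof cases
    case 1
    then obtain D where "S = plug_brk (Leaf z) D" "frontier D = map Some p @ [None] @ map Some r"
      using Node.IH(1) by blast
    then show ?thesis
      using 1 by (intro exI[of _ "Node D (map_brk Some T)"]) auto
  next
    case 2
    then obtain D where "T = plug_brk (Leaf z) D" "frontier D = map Some r @ [None] @ map Some q"
      using Node.IH(2) by blast
    then show ?thesis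
      using 2 by (intro exI[of _ "Node (map_brk Some S) D"]) auto
  qed
qed

context alphabet
begin

text \<open>Shirshov's lemma on Lyndon subwords. A node that splits the subword \<open>v\<close> begins with it,
  for otherwise the right factor of the node would not be its least suffix.\<close>

lemma NLSW_subword:
  assumes T: "is_NLSW gt T" "set (frontier T) \<subseteq> Z" and v: "lyn v" and eq: "frontier T = p @ v @ q"
  shows "\<exists>D S c r. q = c @ r \<and> is_NLSW gt S \<and> frontier S = v @ c \<and> T = plug_brk S D \<and>
    frontier D = map Some p @ [None] @ map Some r"
  using T eq
proof (induction T arbitrary: p q)
  case (Leaf z)
  then have "p = []" "v = [z]" "q = []"
    using lyn_nonempty[OF v] by (auto simp: Cons_eq_append_conv append_eq_Cons_conv)
  then show ?case
    using Leaf by (intro exI[of _ "Leaf None"] exI[of _ "Leaf z"]) auto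
next
  case (Node S T)
  let ?s = "frontier S" and ?t = "frontier T"
  have eq: "?s @ ?t = p @ v @ q" using Node.prems by simp
  consider r where "?s = p @ v @ r" "q = r @ ?t"
    | r where "?t = r @ v @ q" "p = ?s @ r"
    | v1 v2 where "?s = p @ v1" "v = v1 @ v2" "?t = v2 @ q" "v1 \<noteq> []" "v2 \<noteq> []"
  proof -
    from eq consider r where "?s = p @ r" "r @ ?t = v @ q" | r where "p = ?s @ r" "?t = r @ v @ q"
      by (auto simp: append_eq_append_conv2)
    then show ?thesis
    proof cases
      case 1
      from 1(2) consider l where "r = v @ l" "q = l @ ?t" | l where "v = r @ l" "?t = l @ q"
        by (auto simp: append_eq_append_conv2)
      then show ?thesis
      proof cases
        case l: 2
        then show ?thesis
          using that[of "[]"] that(3) 1 by (cases "l = []"; cases "r = []") auto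
      qed (use 1 that in auto)
    qed (use that in auto)
  qed
  then show ?case
  proof cases
    case 1
    then obtain D S' c r' where "r = c @ r'" "is_NLSW gt S'" "frontier S' = v @ c" "S = plug_brk S' D"
      "frontier D = map Some p @ [None] @ map Some r'"
      using Node.IH(1)[of p r] Node.prems by auto
    then show ?thesis
      using 1 by (intro exI[of _ "Node D (map_brk Some T)"] exI[of _ S'] exI[of _ c]
          exI[of _ "r' @ ?t"]) auto
  next
    case 2
    then obtain D S' c r' where "q = c @ r'" "is_NLSW gt S'" "frontier S' = v @ c" "T = plug_brk S' D"
      "frontier D = map Some r @ [None] @ map Some r'"
      using Node.IH(2)[of r q] Node.prems by auto
    then show ?thesis
      using 2 by (intro exI[of _ "Node (map_brk Some S) D"] exI[of _ S'] exI[of _ c]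
          exI[of _ r']) auto
  next
    case 3
    have "p = []"
    proof (rule ccontr)
      assume "p \<noteq> []"
      have "lyn (v2 @ q)" using is_NLSW_lyn[of T] Node.prems 3 by auto
      then have l: "lyn (v1 @ ?t)" using lyn_overlap[of v1 v2 q] v 3 by simp
      have "?t \<sqsubseteq> v1 @ ?t"
        using NLSW_min_suffix[of S T p "v1 @ ?t"] Node.prems 3 \<open>p \<noteq> []\<close> by auto
      moreover have "v1 @ ?t \<sqsubset> ?t" using lyn_suffix[OF l] 3 by simp
      ultimately show False
        using lex_asym lex_irrefl by metis
    qed
    then show ?thesis
      using 3 Node.prems
      by (intro exI[of _ "Leaf None"] exI[of _ "Node S T"] exI[of _ q] exI[of _ "[]"]) auto
  qed
qed

end

section \<open>Spanning by Lyndon--Shirshov words\<close>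

lemma linear_add: "Vector_Spaces.linear s1 s2 f \<Longrightarrow> f (x + y) = f x + f y"
  and linear_scale: "Vector_Spaces.linear s1 s2 f \<Longrightarrow> f (s1 c x) = s2 c (f x)"
  by (auto simp: Vector_Spaces.linear_iff)

lemma linear_zero: "Vector_Spaces.linear s1 s2 f \<Longrightarrow> f 0 = 0"
  using linear_add[of s1 s2 f 0 0] by simp

lemma linear_neg: "Vector_Spaces.linear s1 s2 f \<Longrightarrow> f (- x) = - f x"
  using linear_add[of s1 s2 f "- x" x] linear_zero[of s1 s2 f] by (simp add: eq_neg_iff_add_eq_0)

lemma linear_diff: "Vector_Spaces.linear s1 s2 f \<Longrightarrow> f (x - y) = f x - f y"
  using linear_add[of s1 s2 f x "- y"] linear_neg[of s1 s2 f y] by simp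

lemma linear_sum: "Vector_Spaces.linear s1 s2 f \<Longrightarrow> f (sum g A) = (\<Sum>a\<in>A. f (g a))"
  by (induction A rule: infinite_finite_induct) (simp_all add: linear_zero linear_add)

context lie_algebra
begin

lemma br_add_left: "br (x + y) z = br x z + br y z"
  and br_add_right: "br z (x + y) = br z x + br z y"
  using linear_add[OF br_linear_left] linear_add[OF br_linear_right] by auto

lemma br_scale_left: "br (scale c x) z = scale c (br x z)"
  and br_scale_right: "br z (scale c x) = scale c (br z x)"
  using linear_scale[OF br_linear_left] linear_scale[OF br_linear_right] by auto

lemma br_zero_left [simp]: "br 0 z = 0" and br_zero_right [simp]: "br z 0 = 0"
  using linear_zero[OF br_linear_left] linear_zero[OF br_linear_right] by auto

lemma br_diff_right: "br z (x - y) = br z x - br z y"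
  using linear_diff[OF br_linear_right] .

lemma br_uminus_left: "br (- y) z = - br y z"
  using linear_neg[OF br_linear_left] .

lemma br_antisym: "br x y = - br y x"
proof -
  have "br (x + y) (x + y) = br x x + br x y + (br y x + br y y)"
    by (simp only: br_add_left br_add_right add_ac)
  then show ?thesis
    by (simp add: br_self eq_neg_iff_add_eq_0)
qed

lemma br_jacobi_left: "br (br x y) z = br (br x z) y + br x (br y z)"
proof -
  have 1: "br z (br x y) = - br (br x y) z" by (rule br_antisym)
  have 2: "br y (br z x) = br (br x z) y"
    using br_antisym[of y "br z x"] br_antisym[of z x] by (simp add: br_uminus_left)
  show ?thesis
    using jacobi[of x y z] unfolding 1 2 by (simp add: algebra_simps)
qed

lemma br_in_span:
  assumes "x \<in> span A" "y \<in> span B" and br: "\<And>a b. a \<in> A \<Longrightarrow> b \<in> B \<Longrightarrow> br a b \<in> span C"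
  shows "br x y \<in> span C"
  using assms(1)
proof (induction rule: span_induct_alt)
  case (step c a x')
  have "br a y \<in> span C" using assms(2)
    by (induction rule: span_induct_alt)
      (auto simp: br_add_right br_scale_right span_zero br step.hyps intro!: span_add span_scale)
  then show ?case
    using step by (auto simp: br_add_left br_scale_left intro!: span_add span_scale)
qed (simp add: span_zero)

end

primrec brk_eval :: "('l \<Rightarrow> 'l \<Rightarrow> 'l) \<Rightarrow> ('z \<Rightarrow> 'l) \<Rightarrow> 'z brk \<Rightarrow> 'l" where
  "brk_eval br e (Leaf z) = e z"
| "brk_eval br e (Node S T) = br (brk_eval br e S) (brk_eval br e T)"

abbreviation shirshov_eval :: "('z \<Rightarrow> 'z \<Rightarrow> bool) \<Rightarrow> ('l \<Rightarrow> 'l \<Rightarrow> 'l) \<Rightarrow> ('z \<Rightarrow> 'l) \<Rightarrow> 'z list \<Rightarrow> 'l" where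
  "shirshov_eval gt br e w \<equiv> brk_eval br e (shirshov_bracketing gt w)"

context alphabet
begin

text \<open>If the standard bracketings of \<open>u\<close> and \<open>v\<close> do not combine to that of \<open>uv\<close>, then the right factor
  of \<open>u\<close> precedes \<open>v\<close>, and the Jacobi identity leaves brackets of words that all precede \<open>v\<close>.\<close>

lemma shirshov_eval_br:
  assumes lie: "lie_algebra scale br" and "lyn u" "lyn v" "u \<sqsubset> v"
  shows "br (shirshov_eval gt br e u) (shirshov_eval gt br e v) \<in>
    module.span scale (shirshov_eval gt br e ` {w. lyn w \<and> mset w = mset (u @ v) \<and> w \<sqsubset> v})"
  using assms(2-)
proof (induction "length u + length v" arbitrary: u v rule: less_induct)
  case (less u0 v0)
  interpret lie_algebra scale br by (rule lie)
  note outer = less.hyps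
  let ?val = "shirshov_eval gt br e"
  let ?SP = "\<lambda>v M. span (?val ` {w. lyn w \<and> mset w = M \<and> w \<sqsubset> v})"
  let ?M = "mset (u0 @ v0)"
  \<comment> \<open>The inner induction is on the number of words preceding \<open>v\<close>;
    bounding letters and length by those of the fixed content makes this set finite. The outer
    induction, on the total length, serves the brackets of \<open>v\<close> with the two factors of
    \<open>u\<close>.\<close>
  define below where "below v = {x. set x \<subseteq> set_mset ?M \<and> length x \<le> size ?M \<and> x \<sqsubset> v}" for v
  have fin: "finite (below v)" for v
    unfolding below_def by (rule finite_subset[OF _ finite_lists_length_le[of "set_mset ?M" "size ?M"]]) auto
  have SP_mono: "?SP v M \<subseteq> ?SP v' M" if "v \<sqsubset> v'" for v v' M
    using lex_trans that by (intro span_mono) auto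
  have "br (?val u) (?val v) \<in> ?SP v ?M" if "lyn u" "lyn v" "u \<sqsubset> v" "mset (u @ v) = ?M" for u v
    using that
  proof (induction "card (below v)" arbitrary: u v rule: less_induct)
    case (less v u)
    have sz: "length u + length v = size ?M" "length u0 + length v0 = size ?M"
      using arg_cong[OF less.prems(4), of size] by simp_all
    \<comment> \<open>Two words that both precede \<open>v\<close>: once they are put in order, the
      later one takes the role of \<open>v\<close> and has fewer words below it.\<close>
    have pair: "br (?val a) (?val b) \<in> ?SP v ?M"
      if pr: "lyn a" "lyn b" "a \<sqsubset> v" "b \<sqsubset> v" "mset (a @ b) = ?M" for a b
    proof -
      have *: "br (?val a) (?val b) \<in> ?SP v ?M"
        if ab: "lyn a" "lyn b" "b \<sqsubset> v" "mset (a @ b) = ?M" "a \<sqsubset> b" for a b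
      proof -
        have "set b \<subseteq> set_mset ?M" using ab(4) by (metis set_append set_mset_mset sup_ge2)
        moreover have "length b \<le> size ?M" using arg_cong[OF ab(4), of size] by simp
        ultimately have b: "b \<in> below v" using ab(3) by (simp only: below_def mem_Collect_eq)
        moreover have "b \<notin> below b" by (simp add: below_def lex_irrefl)
        moreover have "below b \<subseteq> below v"
          unfolding below_def using lex_trans[OF _ ab(3)] by blast
        ultimately have "card (below b) < card (below v)"
          by (intro psubset_card_mono[OF fin]) auto
        then show ?thesis
          using less.hyps[of b a] ab SP_mono[of b v ?M] by blast
      qed
      consider "a = b" | "a \<sqsubset> b" | "b \<sqsubset> a"
        using lex_total[OF lyn_set lyn_set, OF pr(1,2)] by blast
      then show ?thesis
      proof cases
        case 1
        then show ?thesis by (simp add: br_self span_zero)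
      next
        case 2
        then show ?thesis using *[OF pr(1,2,4,5)] by blast
      next
        case 3
        then have "br (?val b) (?val a) \<in> ?SP v ?M"
          using *[of b a] pr by (simp add: union_commute)
        then show ?thesis
          by (subst br_antisym) (rule span_neg)
      qed
    qed
    have uv: "lyn (u @ v)" "u @ v \<sqsubset> v"
    proof -
      show "lyn (u @ v)" by (rule lyn_append[OF less.prems(1-3)])
      then show "u @ v \<sqsubset> v" using less.prems(1,2)[THEN lyn_nonempty] by (intro lyn_suffix)
    qed
    show ?case
    proof (cases "\<exists>S1 S2. shirshov_bracketing gt u = Node S1 S2 \<and> frontier S2 \<sqsubset> v")
      case False
      have "lex_le gt (frontier S2) v" if "shirshov_bracketing gt u = Node S1 S2" for S1 S2
      proof -
        have "set (frontier S2) \<subseteq> Z"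
          using shirshov_bracketing(2)[of u] that less.prems lyn_set[of u] by auto
        then have "frontier S2 = v \<or> v \<sqsubset> frontier S2"
          using False that lex_total[OF _ lyn_set[OF less.prems(2)], of "frontier S2"] by blast
        then show ?thesis
          by (auto simp: lex_le_def)
      qed
      then have "is_NLSW gt (Node (shirshov_bracketing gt u) (shirshov_bracketing gt v))"
        using shirshov_bracketing less.prems uv lyn_ALSW_UNIV by auto
      then have "shirshov_bracketing gt (u @ v) =
          Node (shirshov_bracketing gt u) (shirshov_bracketing gt v)"
        using shirshov_bracketing(2) less.prems uv lyn_set by (intro shirshov_bracketing_eqI) auto
      then have "br (?val u) (?val v) = ?val (u @ v)" by simp
      then show ?thesis
        using uv less.prems by (intro span_base) auto
    next
      case True
      then obtain S1 S2 where S: "shirshov_bracketing gt u = Node S1 S2" "frontier S2 \<sqsubset> v"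
        by blast
      define u1 where "u1 = frontier S1"
      define u2 where "u2 = frontier S2"
      have u: "u = u1 @ u2"
        using shirshov_bracketing(2)[of u] S less.prems by (simp add: u1_def u2_def)
      have NL: "is_NLSW gt (Node S1 S2)" using shirshov_bracketing(1)[of u] S less.prems by simp
      have sub: "set u1 \<subseteq> Z" "set u2 \<subseteq> Z" using u less.prems lyn_set[of u] by auto
      have l: "lyn u1" "lyn u2"
        using is_NLSW_lyn[of S1] is_NLSW_lyn[of S2] NL sub by (auto simp: u1_def u2_def)
      have "?val u1 = brk_eval br e S1" "?val u2 = brk_eval br e S2"
        using shirshov_bracketing_eqI[of S1 u1] shirshov_bracketing_eqI[of S2 u2] NL sub
        by (auto simp: u1_def u2_def)
      then have val_u: "?val u = br (?val u1) (?val u2)" using S by simp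
      have ne: "u1 \<noteq> []" "u2 \<noteq> []" using l lyn_nonempty by auto
      have u2v: "u2 \<sqsubset> v" using S by (simp add: u2_def)
      have "u \<sqsubset> u2" using lyn_suffix[of u1 u2] u less.prems ne by simp
      then have u1v: "u1 \<sqsubset> v"
        using lex_trans[OF lex_trans[OF lex_prefix[of u2 u1]] u2v] ne u by simp
      have "length u1 + length v < length u0 + length v0" "length u2 + length v < length u0 + length v0"
      proof -
        have "length u = length u1 + length u2" "length u1 > 0" "length u2 > 0"
          using u ne by simp_all
        then show "length u1 + length v < length u0 + length v0" "length u2 + length v < length u0 + length v0"
          using sz by linarith+
      qed
      then have b: "br (?val u1) (?val v) \<in> ?SP v (mset (u1 @ v))"
        "br (?val u2) (?val v) \<in> ?SP v (mset (u2 @ v))"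
        using outer[OF _ l(1) less.prems(2) u1v] outer[OF _ l(2) less.prems(2) u2v] by blast+
      have M: "?M = mset u1 + mset u2 + mset v" using less.prems(4) u by (simp add: add.assoc)
      have 1: "br (br (?val u1) (?val v)) (?val u2) \<in> ?SP v ?M"
      proof (rule br_in_span[OF b(1) span_base[of _ "{?val u2}"]])
        fix x y
        assume "x \<in> ?val ` {w. lyn w \<and> mset w = mset (u1 @ v) \<and> w \<sqsubset> v}" "y \<in> {?val u2}"
        then obtain w where w: "x = ?val w" "lyn w" "mset w = mset (u1 @ v)" "w \<sqsubset> v" "y = ?val u2"
          by blast
        show "br x y \<in> ?SP v ?M"
          unfolding w(1,5) by (rule pair[OF w(2) l(2) w(4) u2v]) (subst M, simp add: w(3) union_ac)
      qed simp
      have 2: "br (?val u1) (br (?val u2) (?val v)) \<in> ?SP v ?M"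
      proof (rule br_in_span[OF span_base[of _ "{?val u1}"] b(2)])
        fix x y
        assume "x \<in> {?val u1}" "y \<in> ?val ` {w. lyn w \<and> mset w = mset (u2 @ v) \<and> w \<sqsubset> v}"
        then obtain w where w: "y = ?val w" "lyn w" "mset w = mset (u2 @ v)" "w \<sqsubset> v" "x = ?val u1"
          by blast
        show "br x y \<in> ?SP v ?M"
          unfolding w(1,5) by (rule pair[OF l(1) w(2) u1v w(4)]) (subst M, simp add: w(3) union_ac)
      qed simp
      show ?thesis
        unfolding val_u br_jacobi_left[of "?val u1" "?val u2"] using 1 2 by (rule span_add)
    qed
  qed
  then show ?case
    using less.prems by blast
qed

lemma shirshov_eval_br_in_span:
  assumes lie: "lie_algebra scale br" and "lyn u" "lyn v"
  shows "br (shirshov_eval gt br e u) (shirshov_eval gt br e v) \<in>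
    module.span scale (shirshov_eval gt br e ` {w. lyn w \<and> mset w = mset (u @ v)})"
proof -
  interpret lie_algebra scale br by (rule lie)
  let ?val = "shirshov_eval gt br e"
  let ?SP = "\<lambda>M. span (?val ` {w. lyn w \<and> mset w = M})"
  have *: "br (?val a) (?val b) \<in> ?SP (mset (a @ b))" if "lyn a" "lyn b" "a \<sqsubset> b" for a b
    using shirshov_eval_br[OF lie that] by (rule subsetD[OF span_mono, rotated]) auto
  consider "u = v" | "u \<sqsubset> v" | "v \<sqsubset> u"
    using lex_total[OF lyn_set lyn_set, OF assms(2,3)] by blast
  then show ?thesis
  proof cases
    case 1
    then show ?thesis by (simp add: br_self span_zero)
  next
    case 2
    then show ?thesis using * assms by blast
  next
    case 3
    then have "br (?val v) (?val u) \<in> ?SP (mset (u @ v))"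
      using *[of v u] assms by (simp add: union_commute)
    then show ?thesis
      by (subst br_antisym) (rule span_neg)
  qed
qed

end

text \<open>Only comparisons between letters that occur enter the definition. The inner claim keeps
  the letter set of \<open>T\<close> fixed while the subtree varies, so the hypotheses remain usable
  in the induction.\<close>

lemma is_NLSW_map_brk:
  assumes "\<And>p q. p \<in> set (frontier T) \<Longrightarrow> q \<in> set (frontier T) \<Longrightarrow> gt' (f p) (f q) \<longleftrightarrow> gt p q"
    and "inj_on f (set (frontier T))" and "is_NLSW gt T"
  shows "is_NLSW gt' (map_brk f T)"
proof -
  have lex: "lex_greater gt' (map f u) (map f v) \<longleftrightarrow> lex_greater gt u v"
    if "set u \<subseteq> set (frontier T)" "set v \<subseteq> set (frontier T)" for u v
    using that assms(1,2) by (intro lex_greater_map) (auto dest: inj_onD)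
  have alsw: "map f w \<in> ALSW_on gt' UNIV" if "w \<in> ALSW_on gt UNIV" "set w \<subseteq> set (frontier T)" for w
    using that lex by (fastforce simp: ALSW_on_def map_eq_append_conv simp flip: map_append)
  have "is_NLSW gt' (map_brk f T')" if "is_NLSW gt T'" "set (frontier T') \<subseteq> set (frontier T)" for T'
    using that
  proof (induction T')
    case (Leaf z)
    then show ?case using alsw[of "[z]"] by simp
  next
    case (Node S1 S2)
    have "lex_le gt' (frontier s2) (map f (frontier S2))" if eq: "map_brk f S1 = Node s1 s2" for s1 s2
    proof -
      from eq obtain r1 r2 where "S1 = Node r1 r2" "s2 = map_brk f r2" by (cases S1) auto
      then show ?thesis
        using Node.prems lex[of "frontier S2" "frontier r2"] by (auto simp: lex_le_def)
    qed
    then show ?case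
      using Node alsw[of "frontier S1 @ frontier S2"] by auto
  qed
  then show ?thesis
    using assms(3) by blast
qed

section \<open>The order of the words with operator\<close>

lemma pdeg_pos [simp]: "pdeg p > 0"
  by (cases p) auto

lemma pdeg_nonzero [simp]: "pdeg p \<noteq> 0"
  using pdeg_pos[of p] by simp

lemma odeg_simps [simp]: "odeg [] = 0" "odeg (p # w) = pdeg p + odeg w" "odeg (u @ v) = odeg u + odeg v"
  by (simp_all add: odeg_def)

lemma pdeg_Op [simp]: "pdeg (Op w) = Suc (odeg w)"
  by (simp add: odeg_def)

declare pdeg.simps(2) [simp del]

lemma pdeg_le_odeg: "p \<in> set w \<Longrightarrow> pdeg p \<le> odeg w"
  by (induction w) auto

lemma odeg_mset: "mset u = mset v \<Longrightarrow> odeg u = odeg v"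
  unfolding odeg_def by (metis mset_map sum_mset_sum_list)

abbreviation prime_rel :: "('x::wellorder oprime \<times> 'x oprime) set" where
  "prime_rel \<equiv> {(p, q). prime_less p q}"

lemma dl_less_iff: "dl_less u v \<longleftrightarrow> odeg u < odeg v \<or> odeg u = odeg v \<and>
    (length u < length v \<or> length u = length v \<and> (u, v) \<in> lexord prime_rel)"
proof -
  have diff: "dl_less u v" if "odeg u = odeg v" "length u = length v" "(u, v) \<in> lexord prime_rel"
  proof -
    obtain r p q s t where "u = r @ p # s" "v = r @ q # t" "prime_less p q"
      using \<open>(u, v) \<in> lexord prime_rel\<close> \<open>length u = length v\<close> by (auto simp: lexord_def)
    then show ?thesis
      using that(1,2) prime_less_dl_less.intros(6)[of r p s q t] by simp
  qed
  show ?thesis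
  proof
    assume "dl_less u v"
    then show "odeg u < odeg v \<or> odeg u = odeg v \<and>
      (length u < length v \<or> length u = length v \<and> (u, v) \<in> lexord prime_rel)"
    proof (cases rule: dl_less.cases)
      case (3 r p s q t)
      then show ?thesis
        using lexord_append_left_rightI[of p q prime_rel r s t] by simp
    qed simp_all
  qed (use diff prime_less_dl_less.intros(4,5) in blast)
qed

lemma dl_less_odeg: "dl_less u v \<Longrightarrow> odeg u \<le> odeg v"
  by (auto simp: dl_less_iff)

lemma prime_less_iff: "prime_less p q \<longleftrightarrow> pdeg p < pdeg q \<or> (\<exists>x y. p = Ltr x \<and> q = Ltr y \<and> x < y) \<or>
    (\<exists>a b. p = Op a \<and> q = Op b \<and> odeg a = odeg b \<and> dl_less a b)"
  by (subst prime_less.simps) auto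

lemma prime_less_pdeg: "prime_less p q \<Longrightarrow> pdeg p \<le> pdeg q"
  by (auto simp: prime_less_iff)

lemma prime_less_irrefl: "\<not> prime_less p p"
proof (induction p)
  case (Op w)
  have "\<not> (w, w) \<in> lexord prime_rel" using Op by (auto simp: lexord_def)
  then show ?case
    by (simp add: prime_less_iff[of "Op w"] dl_less_iff)
qed (simp add: prime_less_iff)

lemma dl_less_irrefl: "\<not> dl_less w w"
  using prime_less_irrefl by (auto simp: dl_less_iff lexord_def)

lemma prime_less_trans: "prime_less p q \<Longrightarrow> prime_less q r \<Longrightarrow> prime_less p r"
proof (induction p arbitrary: q r)
  case (Ltr x)
  then show ?case
    by (auto simp: prime_less_iff)
next
  case (Op a)
  show ?case
  proof (cases "pdeg (Op a) < pdeg r")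
    case False
    then have "pdeg (Op a) = pdeg q" "pdeg q = pdeg r"
      using prime_less_pdeg[OF Op.prems(1)] prime_less_pdeg[OF Op.prems(2)] by linarith+
    then obtain b c where bc: "q = Op b" "r = Op c" "odeg a = odeg b" "odeg b = odeg c"
        "dl_less a b" "dl_less b c"
      using Op.prems unfolding prime_less_iff[of "Op a"] prime_less_iff[of q] by auto
    have "(a, c) \<in> lexord prime_rel" if "(a, b) \<in> lexord prime_rel" "(b, c) \<in> lexord prime_rel"
      using that Op.IH by (intro lexord_partial_trans[of a prime_rel b c]) auto
    then have "dl_less a c" using bc by (auto simp: dl_less_iff)
    then show ?thesis
      using bc by (auto simp: prime_less_iff)
  qed (simp add: prime_less_iff)
qed

lemma dl_less_trans:
  assumes "dl_less u v" "dl_less v w"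
  shows "dl_less u w"
proof -
  have "(u, w) \<in> lexord prime_rel" if "(u, v) \<in> lexord prime_rel" "(v, w) \<in> lexord prime_rel"
    using that prime_less_trans by (intro lexord_partial_trans[of u prime_rel v w]) auto
  then show ?thesis
    using assms by (auto simp: dl_less_iff)
qed

lemma dl_less_asym: "dl_less u v \<Longrightarrow> \<not> dl_less v u"
  using dl_less_trans dl_less_irrefl by blast

lemma dl_less_append: "dl_less u v \<Longrightarrow> dl_less (a @ u @ b) (a @ v @ b)"
  using lexord_append_leftI[OF lexord_sufI[of u v prime_rel b b], of a] by (auto simp: dl_less_iff)

lemma dl_less_append_left: "dl_less u v \<Longrightarrow> dl_less (a @ u) (a @ v)"
  and dl_less_append_right: "dl_less u v \<Longrightarrow> dl_less (u @ b) (v @ b)"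
  using dl_less_append[of u v a "[]"] dl_less_append[of u v "[]" b] by auto

lemma dl_less_single: "dl_less [p] [q] \<longleftrightarrow> prime_less p q"
  using prime_less_pdeg[of p q] by (auto simp: dl_less_iff prime_less_iff[of p q])

lemma dl_less_Op: "dl_less u v \<Longrightarrow> dl_less [Op u] [Op v]"
  unfolding dl_less_single prime_less_iff[of "Op u"] by (auto dest: dl_less_odeg)

text \<open>Permutations agree in degree and breadth, and neither is a proper prefix of the other,
  so both orders look at the first differing prime. This is the bridge from the Lyndon condition to
  leading words.\<close>

lemma dl_less_of_lex_greater:
  assumes "lex_greater prime_greater u v" "mset u = mset v"
  shows "dl_less v u"
proof -
  have "lex_differ prime_greater u v"
    using assms mset_eq_length by (intro lex_differI) fastforce+
  then obtain r a b s t where "u = r @ a # s" "v = r @ b # t" "prime_less b a"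
    unfolding lex_differ_def by blast
  then show ?thesis
    using odeg_mset[OF assms(2)] mset_eq_length[OF assms(2)] by (auto intro!: prime_less_dl_less.intros(6))
qed

text \<open>Primes without \<open>P\<close> of the empty word at any depth. Quantifying over the
  mapped list is the form that primitive recursion through a nested list accepts.\<close>

primrec valid_prime :: "'y oprime \<Rightarrow> bool" where
  "valid_prime (Ltr y) \<longleftrightarrow> True"
| "valid_prime (Op w) \<longleftrightarrow> w \<noteq> [] \<and> (\<forall>b\<in>set (map valid_prime w). b)"

lemma owords_iff: "w \<in> owords \<longleftrightarrow> w \<noteq> [] \<and> (\<forall>p\<in>set w. valid_prime p)"
proof
  have "w \<noteq> [] \<and> (\<forall>p\<in>set w. valid_prime p)" if "w \<in> oword_level n" for n
    using that by (induction n arbitrary: w) fastforce+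
  then show "w \<in> owords \<Longrightarrow> w \<noteq> [] \<and> (\<forall>p\<in>set w. valid_prime p)" unfolding owords_def by blast
next
  have level: "w \<in> oword_level n" if "w \<noteq> []" "\<forall>p\<in>set w. valid_prime p" "odeg w \<le> n" for w :: "'a oword" and n
    using that
  proof (induction n arbitrary: w)
    case 0
    then show ?case by (cases w) auto
  next
    case (Suc n)
    have "p \<in> range Ltr \<union> Op ` oword_level n" if p: "p \<in> set w" for p
    proof (cases p)
      case (Op w')
      then have "w' \<in> oword_level n" using p Suc.prems pdeg_le_odeg[OF p] by (intro Suc.IH) auto
      then show ?thesis
        using Op by blast
    qed blast
    then show ?case
      using Suc.prems by auto
  qed
  show "w \<in> owords" if w: "w \<noteq> [] \<and> (\<forall>p\<in>set w. valid_prime p)"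
    using level[of w "odeg w"] w unfolding owords_def by blast
qed

lemma lexord_total_on:
  assumes "length u = length v" "u \<noteq> v"
    and "\<And>p q. p \<in> set u \<Longrightarrow> q \<in> set v \<Longrightarrow> p \<noteq> q \<Longrightarrow> (p, q) \<in> R \<or> (q, p) \<in> R"
  shows "(u, v) \<in> lexord R \<or> (v, u) \<in> lexord R"
  using assms by (induction u v rule: list_induct2) auto

text \<open>Validity matters for mixed pairs: \<open>Op\<close> of a nonempty word has degree at
  least two, so the degree separates it from a letter.\<close>

lemma prime_less_total: "valid_prime p \<Longrightarrow> valid_prime q \<Longrightarrow> p \<noteq> q \<Longrightarrow> prime_less p q \<or> prime_less q p"
proof (induction p arbitrary: q)
  case (Ltr x)
  show ?case
  proof (cases q)
    case (Op w)
    then obtain z w' where "w = z # w'" using Ltr by (cases w) auto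
    then show ?thesis
      using Op pdeg_pos[of z] by (simp add: prime_less_iff)
  qed (use Ltr in \<open>auto simp: prime_less_iff\<close>)
next
  case (Op w)
  show ?case
  proof (cases q)
    case (Ltr x)
    obtain z w' where "w = z # w'" using Op by (cases w) auto
    then show ?thesis
      using Ltr pdeg_pos[of z] by (simp add: prime_less_iff)
  next
    case q: (Op w')
    have "(w, w') \<in> lexord prime_rel \<or> (w', w) \<in> lexord prime_rel" if "length w = length w'"
      using that Op q by (intro lexord_total_on) auto
    then have "dl_less w w' \<or> dl_less w' w" by (auto simp: dl_less_iff)
    then show ?thesis
      unfolding q prime_less_iff[of "Op w"] prime_less_iff[of "Op w'"] by (auto dest: dl_less_odeg)
  qed
qed

lemma dl_less_total:
  assumes "\<forall>p\<in>set u. valid_prime p" "\<forall>p\<in>set v. valid_prime p" "u \<noteq> v"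
  shows "dl_less u v \<or> dl_less v u"
proof -
  have "(u, v) \<in> lexord prime_rel \<or> (v, u) \<in> lexord prime_rel" if "length u = length v"
    using that assms prime_less_total by (intro lexord_total_on) auto
  then show ?thesis
    by (auto simp: dl_less_iff)
qed

section \<open>Well-foundedness of the order\<close>

lemma wf_graded:
  fixes f :: "'a \<Rightarrow> nat"
  assumes "\<And>k. wf {(x, y). (x, y) \<in> S \<and> f x = k \<and> f y = k}"
  shows "wf {(x, y). f x < f y \<or> f x = f y \<and> (x, y) \<in> S}" (is "wf ?R")
proof (rule wfUNIVI)
  fix P x
  assume step: "\<forall>x. (\<forall>y. (y, x) \<in> ?R \<longrightarrow> P y) \<longrightarrow> P x"
  show "P x"
  proof (induction "f x" arbitrary: x rule: less_induct)
    case less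
    note outer = less
    have "f y = f x \<longrightarrow> P y" for y
    proof (induction y rule: wf_induct[OF assms[of "f x"]])
      case (1 y)
      show ?case
      proof
        assume y: "f y = f x"
        have "P z" if "(z, y) \<in> ?R" for z
          using that outer[of z] 1 y by auto
        then show "P y" using step by blast
      qed
    qed
    then show ?case by blast
  qed
qed

text \<open>At fixed degree \<open>k\<close>, two letters are compared in a well-order, and
  \<open>Op a\<close> with \<open>Op b\<close> by length and then lexicographically. The primes
  compared inside \<open>a\<close> and \<open>b\<close> have degree below \<open>k\<close>, so the
  cut-off \<open>pdeg q < k\<close> in \<open>?D\<close> makes their order well-founded by the
  induction hypothesis.\<close>

lemma wf_prime_less_deg: "wf {(p, q). prime_less p q \<and> pdeg p = k \<and> pdeg q = (k::nat)}" (is "wf (?S k)")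
proof (induction k rule: less_induct)
  case (less k)
  let ?L = "map_prod Ltr Ltr ` {(x, y). x < (y :: 'a)}"
  let ?D = "lenlex {(p :: 'a oprime, q). pdeg p < pdeg q \<or> pdeg p = pdeg q \<and> prime_less p q \<and> pdeg q < k}"
  have "wf {(p :: 'a oprime, q). pdeg p < pdeg q \<or>
      pdeg p = pdeg q \<and> (p, q) \<in> {(p, q). prime_less p q \<and> pdeg q < k}}"
  proof (rule wf_graded)
    fix j
    show "wf {(x :: 'a oprime, y). (x, y) \<in> {(p, q). prime_less p q \<and> pdeg q < k} \<and> pdeg x = j \<and> pdeg y = j}"
    proof (cases "j < k")
      case True
      show ?thesis
        by (rule wf_subset[OF less[OF True]]) auto
    next
      case False
      then have "{(x :: 'a oprime, y). (x, y) \<in> {(p, q). prime_less p q \<and> pdeg q < k} \<and> pdeg x = j \<and> pdeg y = j} = {}"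
        by auto
      then show ?thesis by (rule ssubst) simp
    qed
  qed
  then have D: "wf ?D" by (intro wf_lenlex) simp
  have sub: "(a, b) \<in> ?D" if "dl_less a b" "odeg a = odeg b" "Suc (odeg b) = k" for a b :: "'a oword"
  proof -
    have "length a < length b \<or> length a = length b \<and> (a, b) \<in> lexord prime_rel"
      using that by (auto simp: dl_less_iff)
    moreover have "(a, b) \<in> lex {(p :: 'a oprime, q). pdeg p < pdeg q \<or> pdeg p = pdeg q \<and> prime_less p q \<and> pdeg q < k}"
      if l: "length a = length b" "(a, b) \<in> lexord prime_rel"
    proof -
      obtain r p q s t where d: "a = r @ p # s" "b = r @ q # t" "prime_less p q"
        using l by (auto simp: lexord_def)
      then have "pdeg q < k" using \<open>Suc (odeg b) = k\<close> by auto
      then show ?thesis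
        using d l prime_less_pdeg[OF d(3)]
        unfolding lexord_lex d by (intro conjI lexord_append_left_rightI) auto
    qed
    ultimately show ?thesis
      by (auto simp: lenlex_conv)
  qed
  have "wf (?L \<union> map_prod Op Op ` ?D)"
  proof (rule wf_Un)
    show "wf ?L" by (intro wf_map_prod_image wf) (auto simp: inj_def)
    show "wf (map_prod Op Op ` ?D)" by (intro wf_map_prod_image D) (auto simp: inj_def)
  qed auto
  moreover have "?S k \<subseteq> ?L \<union> map_prod Op Op ` ?D"
  proof
    fix x assume "x \<in> ?S k"
    then obtain p q :: "'a oprime" where x: "x = (p, q)" "prime_less p q" "pdeg p = k" "pdeg q = k"
      by blast
    then consider y z where "p = Ltr y" "q = Ltr z" "y < z"
      | a b where "p = Op a" "q = Op b" "odeg a = odeg b" "dl_less a b"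
      unfolding prime_less_iff[of p q] by auto
    then show "x \<in> ?L \<union> map_prod Op Op ` ?D"
    proof cases
      case 1
      then show ?thesis using x by force
    next
      case 2
      then have "(a, b) \<in> ?D" using x by (intro sub) auto
      then show ?thesis using x 2 by force
    qed
  qed
  ultimately show ?case
    by (rule wf_subset)
qed

lemma wf_dl_less: "wf {(u :: 'a::wellorder oword, v). dl_less u v}"
proof -
  have P: "wf (prime_rel :: ('a oprime \<times> 'a oprime) set)"
  proof (rule wf_subset)
    show "wf {(p :: 'a oprime, q). pdeg p < pdeg q \<or> pdeg p = pdeg q \<and> (p, q) \<in> prime_rel}"
      by (rule wf_graded) (use wf_prime_less_deg in simp)
  qed (auto dest: prime_less_pdeg)
  have "wf {(u :: 'a oword, v). odeg u < odeg v \<or> odeg u = odeg v \<and> (u, v) \<in> lenlex prime_rel}"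
    by (rule wf_graded, rule wf_subset[OF wf_lenlex[OF P]]) auto
  then show ?thesis
    by (rule wf_subset) (auto simp: dl_less_iff lenlex_conv lexord_lex)
qed

section \<open>Lyndon--Shirshov words with operator\<close>

interpretation primes: alphabet prime_greater "Collect valid_prime"
  by standard (use prime_less_irrefl prime_less_trans prime_less_total in blast)+

text \<open>\<open>primes.lyn\<close> constrains the outermost level only, \<open>ALSW\<close> all levels.\<close>

definition LS_prime :: "'x::wellorder oprime \<Rightarrow> bool" where
  "LS_prime p \<longleftrightarrow> p \<in> range Ltr \<union> Op ` ALSW"

lemma LS_prime_simps [simp]: "LS_prime (Ltr x)" "LS_prime (Op w) \<longleftrightarrow> w \<in> ALSW"
  by (auto simp: LS_prime_def)

lemma ALSW_level_valid: "w \<in> ALSW_level n \<Longrightarrow> w \<noteq> [] \<and> (\<forall>p\<in>set w. valid_prime p)"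
  by (induction n arbitrary: w) (fastforce simp: ALSW_on_def)+

lemma ALSW_level_iff:
  "w \<in> ALSW_level (Suc n) \<longleftrightarrow> primes.lyn w \<and> set w \<subseteq> range Ltr \<union> Op ` ALSW_level n"
  "w \<in> ALSW_level 0 \<longleftrightarrow> primes.lyn w \<and> set w \<subseteq> range Ltr"
  using ALSW_level_valid[of _ n] by (auto simp: primes.lyn_iff_ALSW_on ALSW_on_def) fastforce+

text \<open>Each nesting of \<open>Op\<close> costs one degree, so the degree bounds the level.
  Words from different levels can thereby be moved to a common one.\<close>

lemma ALSW_level_of_odeg:
  assumes "w \<in> ALSW_level m" "odeg w \<le> n"
  shows "w \<in> ALSW_level n"
  using assms
proof (induction n arbitrary: w m)
  case 0
  then show ?case
    using ALSW_level_valid[of w m] by (cases w) auto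
next
  case (Suc n)
  have l: "primes.lyn w" "set w \<subseteq> range Ltr \<union> Op ` (\<Union>m. ALSW_level m)"
    using Suc.prems(1) by (cases m; force simp: ALSW_level_iff simp del: ALSW_level.simps)+
  have "p \<in> range Ltr \<union> Op ` ALSW_level n" if p: "p \<in> set w" for p
  proof (cases p)
    case (Op w')
    then obtain m' where "w' \<in> ALSW_level m'" using l p by auto
    then have "w' \<in> ALSW_level n"
      using p Op Suc.prems(2) pdeg_le_odeg[OF p] by (intro Suc.IH) auto
    then show ?thesis
      using Op by blast
  qed blast
  then show ?case
    using l unfolding ALSW_level_iff by blast
qed

lemma ALSW_iff: "w \<in> ALSW \<longleftrightarrow> primes.lyn w \<and> (\<forall>p\<in>set w. LS_prime p)"
proof
  assume "w \<in> ALSW"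
  then obtain n where "w \<in> ALSW_level n" by (auto simp: ALSW_def)
  then have "w \<in> ALSW_level (Suc (odeg w))" by (rule ALSW_level_of_odeg) simp
  then show "primes.lyn w \<and> (\<forall>p\<in>set w. LS_prime p)"
    unfolding ALSW_level_iff LS_prime_def ALSW_def by blast
next
  assume w: "primes.lyn w \<and> (\<forall>p\<in>set w. LS_prime p)"
  have "p \<in> range Ltr \<union> Op ` ALSW_level (odeg w)" if p: "p \<in> set w" for p
  proof (cases p)
    case (Op w')
    then have "LS_prime (Op w')" using w p by blast
    then obtain m where "w' \<in> ALSW_level m" by (auto simp: ALSW_def)
    then have "w' \<in> ALSW_level (odeg w)"
    proof (rule ALSW_level_of_odeg)
      show "odeg w' \<le> odeg w" using Op pdeg_le_odeg[OF p] by simp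
    qed
    then show ?thesis
      using Op by blast
  qed blast
  then have "w \<in> ALSW_level (Suc (odeg w))" using w unfolding ALSW_level_iff by blast
  then show "w \<in> ALSW" unfolding ALSW_def by blast
qed

lemma ALSW_lyn: "w \<in> ALSW \<Longrightarrow> primes.lyn w"
  by (simp add: ALSW_iff)

lemma ALSW_valid: "w \<in> ALSW \<Longrightarrow> p \<in> set w \<Longrightarrow> valid_prime p"
  using ALSW_lyn primes.lyn_set by blast

lemma ALSW_nonempty: "w \<in> ALSW \<Longrightarrow> w \<noteq> []"
  using ALSW_lyn primes.lyn_nonempty by blast

lemma LS_prime_valid: "LS_prime p \<Longrightarrow> valid_prime p"
  using ALSW_valid ALSW_nonempty by (cases p) auto

lemma ALSW_single: "[p] \<in> ALSW \<longleftrightarrow> LS_prime p"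
  using primes.lyn_letter[of p] LS_prime_valid by (auto simp: ALSW_iff)

lemma ALSW_total: "u \<in> ALSW \<Longrightarrow> v \<in> ALSW \<Longrightarrow> u \<noteq> v \<Longrightarrow> dl_less u v \<or> dl_less v u"
  using ALSW_valid by (intro dl_less_total) auto

abbreviation prime_brk :: "'x::wellorder oword \<Rightarrow> 'x oprime brk" where
  "prime_brk \<equiv> shirshov_bracketing prime_greater"

lemma assoc_naword_of_brk: "assoc (naword_of_brk T) = concat (map assoc (frontier T))"
  by (induction T) auto

lemma naword_alphabet:
  assumes "\<And>p. p \<in> A \<Longrightarrow> assoc (prime_bracketing p) = [p]" "A \<subseteq> Collect valid_prime"
  shows "alphabet naword_greater (prime_bracketing ` A)"
proof
  show "naword_greater s t \<or> naword_greater t s"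
    if st: "s \<in> prime_bracketing ` A" "t \<in> prime_bracketing ` A" "s \<noteq> t" for s t
  proof -
    obtain p q where "s = prime_bracketing p" "t = prime_bracketing q" "p \<in> A" "q \<in> A" "p \<noteq> q"
      using st by auto
    then show ?thesis
      using assms prime_less_total[of p q] by (auto simp: naword_greater_def dl_less_single)
  qed
qed (use dl_less_irrefl dl_less_trans in \<open>unfold naword_greater_def, blast\<close>)+

text \<open>On the letters \<open>[p]\<close> the order through associative words is the order of
  the primes \<open>p\<close>, and \<open>assoc\<close> makes the relabelling injective. The
  hypothesis on \<open>assoc\<close> is local to the primes of \<open>w\<close> so that the lemma
  can be applied inside the induction proving that hypothesis.\<close>

lemma shirshov_bracketing_naword:
  assumes "primes.lyn w" "\<And>p. p \<in> set w \<Longrightarrow> assoc (prime_bracketing p) = [p]"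
  shows "shirshov_bracketing naword_greater (map prime_bracketing w) =
    map_brk prime_bracketing (prime_brk w)"
proof -
  interpret nw: alphabet naword_greater "prime_bracketing ` set w"
    using assms primes.lyn_set by (intro naword_alphabet) auto
  have fr: "frontier (prime_brk w) = w" by (rule primes.shirshov_bracketing(2)[OF assms(1)])
  have "is_NLSW naword_greater (map_brk prime_bracketing (prime_brk w))"
  proof (rule is_NLSW_map_brk[where gt = prime_greater])
    show "is_NLSW prime_greater (prime_brk w)"
      by (rule primes.shirshov_bracketing(1)[OF assms(1)])
    show "inj_on prime_bracketing (set (frontier (prime_brk w)))"
      unfolding fr by (rule inj_onI) (metis assms(2) list.inject)
  qed (use fr assms in \<open>auto simp: naword_greater_def dl_less_single\<close>)
  then show ?thesis
    using fr by (intro nw.shirshov_bracketing_eqI) auto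
qed

lemma concat_map_singleton: "(\<And>p. p \<in> set w \<Longrightarrow> f p = [p]) \<Longrightarrow> concat (map f w) = w"
  by (induction w) auto

lemma assoc_prime_bracketing: "LS_prime p \<Longrightarrow> assoc (prime_bracketing p) = [p]"
proof (induction p)
  case (Op w)
  then have w: "primes.lyn w" "\<And>p. p \<in> set w \<Longrightarrow> assoc (prime_bracketing p) = [p]"
    by (auto simp: ALSW_iff)
  have "concat (map (\<lambda>p. assoc (prime_bracketing p)) w) = w"
    using w(2) by (rule concat_map_singleton)
  then show ?case
    using shirshov_bracketing_naword[OF w] primes.shirshov_bracketing(2)[OF w(1)]
    by (simp add: assoc_naword_of_brk comp_def)
qed simp

lemma bracketing_eq: "w \<in> ALSW \<Longrightarrow> bracketing w = naword_of_brk (map_brk prime_bracketing (prime_brk w))"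
  unfolding bracketing_def
  by (subst shirshov_bracketing_naword) (auto simp: ALSW_iff assoc_prime_bracketing)

lemma prime_bracketing_Op [simp]: "prime_bracketing (Op u) = NOp (bracketing u)"
  by (simp add: bracketing_def)

declare prime_bracketing.simps(2) [simp del]

lemma bracketing_single: "LS_prime p \<Longrightarrow> bracketing [p] = prime_bracketing p"
  using primes.shirshov_bracketing_letter[of p] LS_prime_valid[of p] bracketing_eq[of "[p]"]
  by (simp add: ALSW_single)

lemma assoc_bracketing: "w \<in> ALSW \<Longrightarrow> assoc (bracketing w) = w"
proof -
  assume w: "w \<in> ALSW"
  have "concat (map (\<lambda>p. assoc (prime_bracketing p)) w) = w"
    using w assoc_prime_bracketing by (intro concat_map_singleton) (auto simp: ALSW_iff)
  then show ?thesis
    using bracketing_eq[OF w] primes.shirshov_bracketing(2)[OF ALSW_lyn[OF w]]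
    by (simp add: assoc_naword_of_brk comp_def)
qed

section \<open>Lie algebras with an operator\<close>

primrec na_eval :: "('l \<Rightarrow> 'l \<Rightarrow> 'l) \<Rightarrow> ('l \<Rightarrow> 'l) \<Rightarrow> ('y \<Rightarrow> 'l) \<Rightarrow> 'y naword \<Rightarrow> 'l" where
  "na_eval br P \<sigma> (NLtr y) = \<sigma> y"
| "na_eval br P \<sigma> (NOp t) = P (na_eval br P \<sigma> t)"
| "na_eval br P \<sigma> (NBr s t) = br (na_eval br P \<sigma> s) (na_eval br P \<sigma> t)"

lemma eval_na_eq: "eval_na \<sigma> t = na_eval comm opP \<sigma> t"
  by (induction t) auto

lemma na_eval_naword_of_brk:
  "na_eval br P \<sigma> (naword_of_brk (map_brk f T)) = brk_eval br (\<lambda>p. na_eval br P \<sigma> (f p)) T"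
  by (induction T) auto

locale op_lie_algebra = lie_algebra scale br
  for scale :: "'k::field \<Rightarrow> 'l::ab_group_add \<Rightarrow> 'l" and br :: "'l \<Rightarrow> 'l \<Rightarrow> 'l" +
  fixes P :: "'l \<Rightarrow> 'l"
  assumes P_linear: "Vector_Spaces.linear scale scale P"
begin

definition LS_val :: "('x::wellorder \<Rightarrow> 'l) \<Rightarrow> 'x oword \<Rightarrow> 'l" where
  "LS_val \<sigma> u = na_eval br P \<sigma> (bracketing u)"

lemma LS_val_eq: "w \<in> ALSW \<Longrightarrow>
    LS_val \<sigma> w = shirshov_eval prime_greater br (\<lambda>p. na_eval br P \<sigma> (prime_bracketing p)) w"
  by (simp add: LS_val_def bracketing_eq na_eval_naword_of_brk)

lemma LS_val_Ltr: "LS_val \<sigma> [Ltr x] = \<sigma> x"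
  by (simp add: LS_val_def bracketing_single)

lemma LS_val_Op: "u \<in> ALSW \<Longrightarrow> LS_val \<sigma> [Op u] = P (LS_val \<sigma> u)"
  by (simp add: LS_val_def bracketing_single)

text \<open>Rewriting a bracket preserves the multiset of primes, so the Lyndon words that arise
  consist of Lyndon-Shirshov primes at every depth and belong to \<open>ALSW\<close>.\<close>

lemma br_LS_val_span:
  assumes x: "x \<in> span (LS_val \<sigma> ` ALSW)" and y: "y \<in> span (LS_val \<sigma> ` ALSW)"
  shows "br x y \<in> span (LS_val \<sigma> ` ALSW)"
proof (rule br_in_span[OF x y])
  fix a b assume "a \<in> LS_val \<sigma> ` ALSW" "b \<in> LS_val \<sigma> ` ALSW"
  then obtain u v where uv: "a = LS_val \<sigma> u" "b = LS_val \<sigma> v" "u \<in> ALSW" "v \<in> ALSW" by blast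
  let ?e = "\<lambda>p. na_eval br P \<sigma> (prime_bracketing p)"
  have "{w. primes.lyn w \<and> mset w = mset (u @ v)} \<subseteq> ALSW"
  proof clarify
    fix w assume w: "primes.lyn w" "mset w = mset (u @ v)"
    have "set w = set u \<union> set v" using arg_cong[OF w(2), of set_mset] by simp
    then show "w \<in> ALSW" using w(1) uv(3,4) by (auto simp: ALSW_iff)
  qed
  then have "shirshov_eval prime_greater br ?e ` {w. primes.lyn w \<and> mset w = mset (u @ v)}
      \<subseteq> LS_val \<sigma> ` ALSW"
    by (auto simp: LS_val_eq)
  then have "span (shirshov_eval prime_greater br ?e ` {w. primes.lyn w \<and> mset w = mset (u @ v)})
      \<subseteq> span (LS_val \<sigma> ` ALSW)"
    by (rule span_mono)
  moreover have "br a b \<in>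
      span (shirshov_eval prime_greater br ?e ` {w. primes.lyn w \<and> mset w = mset (u @ v)})"
    using primes.shirshov_eval_br_in_span[OF lie_algebra_axioms ALSW_lyn ALSW_lyn, OF uv(3,4)] uv
    by (simp add: LS_val_eq)
  ultimately show "br a b \<in> span (LS_val \<sigma> ` ALSW)" by blast
qed

lemma P_LS_val_span:
  assumes "x \<in> span (LS_val \<sigma> ` ALSW)"
  shows "P x \<in> span (LS_val \<sigma> ` ALSW)"
  using assms
proof (induction rule: span_induct_alt)
  case base
  then show ?case
    by (simp add: linear_zero[OF P_linear] span_zero)
next
  case (step c x y)
  then have "P x \<in> span (LS_val \<sigma> ` ALSW)"
    by (auto simp: ALSW_single intro!: span_base image_eqI[of _ _ "[Op _]"] LS_val_Op[symmetric])
  then show ?case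
    using step by (auto simp: linear_add[OF P_linear] linear_scale[OF P_linear] intro!: span_add span_scale)
qed

end

section \<open>Leading words\<close>

abbreviation (input) "coeff \<equiv> Poly_Mapping.lookup"
abbreviation (input) "supp \<equiv> Poly_Mapping.keys"
abbreviation (input) "mon \<equiv> Poly_Mapping.single"

definition keys_below :: "('x::wellorder, 'k::field) opoly \<Rightarrow> 'x oword \<Rightarrow> bool" where
  "keys_below f w \<longleftrightarrow> (\<forall>v\<in>supp f. dl_less v w)"

text \<open>Monic with leading word \<open>w\<close>, stated without the description operator in
  \<open>lead\<close>. This form passes through products, commutators and \<open>opP\<close>;
  \<open>lead_eq\<close> translates it back.\<close>

definition has_lead :: "('x::wellorder, 'k::field) opoly \<Rightarrow> 'x oword \<Rightarrow> bool" where
  "has_lead f w \<longleftrightarrow> keys_below (f - mon w 1) w"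

lemma keys_below_add: "keys_below f w \<Longrightarrow> keys_below g w \<Longrightarrow> keys_below (f + g) w"
  using Poly_Mapping.keys_add[of f g] unfolding keys_below_def by blast

lemma keys_below_diff: "keys_below f w \<Longrightarrow> keys_below g w \<Longrightarrow> keys_below (f - g) w"
  unfolding keys_below_def by (metis in_keys_iff lookup_minus diff_zero eq_iff_diff_eq_0)

lemma keys_below_zero [simp]: "keys_below 0 w"
  by (simp add: keys_below_def)

lemma keys_scal: "supp (scal c f) \<subseteq> supp f"
  by (auto simp: in_keys_iff lookup_scal)

lemma keys_mult_list: "supp (f * g) \<subseteq> {u @ v | u v. u \<in> supp f \<and> v \<in> supp g}"
  for f g :: "'p list \<Rightarrow>\<^sub>0 'k::field"
  using Poly_Mapping.keys_mult[of f g] by (simp add: plus_list_def)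

lemma has_lead_key:
  assumes "has_lead f w" "v \<in> supp f"
  shows "v = w \<or> dl_less v w"
proof (cases "v = w")
  case False
  then have "v \<in> supp (f - mon w 1)"
    using assms(2) by (simp add: in_keys_iff lookup_minus lookup_single)
  then show ?thesis
    using assms(1) by (auto simp: has_lead_def keys_below_def)
qed simp

lemma has_lead_lookup: "has_lead f w \<Longrightarrow> coeff f w = 1"
  using dl_less_irrefl[of w]
  by (auto simp: has_lead_def keys_below_def in_keys_iff lookup_minus)

lemma lead_eq:
  assumes "has_lead f w"
  shows "lead f = w" "monic f"
proof -
  have w: "w \<in> supp f" using has_lead_lookup[OF assms] by (simp add: in_keys_iff)
  show lead: "lead f = w" unfolding lead_def
  proof (rule the_equality)
    show "w \<in> supp f \<and> (\<forall>v\<in>supp f. v \<noteq> w \<longrightarrow> dl_less v w)" using w has_lead_key[OF assms] by blast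
    show "v = w" if "v \<in> supp f \<and> (\<forall>u\<in>supp f. u \<noteq> v \<longrightarrow> dl_less u v)" for v
    proof (rule ccontr)
      assume "v \<noteq> w"
      then have "dl_less w v" "dl_less v w" using that w has_lead_key[OF assms, of v] by auto
      then show False
        using dl_less_asym[of v w] by simp
    qed
  qed
  show "monic f" using w has_lead_lookup[OF assms] lead by (auto simp: monic_def)
qed

lemma has_lead_diff: "has_lead f w \<Longrightarrow> has_lead g w \<Longrightarrow> keys_below (f - g) w"
  unfolding has_lead_def
  using keys_below_diff[of "f - mon w 1" w "g - mon w 1"] by simp

lemma has_lead_add_below: "has_lead f w \<Longrightarrow> keys_below g w \<Longrightarrow> has_lead (f + g) w"
  unfolding has_lead_def using keys_below_add[of "f - mon w 1" w g]
  by (simp add: algebra_simps)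

lemma has_lead_mult:
  assumes f: "has_lead f u" and g: "has_lead g v"
  shows "has_lead (f * g) (u @ v)"
proof -
  let ?u = "mon u 1" and ?v = "mon v 1"
  have "f * g - mon (u @ v) 1 = (f - ?u) * g + ?u * (g - ?v)"
    by (simp add: algebra_simps mult_single plus_list_def)
  moreover have "keys_below ((f - ?u) * g) (u @ v)"
  proof -
    have "dl_less (a @ b) (u @ v)" if "a \<in> supp (f - ?u)" "b \<in> supp g" for a b
      using that f has_lead_key[OF g, of b] dl_less_append_left[of b v a] dl_less_append_right[of a u v]
        dl_less_trans by (auto simp: has_lead_def keys_below_def)
    then show ?thesis
      using keys_mult_list[of "f - ?u" g] unfolding keys_below_def by blast
  qed
  moreover have "keys_below (?u * (g - ?v)) (u @ v)"
    using keys_mult_list[of ?u "g - ?v"] g dl_less_append_left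
    by (fastforce simp: has_lead_def keys_below_def)
  ultimately show ?thesis
    by (simp add: has_lead_def keys_below_add)
qed

lemma has_lead_keys_below: "has_lead f u \<Longrightarrow> dl_less u v \<Longrightarrow> keys_below f v"
  unfolding keys_below_def by (metis has_lead_key dl_less_trans)

lemma has_lead_comm:
  assumes "has_lead f u" "has_lead g v" "dl_less (v @ u) (u @ v)"
  shows "has_lead (comm f g) (u @ v)"
  using has_lead_mult[OF assms(1,2)] has_lead_keys_below[OF has_lead_mult[OF assms(2,1)] assms(3)]
    keys_below_diff[of "f * g - mon (u @ v) 1" "u @ v" "g * f"]
  unfolding has_lead_def comm_def by (simp add: algebra_simps)

lemma opP_single: "opP (mon w c) = mon [Op w] c"
  by (simp add: opP_def)

lemma keys_opP: "supp (opP f) \<subseteq> (\<lambda>w. [Op w]) ` supp f"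
  unfolding opP_def by (rule subset_trans[OF Poly_Mapping.keys_sum]) auto

lemma has_lead_opP:
  assumes "has_lead f w"
  shows "has_lead (opP f) [Op w]"
proof -
  have "opP f - mon [Op w] 1 = opP (f - mon w 1)" by (simp add: opP_diff opP_single)
  then show ?thesis
    using assms keys_opP[of "f - mon w 1"] dl_less_Op
    by (fastforce simp: has_lead_def keys_below_def)
qed

lemma has_lead_gen: "has_lead (gen x) [Ltr x]"
  by (simp add: has_lead_def gen_def)

text \<open>At every bracket the product in the written order exceeds the reversed product, which is
  the condition of \<open>has_lead_comm\<close>: evaluation keeps the underlying word as leading
  word.\<close>

primrec good_naword :: "'x::wellorder naword \<Rightarrow> bool" where
  "good_naword (NLtr x) \<longleftrightarrow> True"
| "good_naword (NOp t) \<longleftrightarrow> good_naword t"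
| "good_naword (NBr s t) \<longleftrightarrow> good_naword s \<and> good_naword t \<and> dl_less (assoc t @ assoc s) (assoc s @ assoc t)"

text \<open>The letters may be evaluated to arbitrary polynomials as long as their leading words are
  those of the bracketed words \<open>\<tau> y\<close>. For special normal words the star gets an
  iterated commutator, compared with \<open>[vc]\<close>.\<close>

lemma eval_na_has_lead:
  assumes "\<And>y. has_lead (\<sigma> y) (assoc (\<tau> y))" "good_naword (nsubst \<tau> t)"
  shows "has_lead (eval_na \<sigma> t) (assoc (nsubst \<tau> t))"
  using assms(2) by (induction t) (simp_all add: assms(1) has_lead_opP has_lead_comm)

lemma nsubst_NLtr: "nsubst NLtr t = t"
  by (induction t) auto

lemma lyn_dl_less_rotate:
  assumes "primes.lyn (u @ v)" "u \<noteq> []" "v \<noteq> []"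
  shows "dl_less (v @ u) (u @ v)"
  using primes.lyn_rotate[OF assms] by (rule dl_less_of_lex_greater) (simp add: union_commute)

lemma good_naword_of_brk:
  assumes "is_NLSW prime_greater T" "\<And>p. p \<in> set (frontier T) \<Longrightarrow> LS_prime p \<and> good_naword (prime_bracketing p)"
  shows "good_naword (naword_of_brk (map_brk prime_bracketing T))"
  using assms
proof (induction T)
  case (Leaf p)
  then show ?case by simp
next
  case (Node S T)
  have a: "assoc (naword_of_brk (map_brk prime_bracketing R)) = frontier R"
    if "set (frontier R) \<subseteq> set (frontier (Node S T))" for R
  proof -
    have "concat (map (\<lambda>p. assoc (prime_bracketing p)) (frontier R)) = frontier R"
      using that Node.prems(2) assoc_prime_bracketing by (intro concat_map_singleton) blast
    then show ?thesis
      by (simp add: assoc_naword_of_brk comp_def)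
  qed
  have "set (frontier (Node S T)) \<subseteq> Collect valid_prime"
    using Node.prems(2) LS_prime_valid by blast
  then have "primes.lyn (frontier S @ frontier T)"
    using primes.is_NLSW_lyn[OF Node.prems(1)] by simp
  then have "dl_less (frontier T @ frontier S) (frontier S @ frontier T)"
    by (rule lyn_dl_less_rotate) (simp_all add: primes.frontier_nonempty)
  then show ?case
    using Node a[of S] a[of T] by simp
qed

lemma good_prime_bracketing: "LS_prime p \<Longrightarrow> good_naword (prime_bracketing p)"
proof (induction p)
  case (Op w)
  then have w: "w \<in> ALSW" "primes.lyn w" by (auto simp: ALSW_iff)
  then show ?case
    using Op primes.shirshov_bracketing[OF w(2)] unfolding prime_bracketing_Op bracketing_eq[OF w(1)]
    by (auto simp: ALSW_iff intro!: good_naword_of_brk)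
qed simp

lemma good_bracketing:
  assumes "w \<in> ALSW"
  shows "good_naword (bracketing w)"
proof -
  have "LS_prime p" if "p \<in> set w" for p
    using that assms by (simp add: ALSW_iff)
  then show ?thesis
    using primes.shirshov_bracketing[OF ALSW_lyn[OF assms]] good_prime_bracketing
    unfolding bracketing_eq[OF assms] by (intro good_naword_of_brk) auto
qed

lemma LS_has_lead:
  assumes "u \<in> ALSW"
  shows "has_lead (LS u) u"
  using eval_na_has_lead[of gen NLtr "bracketing u"] assms
  by (simp add: nsubst_NLtr good_bracketing assoc_bracketing LS_def has_lead_gen)

section \<open>Special normal words\<close>

lemma LS_factors:
  assumes "\<And>p. p \<in> set c \<Longrightarrow> LS_prime p"
  shows "concat (LS_factors c) = c" "set (LS_factors c) \<subseteq> ALSW"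
    "successively (lex_le prime_greater) (LS_factors c)"
proof -
  let ?P = "\<lambda>cs. concat cs = c \<and> set cs \<subseteq> ALSW \<and> successively (lex_le prime_greater) cs"
  have "\<exists>!cs. ?P cs"
  proof (rule ex_ex1I)
    have "set c \<subseteq> Collect valid_prime" using assms LS_prime_valid by blast
    then obtain cs where cs: "concat cs = c" "\<forall>d\<in>set cs. primes.lyn d" "successively (lex_le prime_greater) cs"
      using primes.ex_lyn_factorization by blast
    have "d \<in> ALSW" if d: "d \<in> set cs" for d
    proof -
      have "set d \<subseteq> set c" using cs(1) d by auto
      then show ?thesis
        using cs(2) d assms by (auto simp: ALSW_iff)
    qed
    then show "\<exists>cs. ?P cs" using cs by blast
  next
    show "cs = ds" if "?P cs" "?P ds" for cs ds
      using that ALSW_lyn by (intro primes.lyn_factorization_unique) auto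
  qed
  then have "?P (LS_factors c)" unfolding LS_factors_def by (rule theI')
  then show "concat (LS_factors c) = c" "set (LS_factors c) \<subseteq> ALSW"
    "successively (lex_le prime_greater) (LS_factors c)"
    by auto
qed

text \<open>Every partial product is Lyndon by \<open>lyn_factorization_lyn\<close>, so each
  commutator keeps the product in the written order on top. The list \<open>ds\<close> holds the
  factors not yet reached, since the hypotheses concern the whole word.\<close>

lemma foldl_comm_has_lead:
  assumes f: "has_lead f v" and v: "primes.lyn v" "primes.lyn (v @ concat (cs @ ds))"
    and cs: "set (cs @ ds) \<subseteq> ALSW" "successively (lex_le prime_greater) (cs @ ds)"
  shows "has_lead (foldl (\<lambda>h d. comm h (LS d)) f cs) (v @ concat cs)"
  using v(2) cs
proof (induction cs arbitrary: ds rule: rev_induct)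
  case (snoc c cs)
  have eq: "(cs @ [c]) @ ds = cs @ c # ds" by simp
  note prems = snoc.prems[unfolded eq]
  have IH: "has_lead (foldl (\<lambda>h d. comm h (LS d)) f cs) (v @ concat cs)"
    using snoc.IH[OF prems] .
  have c: "c \<in> ALSW" using prems(2) by simp
  have "primes.lyn (v @ concat (cs @ [c]))"
    using primes.lyn_factorization_lyn[OF v(1), of "cs @ [c]" ds] snoc.prems ALSW_lyn by blast
  then have "dl_less (c @ v @ concat cs) ((v @ concat cs) @ c)"
    using lyn_dl_less_rotate[of "v @ concat cs" c] primes.lyn_nonempty[OF v(1)] ALSW_nonempty[OF c] by simp
  then show ?case
    using has_lead_comm[OF IH LS_has_lead[OF c]] by simp
qed (use f in simp)

lemma sum_list_pstars_zero:
  "sum_list (map pstars w) = 0 \<longleftrightarrow> (\<forall>p\<in>set w. pstars p = 0)"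
  by (induction w) auto

lemma pstars_zero: "pstars p = 0 \<Longrightarrow> \<exists>q. p = map_oprime Some q"
proof (induction p)
  case (Ltr y)
  then show ?case
    by (intro exI[of _ "Ltr (the y)"]) (auto split: if_splits)
next
  case (Op w)
  then have "w \<in> lists (range (map_oprime Some))"
    by (auto simp: sum_list_pstars_zero in_lists_conv_set)
  then obtain w' where "w = map (map_oprime Some) w'" unfolding lists_image by blast
  then show ?case
    by (metis oprime.simps(10))
qed

lemma pstars_map_Some [simp]: "pstars (map_oprime Some p) = 0"
proof (induction p)
  case (Op w)
  then show ?case
    by (simp add: sum_list_pstars_zero)
qed simp

lemma valid_prime_map [simp]: "valid_prime (map_oprime f p) \<longleftrightarrow> valid_prime p"
  by (induction p) auto

lemma psubst_map_oprime: "(\<And>x. \<sigma> (f x) = [Ltr (g x)]) \<Longrightarrow> psubst \<sigma> (map_oprime f p) = [map_oprime g p]"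
proof (induction p)
  case (Op w)
  then have "concat (map (\<lambda>p. psubst \<sigma> (map_oprime f p)) w) = map (map_oprime g) w"
    by (induction w) auto
  then show ?case
    by (simp add: comp_def)
qed simp

lemma osubst_append [simp]: "osubst \<sigma> (u @ v) = osubst \<sigma> u @ osubst \<sigma> v"
  and osubst_Cons: "osubst \<sigma> (p # v) = psubst \<sigma> p @ osubst \<sigma> v"
  and psubst_Op: "psubst \<sigma> (Op w) = [Op (osubst \<sigma> w)]"
  by (simp_all add: osubst_def)

lemma osubst_emb: "(\<And>x. \<sigma> (Some x) = [Ltr (g x)]) \<Longrightarrow> osubst \<sigma> (emb w) = map (map_oprime g) w"
  unfolding emb_def osubst_def by (induction w) (simp_all add: psubst_map_oprime)

lemma plug_emb:
  "plug (emb a @ star # emb b) v = a @ v @ b"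
  "plug (emb a @ Op \<pi> # emb b) v = a @ Op (plug \<pi> v) # b"
proof -
  have *: "osubst (case_option v (\<lambda>x. [Ltr x])) (emb w) = w" for w
    using osubst_emb[of "case_option v (\<lambda>x. [Ltr x])" id w]
    by (simp add: oprime.map_id0)
  show "plug (emb a @ star # emb b) v = a @ v @ b"
    "plug (emb a @ Op \<pi> # emb b) v = a @ Op (plug \<pi> v) # b"
    by (simp_all add: plug_def osubst_Cons psubst_Op * star_def del: psubst.simps(2))
qed

lemma plug_star_emb:
  "plug_star (emb a @ star # emb b) \<rho> = emb a @ \<rho> @ emb b"
  "plug_star (emb a @ Op \<pi> # emb b) \<rho> = emb a @ Op (plug_star \<pi> \<rho>) # emb b"
proof -
  have *: "osubst (case_option \<rho> (\<lambda>x. [Ltr (Some x)])) (emb w) = emb w" for w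
    using osubst_emb[of "case_option \<rho> (\<lambda>x. [Ltr (Some x)])" Some w] by (simp add: emb_def)
  show "plug_star (emb a @ star # emb b) \<rho> = emb a @ \<rho> @ emb b"
    "plug_star (emb a @ Op \<pi> # emb b) \<rho> = emb a @ Op (plug_star \<pi> \<rho>) # emb b"
    by (simp_all add: plug_star_def osubst_Cons psubst_Op * star_def del: psubst.simps(2))
qed

lemma emb_append [simp]: "emb (u @ v) = emb u @ emb v" and emb_Nil [simp]: "emb [] = []"
  by (simp_all add: emb_def)

lemma ball_emb [simp]: "(\<forall>p\<in>set (emb a). valid_prime p) \<longleftrightarrow> (\<forall>p\<in>set a. valid_prime p)"
  by (simp add: emb_def)

lemma sum_pstars_emb [simp]: "sum_list (map pstars (emb w)) = 0"
  by (simp add: emb_def sum_list_pstars_zero)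

lemma star_words_iff:
  "emb a @ star # emb b \<in> star_words \<longleftrightarrow> (\<forall>p\<in>set a \<union> set b. valid_prime p)"
  "emb a @ Op \<pi> # emb b \<in> star_words \<longleftrightarrow> \<pi> \<in> star_words \<and> (\<forall>p\<in>set a \<union> set b. valid_prime p)"
  by (auto simp: star_words_def owords_iff star_def ball_Un)

lemma star_words_cases:
  assumes "\<pi> \<in> star_words"
  obtains a b where "\<pi> = emb a @ star # emb b" "\<forall>p\<in>set a \<union> set b. valid_prime p"
  | a b \<rho> where "\<pi> = emb a @ Op \<rho> # emb b" "\<rho> \<in> star_words" "\<forall>p\<in>set a \<union> set b. valid_prime p"
proof -
  have emb: "\<exists>a. w = emb a" if "\<forall>p\<in>set w. pstars p = 0" for w :: "'a option oword"
  proof -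
    have "w \<in> lists (range (map_oprime Some))"
      using that pstars_zero unfolding in_lists_conv_set by blast
    then show ?thesis
      unfolding lists_image emb_def by blast
  qed
  have s: "sum_list (map pstars \<pi>) = 1" using assms by (simp add: star_words_def)
  then obtain q where "q \<in> set \<pi>" "pstars q \<noteq> 0" using sum_list_pstars_zero[of \<pi>] by auto
  then obtain u v where uv: "\<pi> = u @ q # v" by (meson split_list)
  have "sum_list (map pstars u) + pstars q + sum_list (map pstars v) = 1"
    using s unfolding uv by simp
  then have q: "pstars q = 1" and "sum_list (map pstars u) = 0" "sum_list (map pstars v) = 0"
    using \<open>pstars q \<noteq> 0\<close> by linarith+
  then obtain a b where ab: "u = emb a" "v = emb b" using emb sum_list_pstars_zero by metis
  show thesis
  proof (cases q)
    case (Ltr y)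
    then have "q = star" using q by (auto simp: star_def split: if_splits)
    then show thesis
      using that(1)[of a b] assms uv ab star_words_iff(1)[of a b] by blast
  next
    case (Op \<rho>)
    then show thesis
      using that(2)[of a \<rho> b] assms uv ab star_words_iff(2)[of a \<rho> b] by blast
  qed
qed

lemma assoc_map_naword: "assoc (map_naword f t) = map (map_oprime f) (assoc t)"
  by (induction t) auto

lemma nsubst_map_Some [simp]: "nsubst (case_option n NLtr) (map_naword Some t) = t"
  by (induction t) auto

abbreviation hole_naword :: "'x option naword \<Rightarrow> 'x::wellorder oprime option brk \<Rightarrow> 'x option naword" where
  "hole_naword N D \<equiv> naword_of_brk (map_brk (case_option N (\<lambda>p. map_naword Some (prime_bracketing p))) D)"

lemma nsubst_hole_naword:
  assumes "nsubst (case_option n NLtr) N = naword_of_brk (map_brk prime_bracketing S)"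
  shows "nsubst (case_option n NLtr) (hole_naword N D) =
    naword_of_brk (map_brk prime_bracketing (plug_brk S D))"
  using assms by (induction D) (auto split: option.splits)

lemma assoc_hole_naword:
  assumes "frontier D = map Some a @ [None] @ map Some b" "\<And>p. p \<in> set a \<union> set b \<Longrightarrow> LS_prime p"
  shows "assoc (hole_naword N D) = emb a @ assoc N @ emb b"
proof -
  have "concat (map (\<lambda>p. assoc (map_naword Some (prime_bracketing p))) w) = emb w"
    if "\<And>p. p \<in> set w \<Longrightarrow> LS_prime p" for w :: "'a oword"
    using that by (induction w) (auto simp: assoc_map_naword assoc_prime_bracketing emb_def)
  then show ?thesis
    using assms(2) by (simp add: assoc_naword_of_brk assms(1) comp_def)
qed

text \<open>This makes \<open>chosen_split\<close> a valid choice. When the star stands at the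
  outermost level, Shirshov's subword lemma provides the node \<open>[vc]\<close>. When it lies
  inside a prime \<open>Op \<rho>\<close>, that prime is one leaf of the bracketing, and a split for
  \<open>\<rho>\<close> is inserted there.\<close>

lemma ex_bracket_split:
  assumes "\<pi> \<in> star_words" "v \<in> ALSW" "plug \<pi> v \<in> ALSW"
  shows "\<exists>C c. bracket_split \<pi> v (C, c)"
  using assms(1,3)
proof (induction "odeg \<pi>" arbitrary: \<pi> rule: less_induct)
  case less
  let ?w = "plug \<pi> v"
  have T: "is_NLSW prime_greater (prime_brk ?w)" "frontier (prime_brk ?w) = ?w"
    using primes.shirshov_bracketing ALSW_lyn less.prems(2) by auto
  from less.prems(1) show ?case
  proof (cases rule: star_words_cases)
    case (1 a b)
    then have w: "?w = a @ v @ b" by (simp add: plug_emb)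
    then have LS: "\<And>p. p \<in> set a \<union> set v \<union> set b \<Longrightarrow> LS_prime p"
      using less.prems(2) by (auto simp: ALSW_iff)
    obtain D S c r where D: "b = c @ r" "is_NLSW prime_greater S" "frontier S = v @ c"
        "prime_brk ?w = plug_brk S D" "frontier D = map Some a @ [None] @ map Some r"
    proof -
      have "set (frontier (prime_brk ?w)) \<subseteq> Collect valid_prime" "frontier (prime_brk ?w) = a @ v @ b"
        using ALSW_valid[OF less.prems(2)] w T(2) by auto
      from primes.NLSW_subword[OF T(1) this(1) ALSW_lyn[OF assms(2)] this(2)] that show thesis
        by blast
    qed
    have "primes.lyn (v @ c)" using primes.is_NLSW_lyn[OF D(2)] D(1,3) LS LS_prime_valid by auto
    then have vc: "v @ c \<in> ALSW" using LS D(1) by (auto simp: ALSW_iff)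
    have S: "prime_brk (v @ c) = S"
      using primes.shirshov_bracketing_eqI[OF D(2,3)] primes.lyn_set[OF ALSW_lyn[OF vc]] by blast
    have assoc: "assoc (hole_naword (NLtr None) D) = emb a @ star # emb r"
    proof -
      have "LS_prime p" if "p \<in> set a \<union> set r" for p
        using that LS D(1) by auto
      from assoc_hole_naword[OF D(5) this] show ?thesis
        by (simp add: star_def)
    qed
    have "bracket_split \<pi> v (hole_naword (NLtr None) D, c)"
      unfolding bracket_split_def prod.case
    proof (intro conjI)
      show "assoc (hole_naword (NLtr None) D) \<in> star_words"
        using assoc star_words_iff(1)[of a r] LS LS_prime_valid D(1) by auto
      show "c = [] \<or> c \<in> owords" using LS LS_prime_valid D(1) by (auto simp: owords_iff)
      show "plug_star (assoc (hole_naword (NLtr None) D)) (star # emb c) = \<pi>"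
        unfolding assoc plug_star_emb using 1 D(1) by simp
      show "nsubst (case_option (bracketing (v @ c)) NLtr) (hole_naword (NLtr None) D) = bracketing ?w"
        using nsubst_hole_naword[of "bracketing (v @ c)" "NLtr None" S D]
        by (simp add: bracketing_eq[OF vc] bracketing_eq[OF less.prems(2)] S D(4))
    qed (rule vc)
    then show ?thesis by blast
  next
    case (2 a b \<rho>)
    then have w: "?w = a @ Op (plug \<rho> v) # b" by (simp add: plug_emb)
    then have LS: "\<And>p. p \<in> set a \<union> set b \<Longrightarrow> LS_prime p" and p: "plug \<rho> v \<in> ALSW"
      using less.prems(2) by (auto simp: ALSW_iff)
    have "odeg \<rho> < odeg \<pi>" using 2 by simp
    then obtain C c where C: "bracket_split \<rho> v (C, c)" using less.hyps 2 p by blast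
    obtain D where D: "prime_brk ?w = plug_brk (Leaf (Op (plug \<rho> v))) D"
        "frontier D = map Some a @ [None] @ map Some b"
      using ex_plug_leaf[of "prime_brk ?w" a "Op (plug \<rho> v)" b] T(2) w by auto
    have assoc: "assoc (hole_naword (NOp C) D) = emb a @ Op (assoc C) # emb b"
      using assoc_hole_naword[OF D(2)] LS by auto
    have "bracket_split \<pi> v (hole_naword (NOp C) D, c)" unfolding bracket_split_def prod.case
    proof (intro conjI)
      show "assoc (hole_naword (NOp C) D) \<in> star_words"
        using assoc star_words_iff(2)[of a "assoc C" b] 2 C by (auto simp: bracket_split_def)
      show "c = [] \<or> c \<in> owords" "v @ c \<in> ALSW" using C by (auto simp: bracket_split_def)
      show "plug_star (assoc (hole_naword (NOp C) D)) (star # emb c) = \<pi>"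
        unfolding assoc plug_star_emb using 2 C by (simp add: bracket_split_def)
      show "nsubst (case_option (bracketing (v @ c)) NLtr) (hole_naword (NOp C) D) = bracketing ?w"
        using nsubst_hole_naword[of "bracketing (v @ c)" "NOp C" "Leaf (Op (plug \<rho> v))" D] C
        by (simp add: bracket_split_def bracketing_eq[OF less.prems(2)] D(1))
    qed
    then show ?thesis by blast
  qed
qed

text \<open>Only the validity of the split is used, so the result is independent of which one was
  chosen. The iterated commutator replacing \<open>[vc]\<close> has the same leading word
  \<open>v @ c\<close>, and the bracketing around it is unchanged.\<close>

lemma special_word_has_lead:
  assumes f: "has_lead f v" and v: "v \<in> ALSW" and \<pi>: "\<pi> \<in> star_words" "plug \<pi> v \<in> ALSW"
  shows "has_lead (special_word \<pi> f) (plug \<pi> v)"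
proof -
  obtain C c where split: "chosen_split \<pi> v = (C, c)" by fastforce
  have "bracket_split \<pi> v (C, c)"
    using ex_bracket_split[OF \<pi>(1) v \<pi>(2)] someI[of "bracket_split \<pi> v"] split
    unfolding chosen_split_def by metis
  then have vc: "v @ c \<in> ALSW"
    and ns: "nsubst (case_option (bracketing (v @ c)) NLtr) C = bracketing (plug \<pi> v)"
    by (auto simp: bracket_split_def)
  let ?g = "foldl (\<lambda>h d. comm h (LS d)) f (LS_factors c)"
  have c: "concat (LS_factors c) = c" "set (LS_factors c) \<subseteq> ALSW"
    "successively (lex_le prime_greater) (LS_factors c)"
    using LS_factors[of c] vc by (auto simp: ALSW_iff)
  then have "has_lead ?g (v @ c)"
    using foldl_comm_has_lead[OF f, of "LS_factors c" "[]"] vc v by (auto simp: ALSW_iff)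
  then have "has_lead (case_option ?g gen y) (assoc (case_option (bracketing (v @ c)) NLtr y))" for y
    using assoc_bracketing[OF vc] by (cases y) (auto simp: has_lead_gen)
  then have "has_lead (eval_na (case_option ?g gen) C) (plug \<pi> v)"
    using eval_na_has_lead[of "case_option ?g gen" "case_option (bracketing (v @ c)) NLtr" C]
    by (simp add: ns good_bracketing \<pi> assoc_bracketing)
  then show ?thesis
    by (simp add: special_word_def lead_eq[OF f] split)
qed

lemma comm_antisym: "comm f g = - comm g f"
  by (simp add: comm_def)

lemma eval_na_in_ideal:
  assumes I: "lie_ideal I" and g: "g \<in> I"
  shows "eval_na (case_option g gen) C \<in> Lie \<and>
    (sum_list (map pstars (assoc C)) \<noteq> 0 \<longrightarrow> eval_na (case_option g gen) C \<in> I)"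
proof (induction C)
  case (NLtr y)
  then show ?case
    using assms by (cases y) (auto simp: gen_in_Lie lie_ideal_def)
next
  case (NOp C)
  then show ?case
    using I by (auto simp: opP_in_Lie lie_ideal_def)
next
  case (NBr C D)
  let ?e = "eval_na (case_option g gen)"
  have "comm (?e C) (?e D) \<in> I" if "?e C \<in> I"
  proof -
    have "comm (?e D) (?e C) \<in> I" using I NBr that by (auto simp: lie_ideal_def)
    then show ?thesis
      using I comm_antisym[of "?e C" "?e D"] opoly.subspace_neg by (auto simp: lie_ideal_def)
  qed
  then show ?case
    using I NBr by (auto simp: comm_in_Lie lie_ideal_def)
qed

lemma special_word_in_ideal:
  assumes "lie_ideal I" "f \<in> I" "has_lead f v" "v \<in> ALSW" "\<pi> \<in> star_words" "plug \<pi> v \<in> ALSW"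
  shows "special_word \<pi> f \<in> I"
proof -
  obtain C c where split: "chosen_split \<pi> v = (C, c)" by fastforce
  have "bracket_split \<pi> v (C, c)"
    using ex_bracket_split[OF assms(5,4,6)] someI[of "bracket_split \<pi> v"] split
    unfolding chosen_split_def by metis
  then have "assoc C \<in> star_words" by (auto simp: bracket_split_def)
  moreover have "foldl (\<lambda>h d. comm h (LS d)) f cs \<in> I" for cs
  proof (induction cs rule: rev_induct)
    case (snoc d cs)
    then have "comm (LS d) (foldl (\<lambda>h d. comm h (LS d)) f cs) \<in> I"
      using assms(1) LS_in_Lie by (auto simp: lie_ideal_def)
    then have "- comm (LS d) (foldl (\<lambda>h d. comm h (LS d)) f cs) \<in> I"
      using assms(1) opoly.subspace_neg by (auto simp: lie_ideal_def)
    then show ?case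
      by (simp add: comm_antisym[of _ "LS d"])
  qed (use assms in simp)
  ultimately show ?thesis
    using eval_na_in_ideal[OF assms(1), of _ C] by (simp add: special_word_def lead_eq[OF assms(3)] split star_words_def)
qed

section \<open>The Lie algebra with operator\<close>

lemma opP_zero [simp]: "opP 0 = 0"
  by (simp add: opP_def)

lemma opP_add: "opP (f + g) = opP f + opP g"
  using opP_diff[of f "0 - g"] opP_diff[of 0 g] by simp

lemma poly_mapping_sum_single:
  "(\<Sum>w\<in>supp f. mon w (coeff f w)) = f"
  by (rule poly_mapping_eqI) (simp add: lookup_sum lookup_single when_def in_keys_iff)

lemma scal_single: "scal c (mon w a) = mon w (c * a)"
  by (rule poly_mapping_eqI) (simp add: lookup_scal lookup_single when_def)

lemma scal_zero [simp]: "scal c 0 = 0"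
  by (rule poly_mapping_eqI) (simp add: lookup_scal)

lemma scal_add: "scal c (f + g) = scal c f + scal c g"
  by (rule opoly.scale_right_distrib)

lemma scal_sum: "scal c (sum g A) = (\<Sum>a\<in>A. scal c (g a))"
  by (rule opoly.scale_sum_right)

lemma opoly_induct [case_names zero single add]:
  fixes f :: "('x, 'k::field) opoly"
  assumes "h 0" and "\<And>w. h (mon w 1)"
    and "\<And>c f g. h f \<Longrightarrow> h g \<Longrightarrow> h (scal c f + g)"
  shows "h f"
proof -
  have "h (\<Sum>w\<in>A. mon w (coeff f w))" if "finite A" for A
    using that
  proof (induction A rule: finite_induct)
    case (insert w A)
    then show ?case
      using assms(3)[OF assms(2) insert.IH, of "coeff f w" w] by (simp add: scal_single)
  qed (simp add: assms(1))
  from this[of "supp f"] show ?thesis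
    by (simp add: poly_mapping_sum_single)
qed

lemma scal_mult_left: "scal c (f * g) = scal c f * g" for f g :: "('x, 'k::field) opoly"
  by (simp add: scal_conv_mult mult.assoc)

lemma scal_mult_right: "scal c (f * g) = f * scal c g" for f g :: "('x, 'k::field) opoly"
proof -
  have "mon 0 c * f = f * mon 0 c"
  proof (induction f rule: opoly_induct)
    case (single w)
    then show ?case by (simp add: mult_single)
  next
    case (add b f g)
    let ?b = "mon 0 b :: ('x, 'k) opoly" and ?c = "mon 0 c :: ('x, 'k) opoly"
    have "?c * ?b = ?b * ?c" by (simp add: mult_single mult.commute)
    then have "?c * (?b * f) = ?b * (?c * f)" by (simp only: mult.assoc[symmetric])
    also have "\<dots> = (?b * f) * ?c" by (simp only: add(1) mult.assoc)
    finally show ?case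
      using add(2) by (simp add: scal_conv_mult distrib_left distrib_right)
  qed simp
  then show ?thesis
    by (simp add: scal_conv_mult mult.assoc[symmetric])
qed

lemmas opoly_bilinear = distrib_left distrib_right scal_mult_left[symmetric] scal_mult_right[symmetric]

lemma opP_scal: "opP (scal c f) = scal c (opP f)"
proof (induction f arbitrary: c rule: opoly_induct)
  case (add b f g)
  then show ?case by (simp add: opP_add scal_add)
qed (simp_all add: scal_single opP_single)

lemma lie_algebra_comm: "lie_algebra scal (comm :: ('x, 'k::field) opoly \<Rightarrow> _)"
proof (rule lie_algebra.intro[OF vector_space_scal lie_algebra_axioms.intro])
  fix f g h :: "('x, 'k) opoly"
  show "Vector_Spaces.linear scal scal (\<lambda>f. comm f g)" "Vector_Spaces.linear scal scal (comm g)"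
    unfolding Vector_Spaces.linear_iff comm_def
    by (simp_all add: vector_space_scal algebra_simps scal_mult_left[symmetric] scal_mult_right[symmetric]
        opoly.scale_right_diff_distrib)
  show "comm f f = 0" "comm f (comm g h) + comm g (comm h f) + comm h (comm f g) = 0"
    by (simp_all add: comm_def algebra_simps)
qed

interpretation opoly: op_lie_algebra scal comm opP
  by (intro op_lie_algebra.intro op_lie_algebra_axioms.intro lie_algebra_comm)
    (simp add: Vector_Spaces.linear_iff vector_space_scal opP_add opP_scal)

lemma LS_eq_LS_val: "LS u = opoly.LS_val gen u"
  by (simp add: LS_def opoly.LS_val_def eval_na_eq)

text \<open>The span contains the letters and is closed under brackets by
  \<open>br_LS_val_span\<close> and under the operator because \<open>Op u\<close> is again a
  Lyndon-Shirshov prime.\<close>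

lemma Lie_eq_span: "(Lie :: ('x::wellorder, 'k::field) opoly set) = opoly.span (LS ` ALSW)"
proof
  let ?S = "opoly.span (opoly.LS_val gen ` ALSW) :: ('x, 'k) opoly set"
  have "lie_subalgebra ?S" unfolding lie_subalgebra_def
    using opoly.br_LS_val_span opoly.P_LS_val_span opoly.subspace_span by blast
  moreover have "range gen \<subseteq> ?S"
  proof
    fix f :: "('x, 'k) opoly" assume "f \<in> range gen"
    then obtain x where "f = opoly.LS_val gen [Ltr x]" by (auto simp: opoly.LS_val_Ltr)
    then show "f \<in> ?S" by (auto simp: ALSW_single intro!: opoly.span_base imageI)
  qed
  ultimately show "Lie \<subseteq> opoly.span (LS ` ALSW :: ('x, 'k) opoly set)"
    unfolding Lie_def LS_eq_LS_val by (intro hull_minimal)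
  show "opoly.span (LS ` ALSW :: ('x, 'k) opoly set) \<subseteq> Lie"
    by (rule opoly.span_minimal) (auto simp: LS_in_Lie subspace_Lie)
qed

lemma ex_dl_max:
  assumes "finite A" "A \<noteq> {}" "A \<subseteq> ALSW"
  shows "\<exists>m\<in>A. \<forall>w\<in>A. w = m \<or> dl_less w m"
  using assms
proof (induction A rule: finite_ne_induct)
  case (insert a A)
  then obtain m where m: "m \<in> A" "\<forall>w\<in>A. w = m \<or> dl_less w m" by auto
  then have "a = m \<or> dl_less a m \<or> dl_less m a" using insert.prems ALSW_total[of a m] by auto
  then show ?case
    using m dl_less_trans by (metis insert_iff)
qed auto

text \<open>The leading words of the \<open>LS u\<close> are the distinct words \<open>u\<close>, so
  nothing cancels at the greatest \<open>u\<close> with nonzero coefficient. Both the independence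
  of these elements and \<open>Lie_lead\<close> come from here.\<close>

lemma sum_LS_lead:
  assumes "finite A" "A \<subseteq> ALSW" "\<exists>u\<in>A. r u \<noteq> 0"
  obtains w where "w \<in> A" "r w \<noteq> 0" "coeff (\<Sum>u\<in>A. scal (r u) (LS u)) w = r w"
    "\<forall>v\<in>supp (\<Sum>u\<in>A. scal (r u) (LS u)). v = w \<or> dl_less v w"
proof -
  obtain w where w: "w \<in> A" "r w \<noteq> 0" and max: "\<And>u. u \<in> A \<Longrightarrow> r u \<noteq> 0 \<Longrightarrow> u = w \<or> dl_less u w"
    using ex_dl_max[of "{u \<in> A. r u \<noteq> 0}"] assms by auto
  have lk: "v = w \<or> dl_less v w" if "u \<in> A" "r u * coeff (LS u) v \<noteq> 0" for u v
  proof -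
    have "r u \<noteq> 0" "v \<in> supp (LS u :: ('a, 'b) opoly)" using that by (auto simp: in_keys_iff)
    then show ?thesis
      using max[of u] has_lead_key[OF LS_has_lead, of u v] that(1) assms(2) dl_less_trans[of v u w] by auto
  qed
  have "coeff (\<Sum>u\<in>A. scal (r u) (LS u)) w =
      (\<Sum>u\<in>A. if u = w then r w else 0)"
    unfolding lookup_sum lookup_scal
  proof (rule sum.cong)
    fix u assume u: "u \<in> A"
    show "r u * coeff (LS u) w = (if u = w then r w else 0)"
    proof (cases "u = w")
      case True
      then show ?thesis
        using has_lead_lookup[OF LS_has_lead] w assms(2) by auto
    next
      case False
      have "dl_less w u" if "r u * coeff (LS u) w \<noteq> 0"
        using that False u assms(2) has_lead_key[OF LS_has_lead, of u w] by (auto simp: in_keys_iff)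
      then show ?thesis
        using False max[OF u] dl_less_asym[of w u] by auto
    qed
  qed simp
  then have "coeff (\<Sum>u\<in>A. scal (r u) (LS u)) w = r w" using w assms(1) by simp
  moreover have "v = w \<or> dl_less v w" if "v \<in> supp (\<Sum>u\<in>A. scal (r u) (LS u))" for v
    using that lk unfolding in_keys_iff lookup_sum lookup_scal by (meson sum.not_neutral_contains_not_neutral)
  ultimately show thesis
    using that w by blast
qed

lemma LS_sum_zero:
  assumes "finite A" "A \<subseteq> ALSW" "(\<Sum>u\<in>A. scal (r u) (LS u)) = 0" "u \<in> A"
  shows "r u = 0"
  using sum_LS_lead[OF assms(1,2), of r] assms(3,4) by (metis lookup_zero)

lemma inj_on_LS: "inj_on LS ALSW"
  by (metis LS_has_lead inj_onI lead_eq(1))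

lemma (in vector_space) span_family:
  assumes "x \<in> span (g ` A)" "inj_on g A"
  obtains t r where "finite t" "t \<subseteq> A" "x = (\<Sum>u\<in>t. scale (r u) (g u))"
proof -
  obtain t' r where t': "finite t'" "t' \<subseteq> g ` A" "x = (\<Sum>a\<in>t'. scale (r a) a)"
    using assms(1) unfolding span_explicit by blast
  then obtain t where t: "t \<subseteq> A" "finite t" "t' = g ` t" by (meson finite_subset_image)
  then have "x = (\<Sum>u\<in>t. scale (r (g u)) (g u))"
    using t'(3) sum.reindex[of g t] inj_on_subset[OF assms(2)] by (simp add: comp_def)
  then show thesis
    by (rule that[OF t(2,1)])
qed

lemma Lie_lead:
  assumes "f \<in> Lie" "f \<noteq> 0"
  obtains w where "w \<in> ALSW" "coeff f w \<noteq> 0" "\<forall>v\<in>supp f. v = w \<or> dl_less v w"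
proof -
  obtain t r where t: "finite t" "t \<subseteq> ALSW" "f = (\<Sum>u\<in>t. scal (r u) (LS u))"
    using opoly.span_family[OF _ inj_on_LS] assms(1) unfolding Lie_eq_span by blast
  have ne: "\<exists>u\<in>t. r u \<noteq> 0"
    using assms(2) t(3) by (metis (no_types, lifting) opoly.scale_zero_left sum.neutral)
  obtain w where "w \<in> t" "r w \<noteq> 0" "coeff f w = r w"
      "\<forall>v\<in>supp f. v = w \<or> dl_less v w"
    by (rule sum_LS_lead[OF t(1,2) ne, folded t(3)])
  then show thesis
    using that[of w] t(2) by auto
qed

section \<open>Reduction modulo the relations\<close>

definition reducible :: "'x::wellorder oword \<Rightarrow> bool" where
  "reducible w \<longleftrightarrow> (\<exists>\<pi>\<in>star_words. \<exists>u\<in>ALSW. \<exists>v\<in>ALSW. dl_less v u \<and> w = plug \<pi> [Op u, Op v])"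

definition irr_words :: "'x::wellorder oword set" where
  "irr_words = {w \<in> ALSW. \<not> reducible w}"

lemma Irr_S_N_eq: "Irr_S_N = bracketing ` irr_words"
  unfolding Irr_S_N_def irr_words_def reducible_def by auto

lemma Op_Op_ALSW:
  assumes "u \<in> ALSW" "v \<in> ALSW" "dl_less v u"
  shows "[Op u, Op v] \<in> ALSW"
proof -
  have "prime_less (Op v) (Op u)" using dl_less_Op[OF assms(3)] by (simp add: dl_less_single)
  then have "primes.lyn ([Op u] @ [Op v])"
    using assms LS_prime_valid[of "Op u"] LS_prime_valid[of "Op v"]
    by (intro primes.lyn_append primes.lyn_letter) auto
  then show ?thesis
    using assms by (simp add: ALSW_iff)
qed

text \<open>The leading words of the first three terms have the same degree \<open>?d\<close>, and
  the last term does not exceed it. Breadth decides: every word of an \<open>opP\<close> term is a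
  single prime, while \<open>[Op u, Op v]\<close> has breadth two.\<close>

lemma fN_has_lead:
  assumes uv: "u \<in> ALSW" "v \<in> ALSW" "dl_less v u"
  shows "has_lead (fN u v :: ('x::wellorder, 'k::field) opoly) [Op u, Op v]"
proof -
  let ?u = "LS u :: ('x, 'k) opoly" and ?v = "LS v :: ('x, 'k) opoly"
  let ?d = "odeg u + odeg v + 2"
  have leads: "has_lead ?u u" "has_lead ?v v" "has_lead (opP ?u) [Op u]" "has_lead (opP ?v) [Op v]"
    using uv by (simp_all add: LS_has_lead has_lead_opP)
  have deg: "odeg w \<le> odeg a" if "has_lead f a" "w \<in> supp f" for f :: "('x, 'k) opoly" and a w
    using has_lead_key[OF that] dl_less_odeg by auto
  have comm_deg: "odeg w \<le> odeg a + odeg b"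
    if fg: "has_lead f a" "has_lead g b" and w: "w \<in> supp (comm f g)"
    for f g :: "('x, 'k) opoly" and a b w
  proof -
    have "w \<in> supp (f * g) \<or> w \<in> supp (g * f)"
      using w by (auto simp: comm_def in_keys_iff lookup_minus)
    then show ?thesis
      using deg[OF has_lead_mult[OF fg], of w] deg[OF has_lead_mult[OF fg(2,1)], of w] by auto
  qed
  have below: "keys_below (opP f) [Op u, Op v]"
    if "\<And>w. w \<in> supp f \<Longrightarrow> odeg w < ?d" for f :: "('x, 'k) opoly"
    using keys_opP[of f] that unfolding keys_below_def by (fastforce simp: dl_less_iff)
  have deg2: "odeg w \<le> odeg u + odeg v + 1" if "w \<in> supp (opP (comm ?u ?v))" for w
    using keys_opP[of "comm ?u ?v"] that comm_deg[OF leads(1,2)] by auto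
  have "has_lead (comm (opP ?u) (opP ?v)) ([Op u] @ [Op v])"
    by (rule has_lead_comm[OF leads(3,4)]) (use Op_Op_ALSW[OF uv] lyn_dl_less_rotate[of "[Op u]" "[Op v]"] ALSW_lyn in auto)
  moreover have "keys_below (opP (comm (opP ?u) ?v)) [Op u, Op v]"
    using comm_deg[OF leads(3,2)] by (intro below) fastforce
  moreover have "keys_below (opP (comm ?u (opP ?v))) [Op u, Op v]"
    using comm_deg[OF leads(1,4)] by (intro below) fastforce
  moreover have "keys_below (opP (opP (comm ?u ?v))) [Op u, Op v]"
    using deg2 by (intro below) fastforce
  ultimately have "has_lead (comm (opP ?u) (opP ?v) + (opP (opP (comm ?u ?v)) -
      opP (comm (opP ?u) ?v) - opP (comm ?u (opP ?v)))) [Op u, Op v]"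
    by (intro has_lead_add_below keys_below_diff) auto
  then show ?thesis
    by (simp add: fN_def algebra_simps)
qed

abbreviation special_span :: "'x::wellorder oword \<Rightarrow> ('x, 'k::field) opoly set" where
  "special_span w \<equiv> opoly.span {special_word \<pi> s | \<pi> s. s \<in> S_N \<and> admissible \<pi> s \<and> dl_less (plug \<pi> (lead s)) w}"

lemma S_N_cases:
  assumes "s \<in> (S_N :: ('x::wellorder, 'k::field) opoly set)"
  obtains u v where "u \<in> ALSW" "v \<in> ALSW" "dl_less v u" "s = fN u v" "lead s = [Op u, Op v]"
    "has_lead s [Op u, Op v]" "[Op u, Op v] \<in> ALSW"
proof -
  obtain u v where "u \<in> ALSW" "v \<in> ALSW" "dl_less v u" "s = fN u v"
    using assms by (auto simp: S_N_def)
  then show thesis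
    using that[of u v] fN_has_lead[of u v] lead_eq(1)[OF fN_has_lead[of u v]] Op_Op_ALSW[of u v] by simp
qed

lemmas Id_S_N_closed = opoly.subspace_0[OF subspace_Id_S_N] opoly.subspace_add[OF subspace_Id_S_N]
  opoly.subspace_scale[OF subspace_Id_S_N] opoly.subspace_neg[OF subspace_Id_S_N]

lemma Id_S_N_superset: "S_N \<subseteq> Id_Lie S_N"
  unfolding Id_Lie_def by (rule hull_subset)

lemma special_word_S_N:
  assumes "s \<in> S_N" "admissible \<pi> s"
  shows "has_lead (special_word \<pi> s) (plug \<pi> (lead s))" "special_word \<pi> s \<in> Id_Lie S_N"
proof -
  obtain w where w: "has_lead s w" "w \<in> ALSW" "lead s = w" using S_N_cases[OF assms(1)] by metis
  then show "has_lead (special_word \<pi> s) (plug \<pi> (lead s))" "special_word \<pi> s \<in> Id_Lie S_N"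
    using assms special_word_has_lead[OF w(1,2), of \<pi>] Id_S_N_superset
      special_word_in_ideal[OF lie_ideal_Id_S_N _ w(1,2), of \<pi>]
    by (auto simp: admissible_def)
qed

lemma special_span_Id: "special_span w \<subseteq> Id_Lie S_N"
  by (rule opoly.span_minimal) (auto simp: special_word_S_N subspace_Id_S_N)

lemma Id_S_N_Lie: "Id_Lie S_N \<subseteq> Lie"
  by (rule lie_ideal_Id_S_N[unfolded lie_ideal_def, THEN conjunct1])

text \<open>Division with remainder along the well-founded order: the leading word of an element of
  \<open>Lie\<close> is in \<open>ALSW\<close>, so it is removed by a special normal word if
  reducible and by \<open>LS v\<close> otherwise. The bound \<open>w\<close> is carried along since
  triviality of a composition is relative to it.\<close>

lemma reduce:
  fixes f :: "('x::wellorder, 'k::field) opoly"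
  assumes "f \<in> Lie" "keys_below f w"
  shows "\<exists>g r. f = g + r \<and> g \<in> special_span w \<and> r \<in> opoly.span (LS ` irr_words)"
  using assms
proof (induction w arbitrary: f rule: wf_induct[OF wf_dl_less])
  case (1 w)
  note IH = 1(1)[rule_format] and f = 1(2,3)
  show ?case
  proof (cases "f = 0")
    case True
    then show ?thesis
      using opoly.span_zero by (intro exI[of _ 0]) auto
  next
    case False
    obtain v where v: "v \<in> ALSW" "coeff f v \<noteq> 0"
      "\<forall>u\<in>supp f. u = v \<or> dl_less u v"
      by (rule Lie_lead[OF f(1) False])
    then have vw: "dl_less v w" using f(2) by (simp add: keys_below_def in_keys_iff)
    let ?c = "coeff f v"
    have step: "\<exists>g r. f - scal ?c h = g + r \<and> g \<in> special_span w \<and> r \<in> opoly.span (LS ` irr_words)"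
      if h: "h \<in> Lie" "has_lead h v" for h
    proof -
      have "f - scal ?c h \<in> Lie"
        using f(1) h(1) by (intro opoly.subspace_diff opoly.subspace_scale subspace_Lie)
      moreover have "keys_below (f - scal ?c h) v" unfolding keys_below_def
      proof
        fix u assume u: "u \<in> supp (f - scal ?c h)"
        then have "u \<noteq> v"
          using has_lead_lookup[OF h(2)] by (auto simp: in_keys_iff lookup_minus lookup_scal)
        moreover have "u \<in> supp f \<or> u \<in> supp h"
          using u by (auto simp: in_keys_iff lookup_minus lookup_scal)
        ultimately show "dl_less u v" using v(3) has_lead_key[OF h(2)] by blast
      qed
      ultimately obtain g r where gr: "f - scal ?c h = g + r" "g \<in> special_span v" "r \<in> opoly.span (LS ` irr_words)"
        using IH[of v "f - scal ?c h"] vw by auto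
      have "special_span v \<subseteq> (special_span w :: ('x, 'k) opoly set)"
        using vw dl_less_trans by (intro opoly.span_mono) blast
      then show ?thesis
        using gr by blast
    qed
    show ?thesis
    proof (cases "reducible v")
      case True
      then obtain \<pi> a b where \<pi>: "\<pi> \<in> star_words" "a \<in> ALSW" "b \<in> ALSW" "dl_less b a" "v = plug \<pi> [Op a, Op b]"
        unfolding reducible_def by blast
      let ?s = "fN a b :: ('x, 'k) opoly"
      have s: "?s \<in> S_N" "lead ?s = [Op a, Op b]"
        using \<pi> lead_eq(1)[OF fN_has_lead] by (auto simp: S_N_def)
      then have adm: "admissible \<pi> ?s" using \<pi> v(1) by (simp add: admissible_def)
      have h: "has_lead (special_word \<pi> ?s) v" "special_word \<pi> ?s \<in> Lie"
        using special_word_S_N[OF s(1) adm] s(2) \<pi>(5) Id_S_N_Lie by auto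
      obtain g r where gr: "f - scal ?c (special_word \<pi> ?s) = g + r" "g \<in> special_span w" "r \<in> opoly.span (LS ` irr_words)"
        using step[OF h(2,1)] by blast
      have "special_word \<pi> ?s \<in> special_span w"
      proof (rule opoly.span_base)
        have "dl_less (plug \<pi> (lead ?s)) w" using s(2) \<pi>(5) vw by simp
        then show "special_word \<pi> ?s \<in>
            {special_word \<pi> s | \<pi> s. s \<in> S_N \<and> admissible \<pi> s \<and> dl_less (plug \<pi> (lead s)) w}"
          using s(1) adm by blast
      qed
      then have "scal ?c (special_word \<pi> ?s) + g \<in> special_span w"
        using gr(2) by (intro opoly.span_add opoly.span_scale)
      moreover have "f = (scal ?c (special_word \<pi> ?s) + g) + r"
        using gr(1) by (simp add: algebra_simps)
      ultimately show ?thesis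
        using gr(3) by blast
    next
      case False
      then have irr: "v \<in> irr_words" using v(1) by (simp add: irr_words_def)
      obtain g r where gr: "f - scal ?c (LS v) = g + r" "g \<in> special_span w" "r \<in> opoly.span (LS ` irr_words)"
        using step[OF LS_in_Lie LS_has_lead[OF v(1)]] by blast
      have "scal ?c (LS v) + r \<in> opoly.span (LS ` irr_words)"
        by (intro opoly.span_add opoly.span_scale opoly.span_base[OF imageI[OF irr]] gr(3))
      moreover have "f = g + (scal ?c (LS v) + r)" using gr(1) by (simp add: algebra_simps)
      ultimately show ?thesis
        using gr(2) by blast
    qed
  qed
qed

lemma Lie_mod_Id:
  assumes "f \<in> Lie"
  shows "\<exists>r\<in>opoly.span (LS ` irr_words). f - r \<in> Id_Lie S_N"
proof (cases "f = 0")
  case True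
  then show ?thesis
    using opoly.span_zero opoly.subspace_0[OF subspace_Id_S_N] by (intro bexI[of _ 0]) auto
next
  case False
  then obtain w where "\<forall>v\<in>supp f. v = w \<or> dl_less v w" using Lie_lead[OF assms] by blast
  \<comment> \<open>\<open>[Op w]\<close> has one degree more than \<open>w\<close> and serves as a
    bound for all words of \<open>f\<close>.\<close>
  moreover have "dl_less w [Op w]" by (simp add: dl_less_iff)
  ultimately have "keys_below f [Op w]" unfolding keys_below_def by (metis dl_less_trans)
  then obtain g r where "f = g + r" "g \<in> special_span [Op w]" "r \<in> opoly.span (LS ` irr_words)"
    using reduce[OF assms] by blast
  then show ?thesis
    using special_span_Id by (intro bexI[of _ r]) auto
qed

section \<open>The quotient and its universal property\<close>

lemma nl_class_eq_iff: "f \<in> Lie \<Longrightarrow> g \<in> Lie \<Longrightarrow> nl_class f = nl_class g \<longleftrightarrow> f - g \<in> Id_Lie S_N"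
  using Quotient3_rel[OF Quotient3_NL, of f g] nl_rel_refl by (auto simp: nl_class_def nl_rel_def)

lemma rep_NL: "rep_NL x \<in> Lie" "nl_class (rep_NL x) = x"
  using Quotient3_rep_reflp[OF Quotient3_NL, of x] Quotient3_abs_rep[OF Quotient3_NL, of x]
  by (auto simp: nl_class_def nl_rel_def)

lemma nl_cases:
  obtains f where "f \<in> Lie" "x = nl_class f"
  using rep_NL by metis

lemma nl_class_add: "f \<in> Lie \<Longrightarrow> g \<in> Lie \<Longrightarrow> nl_class (f + g) = nl_class f + nl_class g"
  and nl_class_zero: "nl_class 0 = 0"
  and nl_class_scale: "f \<in> Lie \<Longrightarrow> nl_class (scal c f) = nl_scale c (nl_class f)"
  and nl_class_br: "f \<in> Lie \<Longrightarrow> g \<in> Lie \<Longrightarrow> nl_class (comm f g) = nl_br (nl_class f) (nl_class g)"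
  and nl_class_P: "f \<in> Lie \<Longrightarrow> nl_class (opP f) = nl_P (nl_class f)"
  by (simp_all add: nl_class_def nl_rel_refl plus_NL.abs_eq nl_scale.abs_eq nl_br.abs_eq nl_P.abs_eq
      zero_NL.abs_eq)

lemmas Lie_closed = gen_in_Lie LS_in_Lie comm_in_Lie opP_in_Lie opoly.subspace_add[OF subspace_Lie]
  opoly.subspace_scale[OF subspace_Lie] opoly.subspace_0[OF subspace_Lie]

lemmas nl_class_simps = nl_class_add[symmetric] nl_class_scale[symmetric] nl_class_br[symmetric]
  nl_class_P[symmetric] nl_class_zero[symmetric] Lie_closed

lemma vector_space_nl: "vector_space (nl_scale :: 'k \<Rightarrow> ('x::wellorder, 'k::field) NL \<Rightarrow> ('x, 'k) NL)"
proof
  fix a b :: 'k and x y :: "('x, 'k) NL"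
  obtain f where f: "f \<in> Lie" "x = nl_class f" by (rule nl_cases)
  obtain g where g: "g \<in> Lie" "y = nl_class g" by (rule nl_cases)
  show "nl_scale a (x + y) = nl_scale a x + nl_scale a y"
    "nl_scale (a + b) x = nl_scale a x + nl_scale b x"
    "nl_scale a (nl_scale b x) = nl_scale (a * b) x"
    "nl_scale 1 x = x"
    using f g by (simp_all add: nl_class_simps scal_add opoly.scale_left_distrib)
qed

lemma lie_algebra_nl:
  "lie_algebra (nl_scale :: 'k \<Rightarrow> ('x::wellorder, 'k::field) NL \<Rightarrow> ('x, 'k) NL) nl_br"
proof (rule lie_algebra.intro[OF vector_space_nl lie_algebra_axioms.intro])
  fix x y z :: "('x, 'k) NL"
  have add: "nl_br (x + y) z = nl_br x z + nl_br y z" "nl_br z (x + y) = nl_br z x + nl_br z y"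
    and scale: "nl_br (nl_scale c x) z = nl_scale c (nl_br x z)" "nl_br z (nl_scale c x) = nl_scale c (nl_br z x)"
    for c :: 'k and x y z :: "('x, 'k) NL"
  proof -
    obtain f where f: "f \<in> Lie" "x = nl_class f" by (rule nl_cases)
    obtain g where g: "g \<in> Lie" "y = nl_class g" by (rule nl_cases)
    obtain h where h: "h \<in> Lie" "z = nl_class h" by (rule nl_cases)
    show "nl_br (x + y) z = nl_br x z + nl_br y z" "nl_br z (x + y) = nl_br z x + nl_br z y"
      "nl_br (nl_scale c x) z = nl_scale c (nl_br x z)" "nl_br z (nl_scale c x) = nl_scale c (nl_br z x)"
      using f g h by (simp_all add: nl_class_simps opoly.br_add_left opoly.br_add_right
          opoly.br_scale_left opoly.br_scale_right)
  qed
  show "Vector_Spaces.linear nl_scale nl_scale (\<lambda>x. nl_br x y)" "Vector_Spaces.linear nl_scale nl_scale (nl_br x)"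
    unfolding Vector_Spaces.linear_iff by (simp_all add: vector_space_nl add scale)
  obtain f where f: "f \<in> Lie" "x = nl_class f" by (rule nl_cases)
  obtain g where g: "g \<in> Lie" "y = nl_class g" by (rule nl_cases)
  obtain h where h: "h \<in> Lie" "z = nl_class h" by (rule nl_cases)
  show "nl_br x x = 0" "nl_br x (nl_br y z) + nl_br y (nl_br z x) + nl_br z (nl_br x y) = 0"
    using f g h by (simp_all add: nl_class_simps opoly.br_self opoly.jacobi)
qed

definition nij :: "('x, 'k::field) opoly \<Rightarrow> ('x, 'k) opoly \<Rightarrow> ('x, 'k) opoly" where
  "nij f g = comm (opP f) (opP g) - opP (comm (opP f) g) - opP (comm f (opP g)) + opP (opP (comm f g))"

lemma nij_linear_left: "nij (scal c f + f') g = scal c (nij f g) + nij f' g"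
  by (simp add: nij_def opP_add opP_scal opoly.br_add_left opoly.br_scale_left scal_add
      opoly.scale_right_diff_distrib algebra_simps)

lemma opP_uminus: "opP (- f) = - opP f"
  using opP_diff[of 0 f] by simp

lemma nij_antisym: "nij f g = - nij g f"
  unfolding nij_def
  by (simp add: comm_antisym[of "opP f" "opP g"] comm_antisym[of "opP f" g] comm_antisym[of f "opP g"]
      comm_antisym[of f g] opP_uminus)

lemma nij_self: "nij f f = 0"
  by (simp add: nij_def comm_antisym[of f "opP f"] opP_uminus opoly.br_self)

lemma nij_zero: "nij 0 g = 0"
  by (simp add: nij_def comm_def)

text \<open>The defect \<open>nij\<close> of the Nijenhuis identity is bilinear and alternating, so
  it lies in the ideal for all arguments once it does so for pairs of Lyndon-Shirshov words with
  \<open>u > v\<close>, where it is a generator in \<open>S_N\<close>.\<close>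

lemma nij_in_Id:
  fixes f g :: "('x::wellorder, 'k::field) opoly"
  assumes "f \<in> Lie" "g \<in> Lie"
  shows "nij f g \<in> Id_Lie S_N"
proof -
  have 0: "nij (LS u) (LS v) \<in> Id_Lie (S_N :: ('x, 'k) opoly set)" if uv: "u \<in> ALSW" "v \<in> ALSW" for u v :: "'x oword"
  proof -
    have *: "nij (LS u) (LS v) \<in> Id_Lie (S_N :: ('x, 'k) opoly set)"
      if "u \<in> ALSW" "v \<in> ALSW" "dl_less v u" for u v :: "'x oword"
      using Id_S_N_superset that by (force simp: S_N_def fN_def nij_def)
    consider "u = v" | "dl_less v u" | "dl_less u v"
      using ALSW_total[OF uv] by blast
    then show ?thesis
    proof cases
      case 1
      then show ?thesis
        by (simp add: nij_self Id_S_N_closed)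
    next
      case 3
      then show ?thesis
        using *[of v u] uv by (subst nij_antisym) (auto intro!: Id_S_N_closed)
    qed (use * uv in blast)
  qed
  have 1: "nij f (LS v) \<in> Id_Lie S_N" if "f \<in> opoly.span (LS ` ALSW)" "v \<in> ALSW" for f :: "('x, 'k) opoly" and v
    using that
    by (induction f rule: opoly.span_induct_alt)
      (auto simp: nij_zero nij_linear_left 0 intro!: Id_S_N_closed)
  have "nij g f \<in> Id_Lie S_N" if "f \<in> opoly.span (LS ` ALSW)" "g \<in> opoly.span (LS ` ALSW)" for f g :: "('x, 'k) opoly"
    using that(2)
  proof (induction g rule: opoly.span_induct_alt)
    case base
    then show ?case
      by (simp add: nij_zero Id_S_N_closed)
  next
    case (step c x y)
    then obtain v where "x = LS v" "v \<in> ALSW" by blast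
    then have "nij x f \<in> Id_Lie S_N"
      using 1[OF that(1)] opoly.subspace_neg[OF subspace_Id_S_N] by (subst nij_antisym) auto
    then show ?case
      using step by (auto simp: nij_linear_left
        intro!: Id_S_N_closed)
  qed
  then show ?thesis
    using assms unfolding Lie_eq_span by blast
qed

lemma nl_class_diff: "f \<in> Lie \<Longrightarrow> g \<in> Lie \<Longrightarrow> nl_class (f - g) = nl_class f - nl_class g"
  by (simp add: nl_class_def nl_rel_refl minus_NL.abs_eq)

lemma nl_P_linear: "Vector_Spaces.linear nl_scale nl_scale (nl_P :: ('x::wellorder, 'k::field) NL \<Rightarrow> _)"
proof -
  have "nl_P (x + y) = nl_P x + nl_P y" "nl_P (nl_scale c x) = nl_scale c (nl_P x)"
    for c :: 'k and x y :: "('x, 'k) NL"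
  proof -
    obtain f where f: "f \<in> Lie" "x = nl_class f" by (rule nl_cases)
    obtain g where g: "g \<in> Lie" "y = nl_class g" by (rule nl_cases)
    show "nl_P (x + y) = nl_P x + nl_P y" "nl_P (nl_scale c x) = nl_scale c (nl_P x)"
      using f g by (simp_all add: nl_class_simps opP_add opP_scal)
  qed
  then show ?thesis
    unfolding Vector_Spaces.linear_iff by (simp add: vector_space_nl)
qed

lemma nijenhuis_nl:
  "nijenhuis_lie_algebra (nl_scale :: 'k \<Rightarrow> ('x::wellorder, 'k::field) NL \<Rightarrow> ('x, 'k) NL) nl_br nl_P"
proof (rule nijenhuis_lie_algebra.intro[OF lie_algebra_nl nijenhuis_lie_algebra_axioms.intro[OF nl_P_linear]])
  fix x y :: "('x, 'k) NL"
  obtain f where f: "f \<in> Lie" "x = nl_class f" by (rule nl_cases)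
  obtain g where g: "g \<in> Lie" "y = nl_class g" by (rule nl_cases)
  have L: "comm (opP f) g \<in> Lie" "comm f (opP g) \<in> Lie" "comm f g \<in> Lie" "comm (opP f) (opP g) \<in> Lie"
    using f g by (simp_all add: Lie_closed)
  have "nl_class (comm (opP f) (opP g)) =
      nl_class (opP (comm (opP f) g) + opP (comm f (opP g)) - opP (opP (comm f g)))"
    using nij_in_Id[OF f(1) g(1)] L
    by (subst nl_class_eq_iff) (auto simp: Lie_closed opoly.subspace_diff[OF subspace_Lie] nij_def algebra_simps)
  then show "nl_br (nl_P x) (nl_P y) = nl_P (nl_br (nl_P x) y) + nl_P (nl_br x (nl_P y)) - nl_P (nl_P (nl_br x y))"
    using f g L by (simp add: nl_class_add nl_class_diff nl_class_br nl_class_P Lie_closed)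
qed

section \<open>Products of algebras and the universal property\<close>

lemma lie_algebra_prod:
  assumes "lie_algebra s1 b1" "lie_algebra s2 b2"
  shows "lie_algebra (\<lambda>c x. (s1 c (fst x), s2 c (snd x))) (\<lambda>x y. (b1 (fst x) (fst y), b2 (snd x) (snd y)))"
proof -
  interpret l1: lie_algebra s1 b1 by (rule assms)
  interpret l2: lie_algebra s2 b2 by (rule assms)
  have vs: "vector_space (\<lambda>c x. (s1 c (fst x), s2 c (snd x)))"
    by standard (simp_all add: prod_eq_iff l1.scale_right_distrib l2.scale_right_distrib
        l1.scale_left_distrib l2.scale_left_distrib)
  show ?thesis
    by (rule lie_algebra.intro[OF vs lie_algebra_axioms.intro])
      (simp_all add: Vector_Spaces.linear_iff vs prod_eq_iff l1.br_add_left l2.br_add_left l1.br_add_right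
        l2.br_add_right l1.br_scale_left l2.br_scale_left l1.br_scale_right l2.br_scale_right
        l1.br_self l2.br_self l1.jacobi l2.jacobi)
qed

lemma op_lie_algebra_prod:
  assumes "op_lie_algebra s1 b1 P1" "op_lie_algebra s2 b2 P2"
  shows "op_lie_algebra (\<lambda>c x. (s1 c (fst x), s2 c (snd x))) (\<lambda>x y. (b1 (fst x) (fst y), b2 (snd x) (snd y)))
    (\<lambda>x. (P1 (fst x), P2 (snd x)))"
proof -
  interpret l1: op_lie_algebra s1 b1 P1 by (rule assms)
  interpret l2: op_lie_algebra s2 b2 P2 by (rule assms)
  interpret p: lie_algebra "\<lambda>c x. (s1 c (fst x), s2 c (snd x))" "\<lambda>x y. (b1 (fst x) (fst y), b2 (snd x) (snd y))"
    by (rule lie_algebra_prod[OF l1.lie_algebra_axioms l2.lie_algebra_axioms])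
  show ?thesis
    by standard (simp_all add: prod_eq_iff
        linear_add[OF l1.P_linear] linear_add[OF l2.P_linear] linear_scale[OF l1.P_linear]
        linear_scale[OF l2.P_linear])
qed

text \<open>Freeness of \<open>Lie\<close>: the subalgebra of the product generated by the pairs \<open>(x, \<phi> x)\<close> is the graph of
  the wanted homomorphism, since its elements are combinations of pairs with first
  components \<open>LS u\<close>, which are independent.\<close>

lemma Lie_hom_exists:
  fixes \<phi> :: "'x::wellorder \<Rightarrow> 'l::ab_group_add" and scale :: "'k::field \<Rightarrow> 'l \<Rightarrow> 'l"
  assumes "op_lie_algebra scale br P"
  obtains h :: "('x, 'k) opoly \<Rightarrow> 'l" where
    "\<And>f g. f \<in> Lie \<Longrightarrow> g \<in> Lie \<Longrightarrow> h (f + g) = h f + h g"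
    "\<And>c f. f \<in> Lie \<Longrightarrow> h (scal c f) = scale c (h f)"
    "\<And>f g. f \<in> Lie \<Longrightarrow> g \<in> Lie \<Longrightarrow> h (comm f g) = br (h f) (h g)"
    "\<And>f. f \<in> Lie \<Longrightarrow> h (opP f) = P (h f)"
    "\<And>x. h (gen x) = \<phi> x"
proof -
  interpret l: op_lie_algebra scale br P by (rule assms)
  let ?s = "\<lambda>c (x :: ('x, 'k) opoly \<times> 'l). (scal c (fst x), scale c (snd x))"
  let ?b = "\<lambda>(x :: ('x, 'k) opoly \<times> 'l) y. (comm (fst x) (fst y), br (snd x) (snd y))"
  let ?P = "\<lambda>(x :: ('x, 'k) opoly \<times> 'l). (opP (fst x), P (snd x))"
  interpret p: op_lie_algebra ?s ?b ?P
    by (rule op_lie_algebra_prod[OF opoly.op_lie_algebra_axioms assms])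
  define \<sigma> where "\<sigma> x = (gen x :: ('x, 'k) opoly, \<phi> x)" for x
  have fst: "fst (p.LS_val \<sigma> u) = LS u" for u
  proof -
    have "fst (na_eval ?b ?P \<sigma> t) = eval_na gen t" for t
      by (induction t) (auto simp: \<sigma>_def)
    then show ?thesis
      by (simp add: p.LS_val_def LS_def)
  qed
  have inj: "inj_on (p.LS_val \<sigma>) ALSW"
  proof (rule inj_onI)
    fix u v assume uv: "u \<in> ALSW" "v \<in> ALSW" "p.LS_val \<sigma> u = p.LS_val \<sigma> v"
    have "(LS u :: ('x, 'k) opoly) = LS v" using arg_cong[OF uv(3), of fst] by (simp only: fst)
    then show "u = v" using inj_onD[OF inj_on_LS _ uv(1,2)] by blast
  qed
  define G where "G = p.span (p.LS_val \<sigma> ` ALSW)"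
  have fst_comb: "fst (\<Sum>u\<in>t. ?s (r u) (p.LS_val \<sigma> u)) = (\<Sum>u\<in>t. scal (r u) (LS u))"
    and snd_comb: "snd (\<Sum>u\<in>t. ?s (r u) (p.LS_val \<sigma> u)) = (\<Sum>u\<in>t. scale (r u) (snd (p.LS_val \<sigma> u)))" for r t
    by (simp_all add: fst_sum snd_sum fst)
  have zero: "l = 0" if l: "(0, l) \<in> G" for l
  proof -
    obtain t r where t: "finite t" "t \<subseteq> ALSW" "(0, l) = (\<Sum>u\<in>t. ?s (r u) (p.LS_val \<sigma> u))"
      by (rule p.span_family[OF l[unfolded G_def] inj])
    have "(\<Sum>u\<in>t. scal (r u) (LS u)) = 0"
      using arg_cong[OF t(3), of fst] by (simp only: fst_comb fst_conv)
    from this have "r u = 0" if "u \<in> t" for u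
      using LS_sum_zero[OF t(1,2)] that by blast
    moreover have "l = (\<Sum>u\<in>t. scale (r u) (snd (p.LS_val \<sigma> u)))"
      using arg_cong[OF t(3), of snd] by (simp only: snd_comb snd_conv)
    ultimately show ?thesis
      by simp
  qed
  have ex: "\<exists>l. (f, l) \<in> G" if f: "f \<in> Lie" for f
  proof -
    obtain t r where t: "finite t" "t \<subseteq> ALSW" "f = (\<Sum>u\<in>t. scal (r u) (LS u))"
      by (rule opoly.span_family[OF f[unfolded Lie_eq_span] inj_on_LS])
    let ?x = "\<Sum>u\<in>t. ?s (r u) (p.LS_val \<sigma> u)"
    have "?x \<in> G" unfolding G_def using t(2) by (intro p.span_sum p.span_scale p.span_base) auto
    moreover have "?x = (f, snd ?x)"
      by (rule prod_eqI) (simp_all only: fst_comb t(3) fst_conv snd_conv)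
    ultimately have "(f, snd ?x) \<in> G" by (rule back_subst[of "\<lambda>z. z \<in> G"])
    then show ?thesis by (rule exI)
  qed
  have unique: "l = l'" if l: "(f, l) \<in> G" "(f, l') \<in> G" for f l l'
  proof -
    have "(f, l) - (f, l') \<in> G" using l unfolding G_def by (rule p.span_diff)
    then show ?thesis
      using zero[of "l - l'"] by simp
  qed
  define h where "h f = (THE l. (f, l) \<in> G)" for f
  have h_eq: "h f = l" if l: "(f, l) \<in> G" for f l
    unfolding h_def using l by (rule the_equality) (rule unique[OF _ l])
  have hG: "(f, h f) \<in> G" if f: "f \<in> Lie" for f
  proof -
    obtain l where "(f, l) \<in> G" using ex[OF f] by (rule exE)
    then show ?thesis
      using h_eq[of f l] by simp
  qed
  show thesis
  proof (rule that[of h])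
    show "h (f + g) = h f + h g" if "f \<in> Lie" "g \<in> Lie" for f g
      using p.span_add[OF hG[OF that(1), unfolded G_def] hG[OF that(2), unfolded G_def]]
      by (intro h_eq) (simp add: G_def)
    show "h (scal c f) = scale c (h f)" if "f \<in> Lie" for c f
      using p.span_scale[OF hG[OF that, unfolded G_def], of c] by (intro h_eq) (simp add: G_def)
    show "h (comm f g) = br (h f) (h g)" if "f \<in> Lie" "g \<in> Lie" for f g
      using p.br_LS_val_span[OF hG[OF that(1), unfolded G_def] hG[OF that(2), unfolded G_def]]
      by (intro h_eq) (simp add: G_def)
    show "h (opP f) = P (h f)" if "f \<in> Lie" for f
      using p.P_LS_val_span[OF hG[OF that, unfolded G_def]] by (intro h_eq) (simp add: G_def)
    have "p.LS_val \<sigma> [Ltr x] \<in> p.LS_val \<sigma> ` ALSW" for x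
      by (rule imageI) (simp add: ALSW_single)
    from p.span_base[OF this] show "h (gen x) = \<phi> x" for x
      by (intro h_eq) (simp add: G_def p.LS_val_Ltr \<sigma>_def)
  qed
qed

lemma nijenhuis_op_lie: "nijenhuis_lie_algebra scale br P \<Longrightarrow> op_lie_algebra scale br P"
  unfolding nijenhuis_lie_algebra_def nijenhuis_lie_algebra_axioms_def op_lie_algebra_def op_lie_algebra_axioms_def
  by blast

text \<open>The elements of \<open>Lie\<close> killed by the homomorphism on the free algebra form
  an ideal, which contains \<open>S_N\<close> because the target satisfies the Nijenhuis identity.
  Hence evaluation at a representative is well defined on cosets.\<close>

lemma NL_hom_exists:
  fixes \<phi> :: "'x::wellorder \<Rightarrow> 'l::ab_group_add" and scale :: "'k::field \<Rightarrow> 'l \<Rightarrow> 'l"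
  assumes nij: "nijenhuis_lie_algebra scale br P"
  shows "\<exists>h :: ('x, 'k) NL \<Rightarrow> 'l. nijenhuis_hom nl_scale nl_br nl_P scale br P h \<and> (\<forall>x. h (nl_class (gen x)) = \<phi> x)"
proof -
  interpret l: nijenhuis_lie_algebra scale br P by (rule nij)
  obtain h :: "('x, 'k) opoly \<Rightarrow> 'l" where
    add: "\<And>f g. f \<in> Lie \<Longrightarrow> g \<in> Lie \<Longrightarrow> h (f + g) = h f + h g" and
    scale: "\<And>c f. f \<in> Lie \<Longrightarrow> h (scal c f) = scale c (h f)" and
    br: "\<And>f g. f \<in> Lie \<Longrightarrow> g \<in> Lie \<Longrightarrow> h (comm f g) = br (h f) (h g)" and
    P: "\<And>f. f \<in> Lie \<Longrightarrow> h (opP f) = P (h f)" and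
    gen: "\<And>x. h (gen x) = \<phi> x"
    using Lie_hom_exists[OF nijenhuis_op_lie[OF nij], of \<phi>] by blast
  have neg: "h (- f) = - h f" if "f \<in> Lie" for f
    using scale[OF that, of "- 1"] by simp
  have diff: "h (f - g) = h f - h g" if "f \<in> Lie" "g \<in> Lie" for f g
    using add[of f "- g"] neg[OF that(2)] opoly.subspace_neg[OF subspace_Lie that(2)] that by simp
  have zero: "h 0 = 0" using scale[of 0 0] by (simp add: Lie_closed)
  let ?K = "{f \<in> Lie. h f = 0}"
  have "lie_ideal ?K" unfolding lie_ideal_def opoly.subspace_def
    by (auto simp: Lie_closed add scale br P zero linear_zero[OF l.P_linear])
  moreover have "S_N \<subseteq> ?K"
  proof
    fix s :: "('x, 'k) opoly" assume "s \<in> S_N"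
    then obtain u v where s: "s = fN u v" by (auto simp: S_N_def)
    have sL: "s \<in> Lie" by (rule subsetD[OF S_N_subset_Lie]) fact
    have L: "LS u \<in> (Lie :: ('x, 'k) opoly set)" "LS v \<in> (Lie :: ('x, 'k) opoly set)"
      by (simp_all add: LS_in_Lie)
    then have "h s = 0" using l.nijenhuis[of "h (LS u)" "h (LS v)"]
      unfolding s fN_def by (simp add: add diff br P Lie_closed opoly.subspace_diff[OF subspace_Lie])
    then show "s \<in> ?K" using sL by simp
  qed
  ultimately have Id: "Id_Lie S_N \<subseteq> ?K" unfolding Id_Lie_def by (intro hull_minimal)
  define h' where "h' x = h (rep_NL x)" for x
  have h': "h' (nl_class f) = h f" if "f \<in> Lie" for f
  proof -
    have "rep_NL (nl_class f) - f \<in> Id_Lie S_N"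
      using nl_class_eq_iff[of "rep_NL (nl_class f)" f] rep_NL that by blast
    then have "h (rep_NL (nl_class f) - f) = 0" using Id by blast
    then show ?thesis
      using diff[OF rep_NL(1) that, of "nl_class f"] by (simp add: h'_def)
  qed
  have lin: "h' (x + y) = h' x + h' y" "h' (nl_scale c x) = scale c (h' x)" "h' (nl_br x y) = br (h' x) (h' y)"
    "h' (nl_P x) = P (h' x)" for x y c
  proof -
    obtain f where f: "f \<in> Lie" "x = nl_class f" by (rule nl_cases)
    obtain g where g: "g \<in> Lie" "y = nl_class g" by (rule nl_cases)
    show "h' (x + y) = h' x + h' y" "h' (nl_scale c x) = scale c (h' x)" "h' (nl_br x y) = br (h' x) (h' y)"
      "h' (nl_P x) = P (h' x)"
      using f g by (simp_all add: nl_class_simps h' add scale br P)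
  qed
  have "nijenhuis_hom nl_scale nl_br nl_P scale br P h'"
    unfolding nijenhuis_hom_def Vector_Spaces.linear_iff
    by (simp add: lin vector_space_nl l.vector_space_axioms)
  moreover have "\<forall>x. h' (nl_class (gen x)) = \<phi> x" by (simp add: h' gen gen_in_Lie)
  ultimately show ?thesis by blast
qed

lemma NL_hom_unique:
  fixes h h' :: "('x::wellorder, 'k::field) NL \<Rightarrow> 'l::ab_group_add"
  assumes h: "nijenhuis_hom nl_scale nl_br nl_P scale br P h"
    and h': "nijenhuis_hom nl_scale nl_br nl_P scale br P h'"
    and gen: "\<And>x. h (nl_class (gen x)) = h' (nl_class (gen x))"
  shows "h = h'"
proof
  fix x
  let ?A = "{f \<in> Lie. h (nl_class f) = h' (nl_class f)}"
  have lin: "Vector_Spaces.linear nl_scale scale h" "Vector_Spaces.linear nl_scale scale h'"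
    using h h' by (simp_all add: nijenhuis_hom_def)
  have "lie_subalgebra ?A"
    using h h' unfolding lie_subalgebra_def opoly.subspace_def nijenhuis_hom_def
    by (auto simp: Lie_closed nl_class_zero nl_class_add nl_class_scale nl_class_br nl_class_P
        linear_zero[OF lin(1)] linear_zero[OF lin(2)] linear_add[OF lin(1)] linear_add[OF lin(2)]
        linear_scale[OF lin(1)] linear_scale[OF lin(2)])
  moreover have "range gen \<subseteq> ?A" using gen by (auto simp: gen_in_Lie)
  ultimately have "Lie \<subseteq> ?A" unfolding Lie_def by (intro hull_minimal)
  then show "h x = h' x" using rep_NL[of x] by force
qed

section \<open>A Poincare--Birkhoff--Witt theorem for free products\<close>

definition lin_ext :: "('y oword \<Rightarrow> ('y, 'k::field) opoly) \<Rightarrow> ('y, 'k) opoly \<Rightarrow> ('y, 'k) opoly" where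
  "lin_ext F f = (\<Sum>w\<in>supp f. scal (coeff f w) (F w))"

lemma lin_ext_superset:
  assumes "finite A" "supp f \<subseteq> A"
  shows "lin_ext F f = (\<Sum>w\<in>A. scal (coeff f w) (F w))"
  unfolding lin_ext_def using assms by (intro sum.mono_neutral_left) (auto simp: in_keys_iff)

lemma lin_ext_add: "lin_ext F (f + g) = lin_ext F f + lin_ext F g"
proof -
  let ?A = "supp f \<union> supp g \<union> supp (f + g)"
  show ?thesis
    by (subst (1 2 3) lin_ext_superset[of ?A]) (auto simp: lookup_add opoly.scale_left_distrib sum.distrib)
qed

lemma lin_ext_scal: "lin_ext F (scal c f) = scal c (lin_ext F f)"
  by (subst (1 2) lin_ext_superset[of "supp f"])
    (auto simp: keys_scal lookup_scal scal_sum)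

lemma lin_ext_single: "lin_ext F (mon w 1) = F w"
  by (simp add: lin_ext_def)

lemma linear_lin_ext: "Vector_Spaces.linear scal scal (lin_ext F)"
  by (simp add: Vector_Spaces.linear_iff vector_space_scal lin_ext_add lin_ext_scal)

lemmas lin_ext_linear = lin_ext_add lin_ext_scal

lemmas lin_ext_zero = linear_zero[OF linear_lin_ext] and lin_ext_diff = linear_diff[OF linear_lin_ext]
  and lin_ext_uminus = linear_neg[OF linear_lin_ext] and lin_ext_sum = linear_sum[OF linear_lin_ext]

abbreviation word :: "'y oword \<Rightarrow> ('y, 'k::field) opoly" where
  "word w \<equiv> mon w 1"

lemma word_Nil: "word [] = 1"
  by (metis single_one zero_list_def)

lemma word_mult: "word u * word v = word (u @ v)"
  by (simp add: mult_single plus_list_def)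

text \<open>Words over letters among which the \<open>enc b\<close>, for \<open>b\<close> in an ordered basis \<open>B\<close> of a Lie algebra, are
  subject to the relations \<open>bc = cb + [b, c]\<close>. Other letters satisfy no relations, so that this
  is the enveloping algebra of the free product of the given and a free Lie algebra.\<close>

locale pbw = lie_algebra scale br
  for scale :: "'k::field \<Rightarrow> 'm::ab_group_add \<Rightarrow> 'm" and br :: "'m \<Rightarrow> 'm \<Rightarrow> 'm" +
  fixes B :: "'m set" and lt :: "'m \<Rightarrow> 'm \<Rightarrow> bool" and enc :: "'m \<Rightarrow> 'y oprime"
  assumes independent_B: "independent B" and span_B: "span B = UNIV"
    and inj_enc: "inj_on enc B"
    and lt_irrefl: "b \<in> B \<Longrightarrow> \<not> lt b b"
    and lt_trans: "b \<in> B \<Longrightarrow> c \<in> B \<Longrightarrow> d \<in> B \<Longrightarrow> lt b c \<Longrightarrow> lt c d \<Longrightarrow> lt b d"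
    and lt_total: "b \<in> B \<Longrightarrow> c \<in> B \<Longrightarrow> b \<noteq> c \<Longrightarrow> lt b c \<or> lt c b"
begin

sublocale vs_pair: vector_space_pair scale "scal :: 'k \<Rightarrow> ('y, 'k) opoly \<Rightarrow> ('y, 'k) opoly"
  by (intro vector_space_pair.intro vector_space_axioms vector_space_scal)

definition incl :: "'m \<Rightarrow> ('y, 'k) opoly" where
  "incl = vs_pair.construct B (\<lambda>b. word [enc b])"

lemma linear_incl: "Vector_Spaces.linear scale scal incl"
  unfolding incl_def by (rule vs_pair.linear_construct[OF independent_B])

lemma incl_basis: "b \<in> B \<Longrightarrow> incl b = word [enc b]"
  unfolding incl_def by (rule vs_pair.construct_basis[OF independent_B])

lemmas incl_simps = linear_add[OF linear_incl] linear_scale[OF linear_incl] linear_zero[OF linear_incl]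
  linear_neg[OF linear_incl] linear_diff[OF linear_incl]

lemmas pbw_simps = incl_simps incl_basis opoly_bilinear lin_ext_linear

lemma incl_sum: "incl m = (\<Sum>b | representation B m b \<noteq> 0. scal (representation B m b) (word [enc b]))"
proof -
  have m: "m \<in> span B" by (simp add: span_B)
  have "incl m = (\<Sum>b | representation B m b \<noteq> 0. incl (scale (representation B m b) b))"
    using sum_nonzero_representation_eq[OF independent_B m] linear_sum[OF linear_incl]
    by metis
  also have "\<dots> = (\<Sum>b | representation B m b \<noteq> 0. scal (representation B m b) (word [enc b]))"
    using representation_ne_zero[of B m] by (intro sum.cong) (auto simp: incl_simps incl_basis)
  finally show ?thesis .
qed

lemma basis_induct [case_names zero basis]:
  assumes "h 0" and "\<And>c b m. b \<in> B \<Longrightarrow> h m \<Longrightarrow> h (scale c b + m)"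
  shows "h m"
proof -
  have "m \<in> span B" by (simp add: span_B)
  then show ?thesis
    by (induction rule: span_induct_alt) (use assms in auto)
qed

section \<open>Rewriting of words to a normal form without descents\<close>

definition descends :: "'y oprime \<Rightarrow> 'y oprime \<Rightarrow> bool" where
  "descends p q \<longleftrightarrow> (\<exists>b\<in>B. \<exists>c\<in>B. p = enc b \<and> q = enc c \<and> lt c b)"

lemma descends_enc: "b \<in> B \<Longrightarrow> c \<in> B \<Longrightarrow> descends (enc b) (enc c) \<longleftrightarrow> lt c b"
  using inj_enc by (auto simp: descends_def dest: inj_onD)

lemma descends_asym: "descends p q \<Longrightarrow> \<not> descends q p"
  using lt_trans lt_irrefl by (metis descends_def descends_enc)

lemma descends_trans: "descends p q \<Longrightarrow> descends q r \<Longrightarrow> descends p r"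
  using lt_trans by (metis descends_def descends_enc)

primrec inversions :: "'y oword \<Rightarrow> nat" where
  "inversions [] = 0"
| "inversions (p # w) = length (filter (descends p) w) + inversions w"

lemma inversions_swap:
  assumes "descends p q"
  shows "inversions (a @ q # p # d) < inversions (a @ p # q # d)"
proof (induction a)
  case Nil
  then show ?case
    using assms descends_asym[OF assms] by simp
next
  case (Cons r a)
  have "length (filter (descends r) (a @ q # p # d)) = length (filter (descends r) (a @ p # q # d))"
    by simp
  then show ?case
    using Cons by simp
qed

definition descent :: "'y oword \<Rightarrow> 'y oword \<Rightarrow> 'm \<Rightarrow> 'm \<Rightarrow> 'y oword \<Rightarrow> bool" where
  "descent w a b c d \<longleftrightarrow> w = a @ enc b # enc c # d \<and> b \<in> B \<and> c \<in> B \<and> lt c b"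

definition some_descent :: "'y oword \<Rightarrow> 'y oword \<times> 'm \<times> 'm \<times> 'y oword" where
  "some_descent w = (SOME (a, b, c, d). descent w a b c d)"

lemma some_descent: "\<exists>a b c d. descent w a b c d \<Longrightarrow> some_descent w = (a, b, c, d) \<Longrightarrow> descent w a b c d"
  using someI_ex[of "\<lambda>(a, b, c, d). descent w a b c d"] by (auto simp: some_descent_def)

text \<open>The descent is picked by choice to obtain a function at once; that every descent gives
  the same result is the content of \<open>confluent\<close>. A swap keeps the length and lowers the
  number of inversions, and a bracket term has one letter fewer.\<close>

function NF :: "'y oword \<Rightarrow> ('y, 'k) opoly" where
  "NF w = (if \<exists>a b c d. descent w a b c d then
     (case some_descent w of (a, b, c, d) \<Rightarrow> NF (a @ enc c # enc b # d) +
       (\<Sum>e | representation B (br b c) e \<noteq> 0. scal (representation B (br b c) e) (NF (a @ enc e # d))))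
     else word w)"
  by auto
termination
proof (relation "measures [length, inversions]")
  fix w a b c d and y z
  assume "\<exists>a b c d. descent w a b c d" "(a, y) = some_descent w" "(b, z) = y" "(c, d) = z"
  then have "descent w a b c d" by (intro some_descent) auto
  then show "(a @ enc c # enc b # d, w) \<in> measures [length, inversions]"
    using inversions_swap[of "enc b" "enc c" a d] by (auto simp: descent_def descends_enc)
next
  fix w a b c d and y z e
  assume "\<exists>a b c d. descent w a b c d" "(a, y) = some_descent w" "(b, z) = y" "(c, d) = z"
  then have "descent w a b c d" by (intro some_descent) auto
  then show "(a @ enc e # d, w) \<in> measures [length, inversions]" by (auto simp: descent_def)
qed simp

declare NF.simps [simp del]

abbreviation NFl :: "('y, 'k) opoly \<Rightarrow> ('y, 'k) opoly" where
  "NFl \<equiv> lin_ext NF"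

lemma NF_no_descent:
  assumes "\<nexists>a b c d. descent w a b c d"
  shows "NF w = word w"
  by (subst NF.simps) (rule if_not_P[OF assms])

definition rewrite :: "'y oword \<Rightarrow> 'm \<Rightarrow> 'm \<Rightarrow> 'y oword \<Rightarrow> ('y, 'k) opoly" where
  "rewrite a b c d = NF (a @ enc c # enc b # d) + NFl (word a * incl (br b c) * word d)"

lemma sum_enc: "(\<Sum>e | representation B m e \<noteq> 0. scal (representation B m e) (NF (a @ enc e # d))) =
    NFl (word a * incl m * word d)"
proof -
  have "word a * incl m * word d = (\<Sum>e | representation B m e \<noteq> 0. scal (representation B m e) (word (a @ enc e # d)))"
    by (simp add: incl_sum[of m] sum_distrib_left sum_distrib_right scal_mult_left[symmetric]
        scal_mult_right[symmetric] word_mult)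
  then show ?thesis
    by (simp add: lin_ext_sum lin_ext_scal lin_ext_single)
qed

lemma NF_some_descent:
  assumes "descent w a b c d"
  obtains a' b' c' d' where "descent w a' b' c' d'" "NF w = rewrite a' b' c' d'"
proof -
  obtain a' b' c' d' where s: "some_descent w = (a', b', c', d')" using prod_cases4 by blast
  have "descent w a' b' c' d'" using some_descent[OF _ s] assms by blast
  moreover have "NF w = rewrite a' b' c' d'"
    using assms by (subst NF.simps) (auto simp: s sum_enc rewrite_def)
  ultimately show thesis by (rule that)
qed

section \<open>Confluence of the rewriting\<close>

definition relator :: "'m \<Rightarrow> 'm \<Rightarrow> ('y, 'k) opoly" where
  "relator m n = incl m * incl n - incl n * incl m - incl (br m n)"

lemma relator_antisym: "relator m n = - relator n m"
  by (simp add: relator_def br_antisym[of m n] incl_simps)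

lemma relator_linear: "relator (scale k b + m) n = scal k (relator b n) + relator m n"
  by (simp add: relator_def incl_simps br_add_left br_scale_left opoly_bilinear opoly.scale_right_diff_distrib)

lemma relator_zero: "relator 0 n = 0"
  by (simp add: relator_def incl_simps)

definition confluent :: "'y oword \<Rightarrow> bool" where
  "confluent w \<longleftrightarrow> (\<forall>a b c d. descent w a b c d \<longrightarrow> NF w = rewrite a b c d)"

lemma confluentD:
  "confluent (a @ enc b # enc c # d) \<Longrightarrow> b \<in> B \<Longrightarrow> c \<in> B \<Longrightarrow> lt c b \<Longrightarrow>
    NF (a @ enc b # enc c # d) = rewrite a b c d"
  by (auto simp: confluent_def descent_def)

text \<open>For basis vectors in descending order this is confluence of a single word; antisymmetry
  and linearity give all \<open>m\<close> and \<open>m'\<close>. Confluence is assumed for shorter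
  words only, so that the lemma is available within the induction that proves it.\<close>

lemma NFl_relator:
  assumes conf: "\<And>w. length w < n \<Longrightarrow> confluent w" and len: "length a + length d + 2 < n"
  shows "NFl (word a * relator m m' * word d) = 0"
proof -
  have lt: "NFl (word a * relator b c * word d) = 0" if bc: "b \<in> B" "c \<in> B" "lt c b" for b c
  proof -
    have "NF (a @ enc b # enc c # d) = rewrite a b c d"
      using bc len by (intro confluentD conf) auto
    then have "NFl (word a * (incl b * incl c) * word d) =
        NFl (word a * (incl c * incl b) * word d) + NFl (word a * incl (br b c) * word d)"
      using bc by (simp add: incl_basis word_mult lin_ext_single rewrite_def)
    then show ?thesis
      by (simp add: relator_def algebra_simps lin_ext_diff lin_ext_add)
  qed
  have basic: "NFl (word a * relator b c * word d) = 0" if bc: "b \<in> B" "c \<in> B" for b c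
  proof -
    consider "b = c" | "lt c b" | "lt b c"
      using lt_total[OF bc] by blast
    then show ?thesis
    proof cases
      case 1
      then show ?thesis
        by (simp add: relator_def br_self incl_simps lin_ext_zero)
    next
      case 3
      then show ?thesis
        using lt[of c b] bc by (subst relator_antisym) (simp add: lin_ext_uminus)
    qed (use lt bc in blast)
  qed
  have step: "NFl (word a * relator m c * word d) = 0" if "c \<in> B" for m c
  proof (induction m rule: basis_induct)
    case (basis k b m)
    then show ?case
      using basic[OF basis(1) that] by (simp add: relator_linear opoly_bilinear lin_ext_linear)
  qed (simp add: relator_zero lin_ext_zero)
  have "NFl (word a * relator m' m * word d) = 0"
  proof (induction m' rule: basis_induct)
    case (basis k b m')
    have "NFl (word a * relator b m * word d) = 0"
      using step[OF basis(1), of m] by (subst relator_antisym) (simp add: lin_ext_uminus)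
    then show ?case
      using basis by (simp add: relator_linear opoly_bilinear lin_ext_linear)
  qed (simp add: relator_zero lin_ext_zero)
  then show ?thesis
    by (subst relator_antisym) (simp add: lin_ext_uminus)
qed

text \<open>Overlapping descents: the two reductions of \<open>bce\<close> differ by the Jacobi identity.\<close>

lemma confluent_overlap:
  assumes IH: "\<And>w'. (w', w) \<in> measures [length, inversions] \<Longrightarrow> confluent w'"
    and w: "w = a @ enc b # enc c # enc e # d" and B: "b \<in> B" "c \<in> B" "e \<in> B" and lt: "lt c b" "lt e c"
  shows "rewrite a b c (enc e # d) = rewrite (a @ [enc b]) c e d"
proof -
  have be: "lt e b" using lt_trans B lt by blast
  let ?N = "\<lambda>x. NFl (word a * x * word d)"
  \<comment> \<open>Both reductions of \<open>bce\<close> are carried on to the common word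
    \<open>ecb\<close>: one through \<open>cbe\<close> and \<open>ceb\<close>, the other through
    \<open>bec\<close> and \<open>ebc\<close>. The induction hypothesis allows prescribing the
    descent at each of these four words.\<close>
  have 1: "(a @ enc c # enc b # enc e # d, w) \<in> measures [length, inversions]"
    using inversions_swap[of "enc b" "enc c" a "enc e # d"] B lt by (simp add: w descends_enc)
  have 2: "(a @ enc b # enc e # enc c # d, w) \<in> measures [length, inversions]"
    using inversions_swap[of "enc c" "enc e" "a @ [enc b]" d] B lt by (simp add: w descends_enc)
  have 3: "(a @ enc c # enc e # enc b # d, w) \<in> measures [length, inversions]"
    using 1 inversions_swap[of "enc b" "enc e" "a @ [enc c]" d] B be by (simp add: w descends_enc)
  have 4: "(a @ enc e # enc b # enc c # d, w) \<in> measures [length, inversions]"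
    using 2 inversions_swap[of "enc b" "enc e" a "enc c # d"] B be by (simp add: w descends_enc)
  have n1: "NF (a @ enc c # enc b # enc e # d) =
      NF (a @ enc c # enc e # enc b # d) + ?N (incl c * incl (br b e))"
    using confluentD[of "a @ [enc c]" b e d] IH[OF 1] B be
    by (simp add: rewrite_def incl_basis mult.assoc word_mult) (simp add: mult.assoc[symmetric] word_mult)
  have n2: "NF (a @ enc c # enc e # enc b # d) =
      NF (a @ enc e # enc c # enc b # d) + ?N (incl (br c e) * incl b)"
    using confluentD[of a c e "enc b # d"] IH[OF 3] B lt
    by (simp add: rewrite_def incl_basis mult.assoc word_mult)
  have n3: "NF (a @ enc b # enc e # enc c # d) =
      NF (a @ enc e # enc b # enc c # d) + ?N (incl (br b e) * incl c)"
    using confluentD[of a b e "enc c # d"] IH[OF 2] B be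
    by (simp add: rewrite_def incl_basis mult.assoc word_mult)
  have n4: "NF (a @ enc e # enc b # enc c # d) =
      NF (a @ enc e # enc c # enc b # d) + ?N (incl e * incl (br b c))"
    using confluentD[of "a @ [enc e]" b c d] IH[OF 4] B lt
    by (simp add: rewrite_def incl_basis mult.assoc word_mult) (simp add: mult.assoc[symmetric] word_mult)
  have l: "rewrite a b c (enc e # d) = NF (a @ enc c # enc b # enc e # d) + ?N (incl (br b c) * incl e)"
    using B by (simp add: rewrite_def incl_basis mult.assoc word_mult)
  have r: "rewrite (a @ [enc b]) c e d = NF (a @ enc b # enc e # enc c # d) + ?N (incl b * incl (br c e))"
    using B by (simp add: rewrite_def incl_basis mult.assoc word_mult) (simp add: mult.assoc[symmetric] word_mult)
  have rel: "?N (relator m m') = 0" for m m'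
  proof (rule NFl_relator[where n = "length w"])
    show "confluent w'" if "length w' < length w" for w'
      using that by (intro IH) simp
  qed (simp add: w)
  have jac: "br (br b c) e + br c (br b e) + br (br c e) b = 0"
    using br_jacobi_left[of b c e] br_antisym[of c "br b e"] br_antisym[of b "br c e"] by simp
  \<comment> \<open>The bracket terms collected on the two ways differ by three relators and the
    Jacobi sum. The relators stand in a context with one letter fewer than \<open>w\<close>, so they
    vanish under \<open>NFl\<close>.\<close>
  have "incl (br b c) * incl e - incl e * incl (br b c) + (incl c * incl (br b e) - incl (br b e) * incl c)
      + (incl (br c e) * incl b - incl b * incl (br c e)) =
    relator (br b c) e + relator c (br b e) + relator (br c e) b +
      incl (br (br b c) e + br c (br b e) + br (br c e) b)"
    by (simp add: relator_def incl_simps)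
  then have "?N (incl (br b c) * incl e - incl e * incl (br b c) + (incl c * incl (br b e) - incl (br b e) * incl c)
      + (incl (br c e) * incl b - incl b * incl (br c e))) = 0"
    by (simp add: jac incl_simps distrib_left distrib_right lin_ext_add rel)
  then show ?thesis
    unfolding l r n1 n2 n3 n4 by (simp add: algebra_simps lin_ext_add lin_ext_diff)
qed

text \<open>After either reduction the other one is still possible. What remains is the bracket of
  one pair next to the relator of the other, in words with one letter fewer than \<open>w\<close>,
  and such relators vanish by \<open>NFl_relator\<close>.\<close>

lemma confluent_disjoint:
  assumes IH: "\<And>w'. (w', w) \<in> measures [length, inversions] \<Longrightarrow> confluent w'"
    and w: "w = a @ enc b # enc c # x @ enc b' # enc c' # d"
    and B: "b \<in> B" "c \<in> B" "b' \<in> B" "c' \<in> B" and lt: "lt c b" "lt c' b'"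
  shows "rewrite a b c (x @ enc b' # enc c' # d) = rewrite (a @ enc b # enc c # x) b' c' d"
proof -
  have rel: "NFl (word u * relator m m' * word v) = 0" if "length u + length v + 2 < length w" for u v m m'
  proof (rule NFl_relator[where n = "length w"])
    show "confluent w'" if "length w' < length w" for w'
      using that by (intro IH) simp
  qed (use that in simp)
  have 1: "NFl (word a * incl m * word x * relator b' c' * word d) = 0" for m
  proof (induction m rule: basis_induct)
    case (basis k f m)
    then show ?case
      using rel[of "a @ enc f # x" d b' c'] by (simp add: pbw_simps word_mult w)
  qed (simp add: incl_simps lin_ext_zero)
  have 2: "NFl (word a * relator b c * word x * incl m * word d) = 0" for m
  proof (induction m rule: basis_induct)
    case (basis k f m)
    have "word a * relator b c * word x * word [enc f] * word d = word a * relator b c * word (x @ enc f # d)"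
      by (simp add: mult.assoc word_mult)
    then show ?case
      using rel[of a "x @ enc f # d" b c] basis by (simp add: pbw_simps w)
  qed (simp add: incl_simps lin_ext_zero)
  have s1: "(a @ enc c # enc b # x @ enc b' # enc c' # d, w) \<in> measures [length, inversions]"
    using inversions_swap[of "enc b" "enc c" a "x @ enc b' # enc c' # d"] B lt by (simp add: w descends_enc)
  have s2: "(a @ enc b # enc c # x @ enc c' # enc b' # d, w) \<in> measures [length, inversions]"
    using inversions_swap[of "enc b'" "enc c'" "a @ enc b # enc c # x" d] B lt by (simp add: w descends_enc)
  have n1: "NF (a @ enc c # enc b # x @ enc b' # enc c' # d) = NF (a @ enc c # enc b # x @ enc c' # enc b' # d) +
      NFl (word a * (incl c * incl b) * word x * incl (br b' c') * word d)"
    using confluentD[of "a @ enc c # enc b # x" b' c' d] IH[OF s1] B lt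
    by (simp add: rewrite_def incl_basis word_mult)
  have n2: "NF (a @ enc b # enc c # x @ enc c' # enc b' # d) = NF (a @ enc c # enc b # x @ enc c' # enc b' # d) +
      NFl (word a * incl (br b c) * word x * (incl c' * incl b') * word d)"
    using confluentD[of a b c "x @ enc c' # enc b' # d"] IH[OF s2] B lt
    by (simp add: rewrite_def incl_basis word_mult mult.assoc)
  have l: "rewrite a b c (x @ enc b' # enc c' # d) = NF (a @ enc c # enc b # x @ enc b' # enc c' # d) +
      NFl (word a * incl (br b c) * word x * (incl b' * incl c') * word d)"
    using B by (simp add: rewrite_def incl_basis word_mult mult.assoc)
  have r: "rewrite (a @ enc b # enc c # x) b' c' d = NF (a @ enc b # enc c # x @ enc c' # enc b' # d) +
      NFl (word a * (incl b * incl c) * word x * incl (br b' c') * word d)"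
    using B by (simp add: rewrite_def incl_basis word_mult)
  have "rewrite a b c (x @ enc b' # enc c' # d) - rewrite (a @ enc b # enc c # x) b' c' d =
      NFl (word a * incl (br b c) * word x * relator b' c' * word d) -
      NFl (word a * relator b c * word x * incl (br b' c') * word d)"
    unfolding l r n1 n2 relator_def by (simp add: algebra_simps lin_ext_add lin_ext_diff)
  then show ?thesis
    using 1 2 by simp
qed

text \<open>Two descents of the same word coincide, share one letter, or are disjoint; the last two
  cases are settled by the preceding lemmas.\<close>

lemma confluent: "confluent w"
proof (induction w rule: wf_induct[OF wf_measures[of "[length, inversions]"]])
  case (1 w)
  then have IH: "\<And>w'. (w', w) \<in> measures [length, inversions] \<Longrightarrow> confluent w'" by blast
  have *: "rewrite a b c d = rewrite a' b' c' d'"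
    if D: "descent w a b c d" "descent w a' b' c' d'" and l: "length a < length a'" for a b c d a' b' c' d'
  proof -
    have eq: "a @ enc b # enc c # d = a' @ enc b' # enc c' # d'" and B: "b \<in> B" "c \<in> B" "b' \<in> B" "c' \<in> B"
      and lt: "lt c b" "lt c' b'" and w: "w = a @ enc b # enc c # d"
      using D by (simp_all add: descent_def)
    from eq l obtain u where u: "a' = a @ u" "enc b # enc c # d = u @ enc b' # enc c' # d'" "u \<noteq> []"
      by (auto simp: append_eq_append_conv2)
    then obtain u' where u': "u = enc b # u'" "enc c # d = u' @ enc b' # enc c' # d'"
      by (cases u) auto
    show ?thesis
    proof (cases u')
      case Nil
      then have "c = b'" "d = enc c' # d'" using u' B inj_enc by (auto dest: inj_onD)
      then show ?thesis
        using confluent_overlap[OF IH, where a = a and b = b and c = c and e = c' and d = d'] w B lt u u' Nil by simp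
    next
      case (Cons q x)
      then have "q = enc c" "d = x @ enc b' # enc c' # d'" using u' by auto
      then show ?thesis
        using confluent_disjoint[OF IH, where a = a and b = b and c = c and x = x and b' = b' and c' = c' and d = d'] w B lt u u' Cons by simp
    qed
  qed
  have **: "rewrite a b c d = rewrite a' b' c' d'"
    if D: "descent w a b c d" "descent w a' b' c' d'" for a b c d a' b' c' d'
  proof -
    consider "length a < length a'" | "length a' < length a" | "length a = length a'"
      by linarith
    then show ?thesis
    proof cases
      case 3
      then have "a = a'" "b = b'" "c = c'" "d = d'"
        using D inj_enc by (auto simp: descent_def dest: inj_onD)
      then show ?thesis by simp
    qed (use * D in metis)+
  qed
  show ?case
    unfolding confluent_def
  proof (intro allI impI)
    fix a b c d assume D: "descent w a b c d"
    obtain a' b' c' d' where "descent w a' b' c' d'" "NF w = rewrite a' b' c' d'"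
      using NF_some_descent[OF D] by blast
    then show "NF w = rewrite a b c d" using ** D by metis
  qed
qed

lemma NF_descent: "descent w a b c d \<Longrightarrow> NF w = rewrite a b c d"
  using confluent unfolding confluent_def by blast

lemma NFl_relator_all: "NFl (word a * relator m n * word d) = 0"
  using NFl_relator[of "length a + length d + 3"] confluent by simp

text \<open>A reduction step inside \<open>w\<close> is also one of \<open>a @ w @ d\<close>, and by
  confluence the normal form of the latter may be computed starting with it.\<close>

lemma NF_absorb: "NFl (word a * NF w * word d) = NF (a @ w @ d)"
proof (induction w rule: wf_induct[OF wf_measures[of "[length, inversions]"]])
  case (1 w)
  then have IH: "\<And>w'. (w', w) \<in> measures [length, inversions] \<Longrightarrow> NFl (word a * NF w' * word d) = NF (a @ w' @ d)"
    by blast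
  show ?case
  proof (cases "\<exists>u b c v. descent w u b c v")
    case False
    then show ?thesis
      by (simp add: NF_no_descent word_mult lin_ext_single)
  next
    case True
    then obtain u b c v where D: "descent w u b c v" by blast
    then have w: "w = u @ enc b # enc c # v" and bc: "b \<in> B" "c \<in> B" "lt c b"
      by (simp_all add: descent_def)
    have "NFl (word a * NF (u @ enc c # enc b # v) * word d) = NF (a @ (u @ enc c # enc b # v) @ d)"
      using inversions_swap[of "enc b" "enc c" u v] bc by (intro IH) (simp add: w descends_enc)
    moreover have "NFl (word a * NFl (word u * incl m * word v) * word d) = NFl (word (a @ u) * incl m * word (v @ d))" for m
    proof (induction m rule: basis_induct)
      case (basis k e m)
      have "NFl (word a * NF (u @ enc e # v) * word d) = NF (a @ (u @ enc e # v) @ d)"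
        by (intro IH) (simp add: w)
      then show ?case
        using basis by (simp add: pbw_simps word_mult lin_ext_single)
    qed (simp add: incl_simps lin_ext_zero)
    moreover have "NF (a @ w @ d) = rewrite (a @ u) b c (v @ d)"
      using bc by (intro NF_descent) (simp add: descent_def w)
    ultimately show ?thesis
      unfolding NF_descent[OF D] rewrite_def by (simp add: distrib_left distrib_right lin_ext_add)
  qed
qed

lemma NFl_absorb: "NFl (f * NFl g * h) = NFl (f * g * h)"
proof (induction f rule: opoly_induct)
  case (single a)
  show ?case
  proof (induction h rule: opoly_induct)
    case (single d)
    show ?case
    proof (induction g rule: opoly_induct)
      case (single w)
      then show ?case
        by (simp add: lin_ext_single NF_absorb word_mult)
    next
      case (add c f g)
      then show ?case
        by (simp add: lin_ext_linear opoly_bilinear)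
    qed (simp add: lin_ext_zero)
  next
    case (add c f g)
    then show ?case
      by (simp add: lin_ext_linear opoly_bilinear)
  qed (simp add: lin_ext_zero)
next
  case (add c f f')
  then show ?case
    by (simp add: lin_ext_linear opoly_bilinear)
qed (simp add: lin_ext_zero)

lemma NFl_comm: "NFl (comm (NFl f) g) = NFl (comm f g)" "NFl (comm f (NFl g)) = NFl (comm f g)"
proof -
  have "NFl (NFl f * g) = NFl (f * g)" "NFl (g * NFl f) = NFl (g * f)" for f g
    using NFl_absorb[of 1 f g] NFl_absorb[of g f 1] by simp_all
  then show "NFl (comm (NFl f) g) = NFl (comm f g)" "NFl (comm f (NFl g)) = NFl (comm f g)"
    by (simp_all add: comm_def lin_ext_diff)
qed

lemma NFl_incl: "NFl (incl m) = incl m"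
proof (induction m rule: basis_induct)
  case (basis k b m)
  have "NF [enc b] = word [enc b]"
    by (rule NF_no_descent) (auto simp: descent_def append_eq_Cons_conv Cons_eq_append_conv)
  then show ?case
    using basis by (simp add: incl_simps incl_basis lin_ext_linear lin_ext_single)
qed (simp add: incl_simps lin_ext_zero)

lemma NFl_comm_incl: "NFl (comm (incl m) (incl n)) = incl (br m n)"
proof -
  have "comm (incl m) (incl n) = word [] * relator m n * word [] + incl (br m n)"
    by (simp add: relator_def comm_def word_Nil)
  then show ?thesis
    using NFl_relator_all[of "[]" m n "[]"] by (simp add: lin_ext_add NFl_incl)
qed

text \<open>This is the commutator of the enveloping algebra in terms of normal forms. The carrier
  is the whole space of polynomials, which avoids a type of normal forms; the Jacobi identity still
  holds as inner normalizations are absorbed.\<close>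

lemma lie_algebra_NFl: "lie_algebra scal (\<lambda>f g. NFl (comm f g))"
proof (rule lie_algebra.intro[OF vector_space_scal lie_algebra_axioms.intro])
  fix f g h :: "('y, 'k) opoly"
  show "Vector_Spaces.linear scal scal (\<lambda>f. NFl (comm f g))" "Vector_Spaces.linear scal scal (\<lambda>h. NFl (comm g h))"
    by (simp_all add: Vector_Spaces.linear_iff vector_space_scal opoly.br_add_left opoly.br_add_right
        opoly.br_scale_left opoly.br_scale_right lin_ext_linear)
  show "NFl (comm f f) = 0" by (simp add: opoly.br_self lin_ext_zero)
  show "NFl (comm f (NFl (comm g h))) + NFl (comm g (NFl (comm h f))) + NFl (comm h (NFl (comm f g))) = 0"
    by (simp add: NFl_comm lin_ext_add[symmetric] opoly.jacobi lin_ext_zero)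
qed

text \<open>Swaps permute the letters and put the smaller of two first, which makes the word later
  in the lexicographic order; bracket terms have shorter words. So the part of full length is one
  single word.\<close>

lemma NF_top:
  "\<exists>w'. mset w' = mset w \<and> (w' = w \<or> lex_greater descends w w') \<and>
    (\<forall>v\<in>supp (NF w - word w'). length v < length w)"
proof (induction w rule: wf_induct[OF wf_measures[of "[length, inversions]"]])
  case (1 w)
  show ?case
  proof (cases "\<exists>a b c d. descent w a b c d")
    case False
    then show ?thesis
      by (intro exI[of _ w]) (simp add: NF_no_descent)
  next
    case True
    then obtain a b c d where D: "descent w a b c d" by blast
    then have w: "w = a @ enc b # enc c # d" and bc: "b \<in> B" "c \<in> B" "lt c b"
      by (simp_all add: descent_def)
    have desc: "descends (enc b) (enc c)" using bc by (simp add: descends_enc)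
    let ?s = "a @ enc c # enc b # d"
    have "(?s, w) \<in> measures [length, inversions]"
      using inversions_swap[OF desc] by (simp add: w)
    then obtain w' where w': "mset w' = mset ?s" "w' = ?s \<or> lex_greater descends ?s w'"
      "\<forall>v\<in>supp (NF ?s - word w'). length v < length ?s"
      using 1 by blast
    have "lex_greater descends w ?s"
      unfolding lex_greater_iff_differ lex_differ_def w using desc by blast
    then have lex: "lex_greater descends w w'"
      using w'(2) lexord_trans[of w ?s "{(a, b). descends a b}" w'] descends_trans
      by (auto simp: lex_greater_conv_lexord trans_def)
    have rest: "length v < length w" if "v \<in> supp (NFl (word a * incl m * word d))" for v m
      using that
    proof (induction m arbitrary: v rule: basis_induct)
      case (basis k e m)
      have "length v < length w" if v: "v \<in> supp (NF (a @ enc e # d))" for v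
      proof -
        have "(a @ enc e # d, w) \<in> measures [length, inversions]" by (simp add: w)
        then obtain w'' where w'': "mset w'' = mset (a @ enc e # d)"
          "\<forall>v\<in>supp (NF (a @ enc e # d) - word w''). length v < length (a @ enc e # d)"
          using 1 by blast
        have "v = w'' \<or> v \<in> supp (NF (a @ enc e # d) - word w'')"
          using v by (auto simp: in_keys_iff lookup_minus lookup_single)
        moreover have "length w'' = length (a @ enc e # d)" using w''(1) mset_eq_length by blast
        ultimately show ?thesis
          using w''(2) w by fastforce
      qed
      moreover have "v \<in> supp (NF (a @ enc e # d)) \<or>
          v \<in> supp (NFl (word a * incl m * word d))"
        using basis.prems basis.hyps by (auto simp: pbw_simps word_mult
            lin_ext_single in_keys_iff lookup_add lookup_scal)
      ultimately show ?case
        using basis.IH by blast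
    qed (simp add: incl_simps lin_ext_zero)
    have "NF w - word w' = (NF ?s - word w') + NFl (word a * incl (br b c) * word d)"
      using NF_descent[OF D] by (simp add: rewrite_def)
    then have "supp (NF w - word w') \<subseteq> supp (NF ?s - word w') \<union>
        supp (NFl (word a * incl (br b c) * word d))"
      using Poly_Mapping.keys_add by metis
    moreover have "length ?s = length w" by (simp add: w)
    ultimately have keys: "length v < length w" if "v \<in> supp (NF w - word w')" for v
      using that w'(3) rest[of v "br b c"] by auto
    moreover have "mset w' = mset w" using w'(1) by (simp add: w)
    ultimately show ?thesis
      using lex by (intro exI[of _ w']) blast
  qed
qed

end

section \<open>Linear independence of the irreducible words\<close>

lemma (in vector_space) family_independent:
  assumes ind: "\<And>A r a. finite A \<Longrightarrow> A \<subseteq> I \<Longrightarrow> (\<Sum>a\<in>A. scale (r a) (g a)) = 0 \<Longrightarrow> a \<in> A \<Longrightarrow> r a = 0"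
  shows "inj_on g I" "independent (g ` I)"
proof -
  show inj: "inj_on g I"
  proof (rule inj_onI, rule ccontr)
    fix a b assume ab: "a \<in> I" "b \<in> I" "g a = g b" "a \<noteq> b"
    then have "(\<Sum>x\<in>{a, b}. scale (if x = a then 1 else - 1) (g x)) = 0" by simp
    then have "(if a = a then 1 else - 1 :: 'a) = 0"
      using ab by (intro ind[of "{a, b}" "\<lambda>x. if x = a then 1 else - 1" a]) auto
    then show False by simp
  qed
  show "independent (g ` I)" unfolding dependent_explicit
  proof clarify
    fix t u v assume t: "finite t" "t \<subseteq> g ` I" "(\<Sum>v\<in>t. scale (u v) v) = 0" "v \<in> t" "u v \<noteq> 0"
    then obtain A where A: "A \<subseteq> I" "finite A" "t = g ` A" by (meson finite_subset_image)
    then have "(\<Sum>a\<in>A. scale (u (g a)) (g a)) = 0"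
      using t(3) unfolding A(3) sum.reindex[OF inj_on_subset[OF inj A(1)]] by (simp add: comp_def)
    then have "u (g a) = 0" if "a \<in> A" for a
      using ind[OF A(2,1), of "\<lambda>a. u (g a)" a] that by blast
    then show False
      using t A by auto
  qed
qed

section \<open>The deformed bracket\<close>

context nijenhuis_lie_algebra
begin

definition br_P :: "'l \<Rightarrow> 'l \<Rightarrow> 'l" where
  "br_P u v = br (P u) v + br u (P v) - P (br u v)"

lemmas P_simps = linear_add[OF P_linear] linear_diff[OF P_linear] linear_scale[OF P_linear]
  linear_zero[OF P_linear] linear_neg[OF P_linear]

lemma P_br_P: "P (br_P u v) = br (P u) (P v)"
  by (simp add: br_P_def nijenhuis P_simps)

text \<open>In this form the cyclic sum groups into Jacobi sums of the original bracket, with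
  \<open>P\<close> applied to two, one or none of the three arguments. The Nijenhuis identity has
  been used to remove brackets containing \<open>P\<close> of a bracket.\<close>

lemma br_P_br_P: "br_P u (br_P v w) =
    br (P u) (br (P v) w) + br (P u) (br v (P w)) + br u (br (P v) (P w)) -
    P (br (P u) (br v w) + br u (br (P v) w) + br u (br v (P w))) + P (P (br u (br v w)))"
proof -
  have "br_P u (br_P v w) = br (P u) (br_P v w) + br u (br (P v) (P w)) - P (br u (br_P v w))"
    by (simp add: br_P_def[of u] P_br_P)
  moreover have "br (P u) (br_P v w) = br (P u) (br (P v) w) + br (P u) (br v (P w)) -
      (P (br (P u) (br v w)) + P (br u (P (br v w))) - P (P (br u (br v w))))"
    by (simp add: br_P_def br_add_right br_diff_right nijenhuis)
  moreover have "P (br u (br_P v w)) = P (br u (br (P v) w)) + P (br u (br v (P w))) - P (br u (P (br v w)))"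
    by (simp add: br_P_def br_add_right br_diff_right P_simps)
  ultimately show ?thesis
    by (simp add: P_simps)
qed

lemma lie_algebra_br_P: "lie_algebra scale br_P"
proof (rule lie_algebra.intro[OF vector_space_axioms lie_algebra_axioms.intro])
  show "Vector_Spaces.linear scale scale (\<lambda>x. br_P x y)" "Vector_Spaces.linear scale scale (br_P y)" for y
    by (simp_all add: Vector_Spaces.linear_iff vector_space_axioms br_P_def br_add_left br_add_right
        br_scale_left br_scale_right P_simps scale_right_distrib scale_right_diff_distrib)
  show "br_P x x = 0" for x
    using br_antisym[of x "P x"] by (simp add: br_P_def br_self P_simps)
  fix u v w
  let ?J = "\<lambda>x y z. br x (br y z) + br y (br z x) + br z (br x y)"
  have "br_P u (br_P v w) + br_P v (br_P w u) + br_P w (br_P u v) =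
      ?J (P u) (P v) w + ?J (P u) v (P w) + ?J u (P v) (P w) -
      P (?J (P u) v w + ?J u (P v) w + ?J u v (P w)) + P (P (?J u v w))"
    unfolding br_P_br_P by (simp add: P_simps)
  then show "br_P u (br_P v w) + br_P v (br_P w u) + br_P w (br_P u v) = 0"
    by (simp add: jacobi P_simps)
qed

end

interpretation nl: nijenhuis_lie_algebra nl_scale nl_br nl_P
  by (rule nijenhuis_nl)

abbreviation LS_class :: "'x::wellorder oword \<Rightarrow> ('x, 'k::field) NL" where
  "LS_class w \<equiv> nl_class (LS w)"

text \<open>The assumption is the induction hypothesis of the induction on the degree, made a locale
  so that basis, order and representation can be defined from it. The \<open>itself\<close>
  parameter names the type instance when the locale is interpreted.\<close>

locale irr_stage =
  fixes n :: nat and NL_type :: "('x::wellorder, 'k::field) NL itself"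
  assumes stage: "finite A \<Longrightarrow> A \<subseteq> {w \<in> irr_words. odeg w \<le> n} \<Longrightarrow>
    (\<Sum>w\<in>A. nl_scale (r w) (LS_class w :: ('x, 'k) NL)) = 0 \<Longrightarrow> w \<in> A \<Longrightarrow> r w = 0"
begin

abbreviation I :: "'x oword set" where
  "I \<equiv> {w \<in> irr_words. odeg w \<le> n}"

abbreviation K :: "'x oword \<Rightarrow> ('x, 'k) NL" where
  "K \<equiv> LS_class"

lemma inj_K: "inj_on K I" and independent_K: "nl.independent (K ` I)"
  using nl.family_independent[of I K] stage by blast+

definition basis :: "('x, 'k) NL set" where
  "basis = nl.extend_basis (K ` I)"

definition order :: "('x, 'k) NL rel" where
  "order = (SOME R. Well_order R \<and> Field R = UNIV)"

lemma order: "Well_order order" "Field order = UNIV"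
proof -
  have "Well_order order \<and> Field order = UNIV"
    unfolding order_def by (rule someI_ex[OF well_ordering])
  then show "Well_order order" "Field order = UNIV" by (rule conjunct1, rule conjunct2)
qed

definition before :: "('x, 'k) NL \<Rightarrow> ('x, 'k) NL \<Rightarrow> bool" where
  "before c b \<longleftrightarrow> (if c \<in> K ` I then b \<in> K ` I \<longrightarrow> dl_less (inv_into I K c) (inv_into I K b)
     else b \<notin> K ` I \<and> (c, b) \<in> order \<and> c \<noteq> b)"

lemma before_K: "u \<in> I \<Longrightarrow> v \<in> I \<Longrightarrow> before (K v) (K u) \<longleftrightarrow> dl_less v u"
  by (simp add: before_def inv_into_f_f[OF inj_K])

lemma before_in: "c \<in> K ` I \<Longrightarrow>
    before c b \<longleftrightarrow> (b \<in> K ` I \<longrightarrow> dl_less (inv_into I K c) (inv_into I K b))"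
  and before_out: "c \<notin> K ` I \<Longrightarrow> before c b \<longleftrightarrow> b \<notin> K ` I \<and> (c, b) \<in> order \<and> c \<noteq> b"
  by (simp_all only: before_def if_True if_False)

lemma linear_order: "trans order" "antisym order" "total order"
  using order(1) unfolding order_on_defs order(2) by auto

lemma before_trans:
  assumes "before b c" "before c d"
  shows "before b d"
proof (cases "b \<in> K ` I")
  case b: True
  have "dl_less (inv_into I K b) (inv_into I K d)" if d: "d \<in> K ` I"
  proof -
    have c: "c \<in> K ` I" using assms(2) d before_out[of c d] by blast
    show ?thesis
      using assms b c d dl_less_trans unfolding before_in[OF b] before_in[OF c] by blast
  qed
  then show ?thesis
    unfolding before_in[OF b] by blast
next
  case b: False
  then have c: "c \<notin> K ` I" "(b, c) \<in> order" "b \<noteq> c" using assms(1) before_out[OF b] by blast+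
  then have d: "d \<notin> K ` I" "(c, d) \<in> order" "c \<noteq> d" using assms(2) before_out[OF c(1)] by blast+
  have "(b, d) \<in> order" using linear_order(1) c(2) d(2) by (rule transD)
  moreover have "b \<noteq> d" using antisymD[OF linear_order(2) c(2)] c(3) d(2) by blast
  ultimately show ?thesis
    unfolding before_out[OF b] using d(1) by blast
qed

lemma before_total:
  assumes "b \<noteq> c"
  shows "before b c \<or> before c b"
proof (cases "b \<in> K ` I \<and> c \<in> K ` I")
  case True
  then obtain u v where uv: "u \<in> I" "v \<in> I" "b = K u" "c = K v" by blast
  then have "dl_less u v \<or> dl_less v u"
    using assms by (intro ALSW_total) (auto simp: irr_words_def)
  then show ?thesis
    using before_K uv by blast
next
  case False
  have "(b, c) \<in> order \<or> (c, b) \<in> order"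
    using linear_order(3) assms by (auto simp: total_on_def)
  then show ?thesis
    using False assms before_in[of b c] before_in[of c b] before_out[of b c] before_out[of c b] by blast
qed

text \<open>The letters \<open>Ltr (Inl x)\<close> lie outside the range of the encoding and
  generate the free factor.\<close>

sublocale pbw nl_scale nl.br_P basis before "\<lambda>m. Ltr (Inr m) :: ('x + ('x, 'k) NL) oprime"
proof (intro pbw.intro pbw_axioms.intro nl.lie_algebra_br_P)
  show "nl.independent basis" "nl.span basis = UNIV"
    unfolding basis_def by (simp_all add: nl.independent_extend_basis independent_K)
  show "\<not> before b b" for b
    using before_in[of b b] before_out[of b b] dl_less_irrefl by blast
  show "before b d" if "before b c" "before c d" for b c d
    using that by (rule before_trans)
  show "before b c \<or> before c b" if "b \<noteq> c" for b c
    using that by (rule before_total)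
qed (auto simp: inj_on_def)

abbreviation U_br where
  "U_br f g \<equiv> NFl (comm f g)"

text \<open>The representation of the free Nijenhuis algebra \<open>N\<close> that separates words: \<open>N\<close> times the enveloping
  algebra, with operator \<open>(a, f) \<mapsto> (P a, a)\<close>. This operator is Nijenhuis because the
  inclusion into the enveloping algebra is a homomorphism for the deformed bracket of \<open>N\<close>.\<close>

lemma nijenhuis_stage: "nijenhuis_lie_algebra
    (\<lambda>c x. (nl_scale c (fst x), scal c (snd x)))
    (\<lambda>x y. (nl_br (fst x) (fst y), U_br (snd x) (snd y)))
    (\<lambda>x. (nl_P (fst x), incl (fst x)))"
proof -
  interpret p: lie_algebra "\<lambda>c x. (nl_scale c (fst x), scal c (snd x))"
    "\<lambda>x y. (nl_br (fst x) (fst y), U_br (snd x) (snd y))"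
    by (rule lie_algebra_prod[OF nl.lie_algebra_axioms lie_algebra_NFl])
  show ?thesis
  proof (rule nijenhuis_lie_algebra.intro[OF p.lie_algebra_axioms nijenhuis_lie_algebra_axioms.intro])
    let ?s = "\<lambda>c (x :: ('x, 'k) NL \<times> ('x + ('x, 'k) NL, 'k) opoly). (nl_scale c (fst x), scal c (snd x))"
    show "Vector_Spaces.linear ?s ?s (\<lambda>x. (nl_P (fst x), incl (fst x)))"
      by (simp add: Vector_Spaces.linear_iff p.vector_space_axioms nl.P_simps incl_simps)
  qed (simp add: nl.nijenhuis NFl_comm_incl nl.br_P_def incl_simps)
qed

definition hom :: "('x, 'k) NL \<Rightarrow> ('x, 'k) NL \<times> ('x + ('x, 'k) NL, 'k) opoly" where
  "hom = (SOME h. nijenhuis_hom nl_scale nl_br nl_P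
    (\<lambda>c x. (nl_scale c (fst x), scal c (snd x)))
    (\<lambda>x y. (nl_br (fst x) (fst y), U_br (snd x) (snd y)))
    (\<lambda>x. (nl_P (fst x), incl (fst x))) h \<and>
    (\<forall>x. h (nl_class (gen x)) = (nl_class (gen x), word [Ltr (Inl x)])))"

lemma hom: "nijenhuis_hom nl_scale nl_br nl_P
    (\<lambda>c x. (nl_scale c (fst x), scal c (snd x)))
    (\<lambda>x y. (nl_br (fst x) (fst y), U_br (snd x) (snd y)))
    (\<lambda>x. (nl_P (fst x), incl (fst x))) hom"
  "hom (nl_class (gen x)) = (nl_class (gen x), word [Ltr (Inl x)])"
  using someI_ex[OF NL_hom_exists[OF nijenhuis_stage, of "\<lambda>x. (nl_class (gen x), word [Ltr (Inl x)])"],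
      folded hom_def] by simp_all

lemma hom_simps: "hom (x + y) = hom x + hom y"
  "hom (nl_scale c x) = (nl_scale c (fst (hom x)), scal c (snd (hom x)))"
  "hom (nl_br x y) = (nl_br (fst (hom x)) (fst (hom y)), U_br (snd (hom x)) (snd (hom y)))"
  "hom (nl_P x) = (nl_P (fst (hom x)), incl (fst (hom x)))"
  using hom(1) by (auto simp: nijenhuis_hom_def Vector_Spaces.linear_iff)

text \<open>The first component is an endomorphism of the free Nijenhuis algebra that fixes the
  generators. Consequently the second component of the image of \<open>nl_P x\<close> is
  \<open>incl x\<close>.\<close>

lemma fst_hom: "fst (hom x) = x"
proof -
  have "(\<lambda>x. fst (hom x)) = id"
  proof (rule NL_hom_unique)
    show "nijenhuis_hom nl_scale nl_br nl_P nl_scale nl_br nl_P (\<lambda>x. fst (hom x))"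
      "nijenhuis_hom nl_scale nl_br nl_P nl_scale nl_br nl_P id"
      by (simp_all add: nijenhuis_hom_def Vector_Spaces.linear_iff vector_space_nl hom_simps)
  qed (simp add: hom)
  then show ?thesis
    by (metis id_apply)
qed

definition val :: "('x, 'k) opoly \<Rightarrow> ('x + ('x, 'k) NL, 'k) opoly" where
  "val f = snd (hom (nl_class f))"

lemma val_simps: "val (gen x) = word [Ltr (Inl x)]"
  "f \<in> Lie \<Longrightarrow> g \<in> Lie \<Longrightarrow> val (comm f g) = NFl (comm (val f) (val g))"
  "f \<in> Lie \<Longrightarrow> val (opP f) = incl (nl_class f)"
  by (simp_all add: val_def hom nl_class_br nl_class_P hom_simps fst_hom)

definition letter :: "'x oprime \<Rightarrow> ('x + ('x, 'k) NL) oprime" where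
  "letter p = (case p of Ltr x \<Rightarrow> Ltr (Inl x) | Op u \<Rightarrow> Ltr (Inr (K u)))"

definition good_letter :: "'x oprime \<Rightarrow> bool" where
  "good_letter p \<longleftrightarrow> (\<forall>u. p = Op u \<longrightarrow> u \<in> I)"

lemma good_letter_cases:
  assumes "good_letter p"
  obtains x where "p = Ltr x" | u where "p = Op u" "u \<in> I"
  using assms by (cases p) (auto simp: good_letter_def)

lemma K_basis: "u \<in> I \<Longrightarrow> K u \<in> basis"
  using nl.extend_basis_superset[OF independent_K] unfolding basis_def by blast

lemma letter_inj: "good_letter p \<Longrightarrow> good_letter q \<Longrightarrow> letter p = letter q \<longleftrightarrow> p = q"
  using inj_onD[OF inj_K] by (cases p; cases q) (auto simp: letter_def good_letter_def)

lemma letter_descends: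
  assumes "good_letter p" "good_letter q" "descends (letter p) (letter q)"
  shows "\<exists>u v. p = Op u \<and> q = Op v \<and> u \<in> I \<and> v \<in> I \<and> dl_less v u"
proof -
  obtain u v where uv: "p = Op u" "q = Op v" "u \<in> I" "v \<in> I"
    using assms by (cases p; cases q) (auto simp: letter_def good_letter_def descends_def)
  then have "before (K v) (K u)" using assms(3) by (auto simp: letter_def descends_def)
  then show ?thesis
    using uv before_K by blast
qed

lemma letter_eval:
  assumes "good_letter p"
  shows "val (eval_na gen (prime_bracketing p)) = word [letter p]"
  using assms
proof (cases rule: good_letter_cases)
  case (2 u)
  then have "u \<in> ALSW" by (simp add: irr_words_def)
  then have "eval_na gen (prime_bracketing p) = (opP (LS u) :: ('x, 'k) opoly)"
    using 2 by (simp add: LS_def)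
  then show ?thesis
    using 2 K_basis[of u] by (simp add: val_simps LS_in_Lie incl_basis letter_def)
qed (simp add: val_simps letter_def)

text \<open>Primes are sent to single letters and brackets to normalized commutators; by
  \<open>NFl_comm\<close> all normalization can be postponed to the outermost bracket.\<close>

lemma val_brk:
  assumes "\<And>p. p \<in> set (frontier T) \<Longrightarrow> good_letter p"
  shows "val (eval_na gen (naword_of_brk (map_brk prime_bracketing T))) =
    NFl (brk_eval comm (\<lambda>p. word [letter p]) T)"
  using assms
proof (induction T)
  case (Leaf p)
  have "NF [letter p] = word [letter p]"
    by (rule NF_no_descent) (auto simp: descent_def append_eq_Cons_conv Cons_eq_append_conv)
  then show ?case
    using Leaf by (simp add: letter_eval lin_ext_single)
next
  case (Node S T)
  then show ?case
    by (simp add: val_simps eval_na_gen_in_Lie NFl_comm)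
qed

end

section \<open>Triangularity and the step to the next degree\<close>

lemma mult_in_span:
  fixes f g :: "('y, 'k::field) opoly"
  assumes "f \<in> opoly.span A" "g \<in> opoly.span B" and AB: "\<And>a b. a \<in> A \<Longrightarrow> b \<in> B \<Longrightarrow> a * b \<in> opoly.span C"
  shows "f * g \<in> opoly.span C"
  using assms(1)
proof (induction f rule: opoly.span_induct_alt)
  case (step c a f)
  have "a * g \<in> opoly.span C" using assms(2)
    by (induction g rule: opoly.span_induct_alt)
      (auto simp: opoly_bilinear opoly.span_zero AB step.hyps
        intro!: opoly.span_add opoly.span_scale)
  then show ?case
    using step by (auto simp: opoly_bilinear intro!: opoly.span_add opoly.span_scale)
qed (simp add: opoly.span_zero)

context alphabet
begin

abbreviation later :: "'z list \<Rightarrow> 'z list set" where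
  "later w \<equiv> {u. mset u = mset w \<and> w \<sqsubset> u}"

text \<open>In the commutator for a node, the product in reversed order contributes rotations of the
  Lyndon word, which come later; in the direct product, a later term of either factor makes the
  whole later, since permutations have equal length.\<close>

lemma brk_eval_later:
  fixes enc :: "'z \<Rightarrow> 'y oprime"
  assumes "is_NLSW gt T" "set (frontier T) \<subseteq> Z"
  shows "brk_eval comm (\<lambda>z. word [enc z]) T - word (map enc (frontier T)) \<in>
    (opoly.span ((\<lambda>u. word (map enc u)) ` later (frontier T)) :: ('y, 'k::field) opoly set)"
  using assms
proof (induction T)
  case (Leaf z)
  then show ?case by (simp add: opoly.span_zero)
next
  case (Node S T)
  let ?W = "\<lambda>u. word (map enc u) :: ('y, 'k) opoly"
  let ?s = "frontier S" and ?t = "frontier T"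
  let ?f = "brk_eval comm (\<lambda>z. word [enc z]) S :: ('y, 'k) opoly"
  let ?g = "brk_eval comm (\<lambda>z. word [enc z]) T :: ('y, 'k) opoly"
  let ?C = "opoly.span (?W ` later (?s @ ?t))"
  have IH: "?f - ?W ?s \<in> opoly.span (?W ` later ?s)" "?g - ?W ?t \<in> opoly.span (?W ` later ?t)"
    using Node by auto
  have full: "h \<in> opoly.span (?W ` (insert w (later w)))" if "h - ?W w \<in> opoly.span (?W ` later w)" for h w
  proof -
    have "h - ?W w \<in> opoly.span (?W ` (insert w (later w)))"
      using that opoly.span_mono[of "?W ` later w" "?W ` (insert w (later w))"] by blast
    then have "(h - ?W w) + ?W w \<in> opoly.span (?W ` (insert w (later w)))"
      by (rule opoly.span_add) (auto intro: opoly.span_base)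
    then show ?thesis by simp
  qed
  have lyn: "lyn (?s @ ?t)" using is_NLSW_lyn[OF Node.prems] by simp
  have st: "?s @ ?t \<sqsubset> ?t @ ?s" by (rule lyn_rotate[OF lyn]) simp_all
  have app: "u @ v \<sqsubset> u' @ v'" if "u \<sqsubset> u'" "length u = length u'" for u u' v v'
    using that lex_differ_append[OF lex_differI[of gt u u'], of v v'] lex_differD by fastforce
  have W: "?W u * ?W v = ?W (u @ v)" for u v
    by (simp add: word_mult)
  have inC: "?W u \<in> ?C" if "mset u = mset (?s @ ?t)" "?s @ ?t \<sqsubset> u" for u
    by (rule opoly.span_base) (use that in blast)
  have 1: "(?f - ?W ?s) * ?g \<in> ?C"
  proof (rule mult_in_span[OF IH(1) full[OF IH(2)]])
    fix a b assume "a \<in> ?W ` later ?s" "b \<in> ?W ` insert ?t (later ?t)"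
    then obtain u v where "a = ?W u" "b = ?W v" "mset u = mset ?s" "?s \<sqsubset> u" "mset v = mset ?t"
      by auto
    note uv = this
    have "?s @ ?t \<sqsubset> u @ v" by (rule app[OF uv(4) mset_eq_length[OF uv(3)[symmetric]]])
    then show "a * b \<in> ?C" unfolding uv(1,2) W by (intro inC) (simp_all add: uv)
  qed
  have 2: "?W ?s * (?g - ?W ?t) \<in> ?C"
  proof (rule mult_in_span[OF opoly.span_base[of _ "{?W ?s}"] IH(2)])
    fix a b assume "a \<in> {?W ?s}" "b \<in> ?W ` later ?t"
    then obtain v where v: "a = ?W ?s" "b = ?W v" "mset v = mset ?t" "?t \<sqsubset> v" by auto
    then show "a * b \<in> ?C" unfolding v(1,2) W by (intro inC) simp_all
  qed simp
  have 3: "?g * ?f \<in> ?C"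
  proof (rule mult_in_span[OF full[OF IH(2)] full[OF IH(1)]])
    fix a b assume "a \<in> ?W ` insert ?t (later ?t)" "b \<in> ?W ` insert ?s (later ?s)"
    then obtain u v where uv: "a = ?W u" "b = ?W v" "mset u = mset ?t" "mset v = mset ?s" "?t \<sqsubseteq> u" "?s \<sqsubseteq> v"
      by auto
    have "?t @ ?s \<sqsubseteq> u @ v"
    proof (cases "?t = u")
      case True
      then show ?thesis using uv(6) by auto
    next
      case False
      then show ?thesis
        using uv(5) app[OF _ mset_eq_length[OF uv(3)[symmetric]]] by blast
    qed
    then have "?s @ ?t \<sqsubset> u @ v" using st lex_trans by metis
    then show "a * b \<in> ?C" unfolding uv(1,2) W by (intro inC) (simp_all add: uv union_commute)
  qed
  have "brk_eval comm (\<lambda>z. word [enc z]) (Node S T) - ?W (frontier (Node S T)) =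
      (?f - ?W ?s) * ?g + ?W ?s * (?g - ?W ?t) - ?g * ?f"
    by (simp add: comm_def algebra_simps word_mult)
  then show ?case
    using opoly.span_diff[OF opoly.span_add[OF 1 2] 3] by simp
qed

end

lemma irr_words_ALSW: "w \<in> irr_words \<Longrightarrow> w \<in> ALSW"
  by (simp add: irr_words_def)

lemma irr_words_Op:
  assumes "w \<in> irr_words" "Op u \<in> set w"
  shows "u \<in> irr_words"
proof -
  obtain a b where w: "w = a @ Op u # b" using assms(2) by (meson split_list)
  have ab: "\<forall>p\<in>set a \<union> set b. valid_prime p"
    using ALSW_valid[OF irr_words_ALSW[OF assms(1)]] w by auto
  have "\<not> reducible u"
  proof
    assume "reducible u"
    then obtain \<pi> x y where \<pi>: "\<pi> \<in> star_words" "x \<in> ALSW" "y \<in> ALSW" "dl_less y x" "u = plug \<pi> [Op x, Op y]"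
      unfolding reducible_def by blast
    then have "emb a @ Op \<pi> # emb b \<in> star_words" "w = plug (emb a @ Op \<pi> # emb b) [Op x, Op y]"
      using star_words_iff(2)[of a \<pi> b] ab by (auto simp: plug_emb w)
    then have "reducible w" using \<pi> unfolding reducible_def by blast
    then show False
      using assms(1) by (simp add: irr_words_def)
  qed
  then show ?thesis
    using irr_words_ALSW[OF assms(1)] assms(2) by (auto simp: irr_words_def ALSW_iff[of w])
qed

lemma irr_words_no_descent:
  assumes "w \<in> irr_words" "w = a @ Op u # Op v # b" "dl_less v u"
  shows False
proof -
  have "\<forall>p\<in>set a \<union> set b. valid_prime p" "u \<in> ALSW" "v \<in> ALSW"
    using irr_words_ALSW[OF assms(1)] ALSW_valid[of w] assms(2) by (auto simp: ALSW_iff)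
  moreover from this have "emb a @ star # emb b \<in> star_words" "w = plug (emb a @ star # emb b) [Op u, Op v]"
    by (simp_all add: star_words_iff plug_emb assms(2))
  ultimately show False
    using assms(1,3) unfolding irr_words_def reducible_def by blast
qed

context irr_stage
begin

abbreviation J :: "'x oword set" where
  "J \<equiv> {w \<in> irr_words. odeg w \<le> Suc n}"

text \<open>The point where the degree drops: removing the outer \<open>Op\<close> brings the
  argument from degree bound \<open>Suc n\<close> to \<open>n\<close>, where its class is a known
  basis vector.\<close>

lemma good_letter_J:
  assumes "w \<in> J" "p \<in> set w"
  shows "good_letter p"
  unfolding good_letter_def
proof (intro allI impI)
  fix u assume "p = Op u"
  then show "u \<in> I" using irr_words_Op[of w u] pdeg_le_odeg[of p w] assms by auto
qed

lemma NF_irr: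
  assumes "w \<in> J"
  shows "NF (map letter w) = word (map letter w)"
proof (rule NF_no_descent, rule notI, elim exE)
  fix a b c d assume D: "descent (map letter w) a b c d"
  then have "map letter w = a @ Ltr (Inr b) # Ltr (Inr c) # d" by (simp add: descent_def)
  then obtain a' p q d' where w: "w = a' @ p # q # d'" "letter p = Ltr (Inr b)" "letter q = Ltr (Inr c)"
    by (auto simp: map_eq_append_conv map_eq_Cons_conv)
  have "descends (letter p) (letter q)" using D w by (auto simp: descends_def descent_def)
  then obtain u v where "p = Op u" "q = Op v" "dl_less v u"
    using letter_descends[of p q] good_letter_J[OF assms] w by auto
  then show False
    using irr_words_no_descent[of w a' u v d'] assms w by blast
qed

text \<open>Only this implication holds in general: \<open>descends\<close> never compares letters
  that come from \<open>X\<close>, whereas the order of primes does.\<close>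

lemma lex_greater_letter:
  assumes "\<forall>p\<in>set u \<union> set v. good_letter p" "lex_greater descends (map letter u) (map letter v)"
  shows "lex_greater prime_greater u v"
  using assms
proof (induction u arbitrary: v)
  case Nil
  then show ?case by (cases v) auto
next
  case (Cons p u)
  then obtain q v' where v: "v = q # v'" by (cases v) auto
  have "prime_less q p" if d: "descends (letter p) (letter q)"
  proof -
    obtain x y where "p = Op x" "q = Op y" "dl_less y x"
      using letter_descends[OF _ _ d] Cons.prems v by auto
    then show ?thesis
      using dl_less_Op[of y x] by (simp add: dl_less_single)
  qed
  then show ?case
    using Cons letter_inj[of p q] by (auto simp: v)
qed

lemma map_letter_inj:
  assumes "\<forall>p\<in>set u \<union> set v. good_letter p" "map letter u = map letter v"
  shows "u = v"
proof (rule map_inj_on[OF assms(2)])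
  show "inj_on letter (set u \<union> set v)" using assms(1) letter_inj by (auto simp: inj_on_def)
qed

text \<open>\<open>val (LS w)\<close> is the word of \<open>w\<close>, already normal, plus normal
  forms of later permutations. By \<open>NF_top\<close> these involve words shorter than
  \<open>w\<close>, excluded by the length hypothesis, and words of equal length that come later
  still, excluded by the lexicographic one.\<close>

lemma lookup_val_LS:
  assumes w: "w \<in> J" and v: "v \<in> J"
    and len: "length w \<le> length v" and lex: "length w = length v \<Longrightarrow> \<not> lex_greater prime_greater w v"
  shows "coeff (val (LS w)) (map letter v) = (if w = v then 1 else 0)"
proof -
  have good: "\<forall>p\<in>set w. good_letter p" "\<forall>p\<in>set v. good_letter p"
    using good_letter_J w v by blast+
  have T: "is_NLSW prime_greater (prime_brk w)" "frontier (prime_brk w) = w"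
    using primes.shirshov_bracketing ALSW_lyn irr_words_ALSW w by auto
  let ?W = "\<lambda>u. word (map letter u) :: ('x + ('x, 'k) NL, 'k) opoly"
  let ?e = "brk_eval comm (\<lambda>p. word [letter p]) (prime_brk w) :: ('x + ('x, 'k) NL, 'k) opoly"
  have "val (LS w) = NFl ?e"
    using val_brk[of "prime_brk w"] T(2) good w by (simp add: LS_def bracketing_eq irr_words_ALSW)
  then have val: "val (LS w) = ?W w + NFl (?e - ?W w)"
    using NF_irr[OF w] by (simp add: lin_ext_diff lin_ext_single)
  have later: "coeff (NF (map letter u)) (map letter v) = 0" if u: "u \<in> primes.later w" for u
  proof (rule ccontr)
    assume ne: "coeff (NF (map letter u)) (map letter v) \<noteq> 0"
    have mu: "mset u = mset w" and wu: "lex_greater prime_greater w u" using u by auto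
    have lu: "length u = length w" using mset_eq_length[OF mu] .
    have gu: "\<forall>p\<in>set u \<union> set v. good_letter p" using good mset_eq_setD[OF mu] by auto
    obtain w' where w': "mset w' = mset (map letter u)" "w' = map letter u \<or> lex_greater descends (map letter u) w'"
      "\<forall>x\<in>supp (NF (map letter u) - word w'). length x < length (map letter u)"
      using NF_top[of "map letter u"] by blast
    have eq: "w' = map letter v"
    proof (rule ccontr)
      assume "w' \<noteq> map letter v"
      then have "map letter v \<in> supp (NF (map letter u) - word w')"
        using ne by (simp add: in_keys_iff lookup_minus lookup_single)
      then show False
        using w'(3) len lu by fastforce
    qed
    have lv: "length w = length v" using mset_eq_length[OF w'(1)] lu unfolding eq by simp
    have "u = v \<or> lex_greater prime_greater u v"
      using w'(2) map_letter_inj[OF gu] lex_greater_letter[OF gu] unfolding eq by metis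
    then have "lex_greater prime_greater w v" using wu primes.lex_trans[of w u v] by blast
    then show False
      using lex[OF lv] by blast
  qed
  have "coeff (NFl x) (map letter v) = 0" if "x \<in> opoly.span (?W ` primes.later w)" for x
    using that
  proof (induction x rule: opoly.span_induct_alt)
    case (step c x y)
    then obtain u where "x = ?W u" "u \<in> primes.later w" by blast
    then show ?case
      using later[of u] step by (simp add: lin_ext_linear lin_ext_single lookup_add lookup_scal)
  qed (simp add: lin_ext_zero)
  moreover have "?e - ?W w \<in> opoly.span (?W ` primes.later w)"
  proof -
    have "set (frontier (prime_brk w)) \<subseteq> Collect valid_prime"
      using ALSW_valid[OF irr_words_ALSW] w T(2) by auto
    from primes.brk_eval_later[OF T(1) this, of letter] show ?thesis
      by (simp only: T(2))
  qed
  ultimately have "coeff (val (LS w)) (map letter v) = coeff (?W w) (map letter v)"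
    unfolding val lookup_add by simp
  also have "\<dots> = (if w = v then 1 else 0)"
    using map_letter_inj[of w v] good by (auto simp: lookup_single when_def)
  finally show ?thesis .
qed

lemma hom_sum: "snd (hom (\<Sum>w\<in>A. nl_scale (r w) (K w))) = (\<Sum>w\<in>A. scal (r w) (val (LS w)))"
proof (induction A rule: infinite_finite_induct)
  case (infinite A)
  then show ?case
    using hom_simps(2)[of 0 0] by simp
next
  case empty
  then show ?case
    using hom_simps(2)[of 0 0] by simp
next
  case (insert w A)
  then show ?case
    by (simp add: hom_simps val_def)
qed

text \<open>Among the words with nonzero coefficient take the longest, and among those the earliest
  word \<open>v\<close>. By \<open>lookup_val_LS\<close> no other term of the combination
  contributes at \<open>map letter v\<close>, so the coefficient there is
  \<open>r v\<close>.\<close>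

lemma next_stage:
  assumes A: "finite A" "A \<subseteq> J" "(\<Sum>w\<in>A. nl_scale (r w) (K w)) = 0" and w: "w \<in> A"
  shows "r w = 0"
proof (rule ccontr)
  assume "r w \<noteq> 0"
  let ?A = "{w \<in> A. r w \<noteq> 0}"
  define m where "m = Max (length ` ?A)"
  define M where "M = {w \<in> ?A. length w = m}"
  have fin: "finite ?A" "?A \<noteq> {}" using A w \<open>r w \<noteq> 0\<close> by auto
  then have "m \<in> length ` ?A" unfolding m_def by (intro Max_in) auto
  then have "M \<noteq> {}" by (auto simp: M_def)
  moreover have "finite M" using A(1) by (simp add: M_def)
  moreover have "set u \<subseteq> Collect valid_prime" if "u \<in> M" for u
    using that A(2) ALSW_valid[OF irr_words_ALSW, of u] by (auto simp: M_def)
  ultimately obtain v where "v \<in> M" and min: "\<forall>u\<in>M. v = u \<or> lex_greater prime_greater v u"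
    using primes.ex_min_word[of M] by blast
  then have v: "v \<in> A" "r v \<noteq> 0" "length v = m" by (auto simp: M_def)
  have "(\<Sum>u\<in>?A. scal (r u) (val (LS u))) = (\<Sum>u\<in>A. scal (r u) (val (LS u)))"
    using A(1) by (intro sum.mono_neutral_left) auto
  also have "\<dots> = 0" using hom_sum[of r A] hom_simps(2)[of 0 0] A(3) by simp
  finally have "(\<Sum>u\<in>?A. r u * coeff (val (LS u)) (map letter v)) = 0"
    by (metis (no_types, lifting) lookup_scal lookup_sum lookup_zero sum.cong)
  moreover have "(\<Sum>u\<in>?A. r u * coeff (val (LS u)) (map letter v)) =
      (\<Sum>u\<in>?A. if u = v then r v else 0)"
  proof (rule sum.cong)
    fix u assume u: "u \<in> ?A"
    have le: "length u \<le> length v" unfolding v(3) m_def using u fin(1) by (intro Max_ge) auto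
    have "\<not> lex_greater prime_greater u v" if "length u = length v"
    proof -
      have "v = u \<or> lex_greater prime_greater v u" using min v(3) that u by (auto simp: M_def)
      then show ?thesis
        using primes.lex_irrefl primes.lex_asym by blast
    qed
    then have "coeff (val (LS u)) (map letter v) = (if u = v then 1 else 0)"
      using u v(1) A(2) by (intro lookup_val_LS le) auto
    then show "r u * coeff (val (LS u)) (map letter v) = (if u = v then r v else 0)" by simp
  qed simp
  ultimately show False
    using v fin(1) by simp
qed

end

lemma irr_independent:
  assumes A: "finite A" "A \<subseteq> irr_words"
    and sum: "(\<Sum>w\<in>A. nl_scale (r w) (LS_class w :: ('x::wellorder, 'k::field) NL)) = 0" and w: "w \<in> A"
  shows "r w = 0"
proof -
  have stage: "r w = 0" if "finite A" "A \<subseteq> {w \<in> irr_words. odeg w \<le> n}"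
      "(\<Sum>w\<in>A. nl_scale (r w) (LS_class w :: ('x, 'k) NL)) = 0" "w \<in> A" for n A r w
    using that
  proof (induction n arbitrary: A r w)
    case 0
    then have "odeg w = 0" "w \<noteq> []" using ALSW_nonempty[OF irr_words_ALSW] by auto
    then show ?case by (cases w) auto
  next
    case (Suc n)
    interpret irr_stage n "TYPE(('x, 'k) NL)"
      by standard (rule Suc.IH)
    show ?case
      using Suc.prems by (rule next_stage)
  qed
  have "A \<subseteq> {w \<in> irr_words. odeg w \<le> Max (odeg ` A)}" using A by auto
  from stage[OF A(1) this sum w] show ?thesis .
qed

section \<open>The main theorem\<close>

lemma nl_class_sum:
  assumes "finite A" "\<And>a. a \<in> A \<Longrightarrow> g a \<in> Lie"
  shows "nl_class (\<Sum>a\<in>A. scal (r a) (g a)) = (\<Sum>a\<in>A. nl_scale (r a) (nl_class (g a)))"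
  using assms
proof (induction A rule: finite_induct)
  case (insert a A)
  have "(\<Sum>a\<in>A. scal (r a) (g a)) \<in> Lie"
    using insert.prems by (intro opoly.subspace_sum[OF subspace_Lie] opoly.subspace_scale[OF subspace_Lie]) auto
  then show ?case
    using insert by (simp add: nl_class_add nl_class_scale Lie_closed)
qed (simp add: nl_class_zero)

lemma irr_span_Id:
  fixes x :: "('x::wellorder, 'k::field) opoly"
  assumes "x \<in> opoly.span (LS ` irr_words)" "x \<in> Id_Lie S_N"
  shows "x = 0"
proof -
  have inj: "inj_on LS irr_words" using inj_on_subset[OF inj_on_LS] irr_words_ALSW by blast
  obtain t r where t: "finite t" "t \<subseteq> irr_words" "x = (\<Sum>u\<in>t. scal (r u) (LS u))"
    by (rule opoly.span_family[OF assms(1) inj])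
  have "x \<in> Lie" using assms(2) Id_S_N_Lie by blast
  then have "nl_class x = 0"
    using assms(2) nl_class_eq_iff[of x 0] by (simp add: Lie_closed nl_class_zero)
  moreover have "nl_class x = (\<Sum>u\<in>t. nl_scale (r u) (LS_class u))"
    unfolding t(3) by (rule nl_class_sum[OF t(1) LS_in_Lie])
  ultimately have sum: "(\<Sum>u\<in>t. nl_scale (r u) (LS_class u :: ('x, 'k) NL)) = 0" by simp
  have "r u = 0" if "u \<in> t" for u
    using irr_independent[OF t(1,2) sum that] .
  then show ?thesis
    by (simp add: t(3))
qed

text \<open>The remainder left by reduction lies in the ideal and in the span of irreducible words,
  hence vanishes by independence. What is left is the combination of special words below
  \<open>w\<close>.\<close>

lemma trivial_mod_Id:
  assumes "h \<in> Id_Lie S_N" "keys_below h w"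
  shows "trivial_mod S_N w h"
proof -
  obtain g r where gr: "h = g + r" "g \<in> special_span w" "r \<in> opoly.span (LS ` irr_words)"
    using reduce[OF subsetD[OF Id_S_N_Lie assms(1)] assms(2)] by blast
  have "g \<in> Id_Lie S_N" using gr(2) special_span_Id by blast
  then have "h - g \<in> Id_Lie S_N" using assms(1) opoly.subspace_diff[OF subspace_Id_S_N] by blast
  then have "r = 0" using irr_span_Id[OF gr(3)] gr(1) by simp
  then show ?thesis
    using gr unfolding trivial_mod_def by simp
qed

lemma composition_trivial:
  assumes f: "f \<in> S_N" and g: "g \<in> S_N" and comp: "composition f g w h"
  shows "trivial_mod S_N w h"
proof -
  obtain u v where uv: "u \<in> ALSW" "v \<in> ALSW" "dl_less v u" "lead f = [Op u, Op v]" "has_lead f [Op u, Op v]"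
    using S_N_cases[OF f] by metis
  obtain u' v' where uv': "u' \<in> ALSW" "v' \<in> ALSW" "dl_less v' u'" "lead g = [Op u', Op v']" "[Op u', Op v'] \<in> ALSW"
    using S_N_cases[OF g] by metis
  have Id: "f \<in> Id_Lie S_N" using f Id_S_N_superset by blast
  from comp show ?thesis
  proof cases
    case (intersection a b)
    have "a \<noteq> []" "b \<noteq> []" using intersection by (auto simp: owords_iff)
    \<comment> \<open>Leading words have breadth two, so a breadth below four with nonempty
      \<open>a\<close> and \<open>b\<close> leaves only an overlap in one prime:
      \<open>w = P(u)P(v)P(v')\<close>.\<close>
    moreover have "[Op u, Op v] @ a = b @ [Op u', Op v']" "length ([Op u, Op v] @ a) < 4"
      using intersection uv uv' by auto
    ultimately have ab: "a = [Op v']" "b = [Op u]" "u' = v"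
      by (auto simp: Cons_eq_append_conv append_eq_Cons_conv)
    have pu: "prime_less (Op v) (Op u)" using dl_less_Op[OF uv(3)] by (simp add: dl_less_single)
    \<comment> \<open>Since \<open>u > v\<close>, the word \<open>[Op u]\<close> precedes
      \<open>[Op v, Op v']\<close>, and both are Lyndon. Thus \<open>w\<close> is in
      \<open>ALSW\<close> and both special words are admissible with leading word \<open>w\<close>,
      which cancels in the difference.\<close>
    have "primes.lyn ([Op u] @ [Op v, Op v'])"
      using uv uv' ab pu ALSW_lyn LS_prime_valid[of "Op u"]
      by (intro primes.lyn_append primes.lyn_letter) auto
    then have w: "w \<in> ALSW" using intersection(2) uv uv' ab by (simp add: ALSW_iff)
    have pl: "plug (star # emb a) (lead f) = w" "plug (emb b @ [star]) (lead g) = w"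
      using plug_emb(1)[of "[]" a "lead f"] plug_emb(1)[of b "[]" "lead g"] intersection by simp_all
    have st: "star # emb a \<in> star_words" "emb b @ [star] \<in> star_words"
      using star_words_iff(1)[of "[]" a] star_words_iff(1)[of b "[]"] intersection(4,5) by (auto simp: owords_iff)
    have "admissible (star # emb a) f" "admissible (emb b @ [star]) g"
      using st pl w by (simp_all add: admissible_def)
    note sp = special_word_S_N[OF f this(1)] special_word_S_N[OF g this(2)]
    show ?thesis
      unfolding intersection(1)
      using sp has_lead_diff opoly.subspace_diff[OF subspace_Id_S_N] unfolding pl
      by (intro trivial_mod_Id) auto
  next
    case (inclusion \<pi>)
    have w: "w \<in> ALSW" using inclusion(2) uv Op_Op_ALSW by simp
    then have "admissible \<pi> g" using inclusion by (simp add: admissible_def)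
    note sp = special_word_S_N[OF g this]
    have "has_lead f w" using inclusion(2) uv by simp
    then show ?thesis
      unfolding inclusion(1)
      using sp Id has_lead_diff opoly.subspace_diff[OF subspace_Id_S_N] unfolding inclusion(3)[symmetric]
      by (intro trivial_mod_Id) auto
  qed
qed

lemma irr_span_UNIV: "nl.span (LS_class ` irr_words) = (UNIV :: ('x::wellorder, 'k::field) NL set)"
proof (intro equalityI subsetI)
  fix x :: "('x, 'k) NL"
  obtain f where f: "f \<in> Lie" "x = nl_class f" by (rule nl_cases)
  obtain y where y: "y \<in> opoly.span (LS ` irr_words)" "f - y \<in> Id_Lie S_N"
    using Lie_mod_Id[OF f(1)] by blast
  have inj: "inj_on LS irr_words" using inj_on_subset[OF inj_on_LS] irr_words_ALSW by blast
  obtain t r where t: "finite t" "t \<subseteq> irr_words" "y = (\<Sum>u\<in>t. scal (r u) (LS u))"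
    by (rule opoly.span_family[OF y(1) inj])
  have "y \<in> Lie"
    unfolding t(3) by (intro opoly.subspace_sum[OF subspace_Lie] opoly.subspace_scale[OF subspace_Lie] LS_in_Lie)
  then have "x = nl_class y" using f y(2) nl_class_eq_iff by blast
  also have "\<dots> = (\<Sum>u\<in>t. nl_scale (r u) (LS_class u))"
    unfolding t(3) by (rule nl_class_sum[OF t(1) LS_in_Lie])
  also have "\<dots> \<in> nl.span (LS_class ` irr_words)"
    using t(2) by (intro nl.span_sum nl.span_scale nl.span_base) auto
  finally show "x \<in> nl.span (LS_class ` irr_words)" .
qed simp

lemma Irr_S_N_basis: "is_linear_basis (nl_scale :: 'k \<Rightarrow> ('x::wellorder, 'k::field) NL \<Rightarrow> ('x, 'k) NL)
    (Irr_S_N :: 'x naword set) (\<lambda>t. nl_class (eval_na gen t))"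
proof -
  have ind: "inj_on (LS_class :: _ \<Rightarrow> ('x, 'k) NL) irr_words"
    "nl.independent ((LS_class :: _ \<Rightarrow> ('x, 'k) NL) ` irr_words)"
    using nl.family_independent[of irr_words LS_class] irr_independent by blast+
  have im: "(\<lambda>t. nl_class (eval_na gen t)) ` Irr_S_N = (LS_class :: _ \<Rightarrow> ('x, 'k) NL) ` irr_words"
    by (auto simp: Irr_S_N_eq LS_def)
  have "inj_on (\<lambda>t. nl_class (eval_na gen t) :: ('x, 'k) NL) Irr_S_N"
    using ind(1) unfolding Irr_S_N_eq by (auto simp: inj_on_def LS_def)
  then show ?thesis
    using ind(2) irr_span_UNIV by (simp add: is_linear_basis_def im)
qed

theorem theorem4p3:
  shows "GS_basis (S_N :: ('x::wellorder, 'k::field) opoly set)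
    \<and> nijenhuis_lie_algebra (nl_scale :: 'k \<Rightarrow> ('x, 'k) NL \<Rightarrow> ('x, 'k) NL) nl_br nl_P
    \<and> (\<forall>(scale :: 'k \<Rightarrow> 'l::ab_group_add \<Rightarrow> 'l) br P (\<phi> :: 'x \<Rightarrow> 'l).
         nijenhuis_lie_algebra scale br P \<longrightarrow>
         (\<exists>!h :: ('x, 'k) NL \<Rightarrow> 'l. nijenhuis_hom nl_scale nl_br nl_P scale br P h \<and>
            (\<forall>x. h (nl_class (gen x)) = \<phi> x)))
    \<and> is_linear_basis (nl_scale :: 'k \<Rightarrow> ('x, 'k) NL \<Rightarrow> ('x, 'k) NL) (Irr_S_N :: 'x naword set)
         (\<lambda>t. nl_class (eval_na gen t))"
proof (intro conjI allI impI)
  have "monic s" if "s \<in> S_N" for s :: "('x, 'k) opoly"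
    using S_N_cases[OF that] lead_eq(2) by metis
  then show "GS_basis (S_N :: ('x, 'k) opoly set)"
    unfolding GS_basis_def using S_N_subset_Lie composition_trivial by blast
  fix scale :: "'k \<Rightarrow> 'l \<Rightarrow> 'l" and br P and \<phi> :: "'x \<Rightarrow> 'l"
  assume nij: "nijenhuis_lie_algebra scale br P"
  show "\<exists>!h :: ('x, 'k) NL \<Rightarrow> 'l. nijenhuis_hom nl_scale nl_br nl_P scale br P h \<and>
      (\<forall>x. h (nl_class (gen x)) = \<phi> x)"
  proof (rule ex_ex1I[OF NL_hom_exists[OF nij]])
    show "h = h'" if "nijenhuis_hom nl_scale nl_br nl_P scale br P h \<and> (\<forall>x. h (nl_class (gen x)) = \<phi> x)"
      "nijenhuis_hom nl_scale nl_br nl_P scale br P h' \<and> (\<forall>x. h' (nl_class (gen x)) = \<phi> x)"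
      for h h' :: "('x, 'k) NL \<Rightarrow> 'l"
      using that by (intro NL_hom_unique[of scale br P h h']) auto
  qed
qed (rule nijenhuis_nl Irr_S_N_basis)+

end
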